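(* For all $k,m,n \in \mathbb N \cup \{\infty\}$ with $4 \leq k \leq m \leq n$, there exist finitely generated, recursively presented groups $G$ and $H$ with $H \leqslant G$ such that $$\operatorname{asdim}(G) = k,\qquad \operatorname{asdim}_{AN}(G) = m,\qquad \operatorname{asdim}_{AN}(H) = n.$$
   Context: For a metric space $X$ and $n\in\mathbb N$: $\operatorname{asdim}(X)\le n$ means that for every $r>0$ there is a cover of $X$ by sets of uniformly bounded diameter such that every ball of radius $r$ meets at most $n+1$ members of the cover. $\operatorname{asdim}_{AN}(X)\le n$ (asymptotic Assouad–Nagata dimension) means that there exist $C>0$ and $r_0>0$ such that for every $r\ge r_0$ there is a cover of $X$ by sets of diameter at most $Cr$ such that every ball of radius $r$ meets at most $n+1$ members of the cover. $\operatorname{asdim}(X)$ and $\operatorname{asdim}_{AN}(X)$ are the least such $n$ (or $\infty$ if none exists). For a finitely generated group these are computed with respect to the word metric of a finite generating set (the values do not depend on the choice). *)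

theory Defs
  imports "HOL-Algebra.Algebra" "HOL-Library.Nat_Bijection" "HOL-Library.Extended_Nat"
begin

datatype recf = Zf | Sucf | Proj nat | Comp recf "recf list" | Prec recf recf | Mn recf

inductive rec_eval :: "recf \<Rightarrow> nat list \<Rightarrow> nat \<Rightarrow> bool" where
  zero: "rec_eval Zf xs 0"
| succ: "rec_eval Sucf (x # xs) (Suc x)"
| proj: "i < length xs \<Longrightarrow> rec_eval (Proj i) xs (xs ! i)"
| comp: "length ys = length hs \<Longrightarrow> (\<forall>i<length hs. rec_eval (hs ! i) xs (ys ! i))
          \<Longrightarrow> rec_eval g ys y \<Longrightarrow> rec_eval (Comp g hs) xs y"
| prec0: "rec_eval f xs y \<Longrightarrow> rec_eval (Prec f g) (0 # xs) y"
| precS: "rec_eval (Prec f g) (n # xs) y \<Longrightarrow> rec_eval g (n # y # xs) z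
          \<Longrightarrow> rec_eval (Prec f g) (Suc n # xs) z"
| mn: "rec_eval f (n # xs) 0 \<Longrightarrow> (\<forall>j<n. \<exists>y. rec_eval f (j # xs) (Suc y))
          \<Longrightarrow> rec_eval (Mn f) xs n"

definition re_set :: "nat set \<Rightarrow> bool" where
  "re_set A \<longleftrightarrow> (\<exists>f. A = {x. \<exists>y. rec_eval f [x] y})"

text \<open>Letters: (generator index, inverted?); words are lists of letters.\<close>
type_synonym word = "(nat \<times> bool) list"

definition inv_letter :: "nat \<times> bool \<Rightarrow> nat \<times> bool" where
  "inv_letter l = (fst l, \<not> snd l)"

definition word_code :: "word \<Rightarrow> nat" where
  "word_code w = list_encode (map (\<lambda>(a, b). prod_encode (a, if b then 1 else 0)) w)"

inductive pres_eq :: "word set \<Rightarrow> word \<Rightarrow> word \<Rightarrow> bool" for R where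
  refl: "pres_eq R w w"
| sym: "pres_eq R u v \<Longrightarrow> pres_eq R v u"
| trans: "pres_eq R u v \<Longrightarrow> pres_eq R v w \<Longrightarrow> pres_eq R u w"
| cancel: "pres_eq R (u @ [x, inv_letter x] @ v) (u @ v)"
| relator: "r \<in> R \<Longrightarrow> pres_eq R (u @ r @ v) (u @ v)"

definition pres_class :: "word set \<Rightarrow> word \<Rightarrow> word set" where
  "pres_class R w = {v. pres_eq R w v}"

definition words_over :: "nat \<Rightarrow> word set" where
  "words_over s = {w. \<forall>l \<in> set w. fst l < s}"

definition pres_group :: "nat \<Rightarrow> word set \<Rightarrow> word set monoid" where
  "pres_group s R = \<lparr> carrier = pres_class R ` words_over s,
      monoid.mult = (\<lambda>A B. {w. \<exists>a\<in>A. \<exists>b\<in>B. pres_eq R (a @ b) w}),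
      monoid.one = pres_class R [] \<rparr>"

definition rec_presentation :: "nat \<Rightarrow> word set \<Rightarrow> bool" where
  "rec_presentation s R \<longleftrightarrow> R \<subseteq> words_over s \<and> re_set (word_code ` R)"

definition fin_generated :: "('a, 'b) monoid_scheme \<Rightarrow> bool" where
  "fin_generated G \<longleftrightarrow> (\<exists>S. finite S \<and> S \<subseteq> carrier G \<and> generate G S = carrier G)"

definition fg_rec_presented :: "('a, 'b) monoid_scheme \<Rightarrow> bool" where
  "fg_rec_presented G \<longleftrightarrow> group G \<and> fin_generated G \<and>
     (\<exists>s R. rec_presentation s R \<and> is_iso G (pres_group s R))"

definition cball_in :: "'a set \<Rightarrow> ('a \<Rightarrow> 'a \<Rightarrow> real) \<Rightarrow> 'a \<Rightarrow> real \<Rightarrow> 'a set" where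
  "cball_in M dd x r = {y \<in> M. dd x y \<le> r}"

definition meets_at_most :: "'a set \<Rightarrow> ('a \<Rightarrow> 'a \<Rightarrow> real) \<Rightarrow> 'a set set \<Rightarrow> real \<Rightarrow> nat \<Rightarrow> bool" where
  "meets_at_most M dd \<U> r n \<longleftrightarrow> (\<forall>x\<in>M. finite {U \<in> \<U>. U \<inter> cball_in M dd x r \<noteq> {}} \<and>
      card {U \<in> \<U>. U \<inter> cball_in M dd x r \<noteq> {}} \<le> n + 1)"

definition asdim_le :: "'a set \<Rightarrow> ('a \<Rightarrow> 'a \<Rightarrow> real) \<Rightarrow> nat \<Rightarrow> bool" where
  "asdim_le M dd n \<longleftrightarrow> (\<forall>r>0. \<exists>\<U>. \<Union>\<U> = M \<and>
      (\<exists>D. \<forall>U\<in>\<U>. \<forall>x\<in>U. \<forall>y\<in>U. dd x y \<le> D) \<and> meets_at_most M dd \<U> r n)"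

definition asdim_AN_le :: "'a set \<Rightarrow> ('a \<Rightarrow> 'a \<Rightarrow> real) \<Rightarrow> nat \<Rightarrow> bool" where
  "asdim_AN_le M dd n \<longleftrightarrow> (\<exists>C>0. \<exists>r0>0. \<forall>r\<ge>r0. \<exists>\<U>. \<Union>\<U> = M \<and>
      (\<forall>U\<in>\<U>. \<forall>x\<in>U. \<forall>y\<in>U. dd x y \<le> C * r) \<and> meets_at_most M dd \<U> r n)"

text \<open>Least such n, or infinity if there is none (Inf of the empty set of enat is infinity).\<close>
definition asdim :: "'a set \<Rightarrow> ('a \<Rightarrow> 'a \<Rightarrow> real) \<Rightarrow> enat" where
  "asdim M dd = (INF n \<in> {n. asdim_le M dd n}. enat n)"

definition asdim_AN :: "'a set \<Rightarrow> ('a \<Rightarrow> 'a \<Rightarrow> real) \<Rightarrow> enat" where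
  "asdim_AN M dd = (INF n \<in> {n. asdim_AN_le M dd n}. enat n)"

definition word_length :: "('a, 'b) monoid_scheme \<Rightarrow> 'a set \<Rightarrow> 'a \<Rightarrow> nat" where
  "word_length G S g = (LEAST n. \<exists>ws. length ws = n \<and> set ws \<subseteq> S \<union> m_inv G ` S \<and>
      foldr (\<otimes>\<^bsub>G\<^esub>) ws \<one>\<^bsub>G\<^esub> = g)"

definition word_dist :: "('a, 'b) monoid_scheme \<Rightarrow> 'a set \<Rightarrow> 'a \<Rightarrow> 'a \<Rightarrow> real" where
  "word_dist G S g h = real (word_length G S (inv\<^bsub>G\<^esub> g \<otimes>\<^bsub>G\<^esub> h))"

text \<open>Dimensions of a group: computed with any finite generating set (independent of choice).\<close>
definition group_asdim_eq :: "('a, 'b) monoid_scheme \<Rightarrow> enat \<Rightarrow> bool" where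
  "group_asdim_eq G k \<longleftrightarrow> (\<forall>S. finite S \<and> S \<subseteq> carrier G \<and> generate G S = carrier G
      \<longrightarrow> asdim (carrier G) (word_dist G S) = k)"

definition group_asdim_AN_eq :: "('a, 'b) monoid_scheme \<Rightarrow> enat \<Rightarrow> bool" where
  "group_asdim_AN_eq G k \<longleftrightarrow> (\<forall>S. finite S \<and> S \<subseteq> carrier G \<and> generate G S = carrier G
      \<longrightarrow> asdim_AN (carrier G) (word_dist G S) = k)"

end

theory Submission
  imports Defs "HOL-Analysis.Brouwer_Fixpoint"
begin

text \<open>Let \<open>Q\<close> be the fibre product, over the exponent sum of \<open>x\<close>, of the free groups on \<open>x, y\<close> and on
  \<open>x, y', w'\<close>; it sits undistorted in a product of two trees. \<open>G\<close> is the central extension of \<open>Q\<close>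
  by a direct sum of cyclic groups of orders \<open>N d\<close> with generators \<open>z d = [y', Y d]\<close>, where
  \<open>Y d\<close> is the conjugate of \<open>y\<close> by \<open>x ^ d\<close>, and \<open>H\<close> is generated by \<open>x, y, y'\<close>. The norm of
  \<open>c * z d\<close> is about \<open>d\<close> plus the square root of \<open>c\<close>. Hence each of the \<open>k - 2\<close> infinite orders adds one
  to both dimensions, whereas finite orders that are large on a sparse sequence of scales add only
  to the Assouad--Nagata dimension. In \<open>G\<close> the relation \<open>[w', Y d] = q d * z d\<close> with \<open>(q d) ^ 2 = N d\<close> shrinks
  the whole cyclic group to diameter about \<open>d\<close>, so that this dimension is lost in \<open>G\<close> but not in \<open>H\<close>.

  Upper bounds: over bounded parts of the two trees the central coordinates are cut by periodic
  gaps, and each tree costs one more colour. Lower bounds: grids in the directions \<open>y\<close>, \<open>y'\<close> and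
  \<open>z d\<close>, and Kuhn's combinatorial lemma.\<close>

text \<open>Commutators with all conjugates \<open>Y d\<close> let three generators produce
  infinitely many central directions. Reaching \<open>Y d\<close> costs a walk of length
  \<open>d\<close> along \<open>x\<close>, so on a connected part of tree diameter
  \<open>\<rho>\<close> only the coordinates up to \<open>2 * \<rho>\<close> move and all others are
  frozen. The square root comes from bilinearity: \<open>[y' ^ a, Y d ^ b]\<close> is
  \<open>a * b\<close> times \<open>z d\<close>, and conversely a word of length \<open>l\<close>
  shows at most \<open>l ^ 2\<close> in a coordinate. A finite cyclic factor is therefore bounded
  above the square root of its order and resembles a line below it. For \<open>asdim\<close> no rate
  is asked, and finitely many bounded factors per radius are harmless; a linear rate notices every
  factor for which this square root is much larger than \<open>d\<close>. The relation with
  \<open>w'\<close> allows the splitting to be done twice, once in base \<open>q d\<close> and once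
  more within each digit, so that the fourth root of the order takes over, and the orders are chosen
  to keep it at most \<open>d\<close>. Both groups are treated through one complete invariant
  \<open>st\<close> of words, which decides equality in \<open>G\<close> and, on words without
  \<open>w'\<close>, in \<open>H\<close>.\<close>

definition winv :: "word \<Rightarrow> word" where
  "winv w = rev (map inv_letter w)"

lemma inv_letter_inv [simp]: "inv_letter (inv_letter l) = l"
  by (simp add: inv_letter_def)

lemma fst_inv_letter [simp]: "fst (inv_letter l) = fst l"
  by (simp add: inv_letter_def)

lemma inv_letter_pair [simp]: "inv_letter (i, b) = (i, \<not> b)"
  by (simp add: inv_letter_def)

lemma winv_simps [simp]:
  "winv [] = []" "winv (u @ v) = winv v @ winv u" "winv (l # u) = winv u @ [inv_letter l]"
  "winv (winv u) = u" "length (winv u) = length u"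
  by (simp_all add: winv_def rev_map o_def)

lemma words_over_simps [simp]:
  "[] \<in> words_over s" "l # u \<in> words_over s \<longleftrightarrow> fst l < s \<and> u \<in> words_over s"
  "u @ v \<in> words_over s \<longleftrightarrow> u \<in> words_over s \<and> v \<in> words_over s"
  "winv u \<in> words_over s \<longleftrightarrow> u \<in> words_over s"
  by (auto simp: words_over_def winv_def)

lemma words_over_replicate [simp]:
  "i < s \<Longrightarrow> replicate n (i, b) \<in> words_over s"
  by (auto simp: words_over_def)

section \<open>The congruence generated by a set of relators\<close>

lemma pres_eq_ctx: "pres_eq R u v \<Longrightarrow> pres_eq R (a @ u @ b) (a @ v @ b)"
proof (induction rule: pres_eq.induct)
  case (cancel u x v)
  show ?case using pres_eq.cancel[of R "a @ u" x "v @ b"] by simp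
next
  case (relator r u v)
  then show ?case using pres_eq.relator[of r R "a @ u" "v @ b"] by simp
qed (auto intro: pres_eq.intros)

lemma pres_eq_left: "pres_eq R u v \<Longrightarrow> pres_eq R (a @ u) (a @ v)"
  using pres_eq_ctx[of R u v a "[]"] by simp

lemma pres_eq_right: "pres_eq R u v \<Longrightarrow> pres_eq R (u @ b) (v @ b)"
  using pres_eq_ctx[of R u v "[]" b] by simp

lemma pres_eq_append: "pres_eq R u u' \<Longrightarrow> pres_eq R v v' \<Longrightarrow> pres_eq R (u @ v) (u' @ v')"
  by (meson pres_eq.trans pres_eq_left pres_eq_right)

lemma pres_eq_cancel_right: "pres_eq R (u @ winv u) []"
proof (induction u)
  case (Cons l u)
  have "pres_eq R ([l] @ (u @ winv u) @ [inv_letter l]) ([l] @ [] @ [inv_letter l])"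
    by (rule pres_eq_ctx[OF Cons])
  moreover have "pres_eq R ([] @ [l, inv_letter l] @ []) ([] @ [])"
    by (rule pres_eq.cancel)
  ultimately show ?case by simp (erule pres_eq.trans)
qed (simp add: pres_eq.refl)

lemma pres_eq_cancel_left: "pres_eq R (winv u @ u) []"
  using pres_eq_cancel_right[of R "winv u"] by simp

lemma pres_eq_winv: assumes "pres_eq R u v" shows "pres_eq R (winv u) (winv v)"
proof -
  have "pres_eq R (winv u @ v @ winv v) (winv u @ u @ winv v)"
    by (rule pres_eq_ctx[OF pres_eq.sym[OF assms]])
  moreover have "pres_eq R (winv u @ v @ winv v) (winv u @ [])"
    by (rule pres_eq_left[OF pres_eq_cancel_right])
  moreover have "pres_eq R ((winv u @ u) @ winv v) ([] @ winv v)"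
    by (rule pres_eq_right[OF pres_eq_cancel_left])
  ultimately show ?thesis
    by simp (meson pres_eq.trans pres_eq.sym)
qed

lemma pres_eq_iff_quotient: "pres_eq R u v \<longleftrightarrow> pres_eq R (winv v @ u) []"
proof
  assume "pres_eq R u v"
  then have "pres_eq R (winv v @ u) (winv v @ v)" by (rule pres_eq_left)
  then show "pres_eq R (winv v @ u) []" using pres_eq_cancel_left pres_eq.trans by blast
next
  assume a: "pres_eq R (winv v @ u) []"
  have "pres_eq R (v @ winv v @ u) (v @ [])" by (rule pres_eq_left[OF a])
  moreover have "pres_eq R ((v @ winv v) @ u) ([] @ u)"
    by (rule pres_eq_right[OF pres_eq_cancel_right])
  ultimately show "pres_eq R u v" by simp (meson pres_eq.trans pres_eq.sym)
qed

subsection \<open>Free reduction\<close>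

fun push :: "nat \<times> bool \<Rightarrow> word \<Rightarrow> word" where
  "push l [] = [l]"
| "push l (m # t) = (if m = inv_letter l then t else l # m # t)"

definition red :: "word \<Rightarrow> word" where
  "red w = foldr push w []"

fun reduced :: "word \<Rightarrow> bool" where
  "reduced (l # m # t) \<longleftrightarrow> m \<noteq> inv_letter l \<and> reduced (m # t)"
| "reduced _ \<longleftrightarrow> True"

lemma red_simps [simp]: "red [] = []" "red (l # w) = push l (red w)"
  by (simp_all add: red_def)

lemma red_append: "red (u @ v) = foldr push u (red v)"
  by (simp add: red_def)

lemma reduced_push: "reduced t \<Longrightarrow> reduced (push l t)"
  by (cases t rule: reduced.cases) auto

lemma reduced_red: "reduced (red w)"
  by (induction w) (auto simp: reduced_push)

text \<open>Prepending a letter is a bijection of the reduced words, inverse to prepending its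
  inverse: the free group acts on reduced words. Invariance of \<open>red\<close> under cancellation
  follows without a confluence argument.\<close>

lemma push_push: "reduced t \<Longrightarrow> push l (push (inv_letter l) t) = t"
  by (cases t rule: reduced.cases) auto

lemma red_pres_eq: "pres_eq {} u v \<Longrightarrow> red u = red v"
proof (induction rule: pres_eq.induct)
  case (cancel u x v)
  then show ?case by (simp add: red_append push_push reduced_red)
qed auto

lemma push_free_eq: "pres_eq R (push l t) (l # t)"
proof (cases t)
  case (Cons m t')
  have "pres_eq R ([] @ [l, inv_letter l] @ t') ([] @ t')" by (rule pres_eq.cancel)
  then show ?thesis using Cons by (auto intro: pres_eq.refl pres_eq.sym)
qed (simp add: pres_eq.refl)

lemma red_free_eq: "pres_eq R (red w) w"
proof (induction w)
  case (Cons l w)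
  have "pres_eq R ([l] @ red w) ([l] @ w)" by (rule pres_eq_left[OF Cons])
  then show ?case using push_free_eq[of R l "red w"] by simp (meson pres_eq.trans)
qed (simp add: pres_eq.refl)

lemma red_eq_iff: "red u = red v \<longleftrightarrow> pres_eq {} u v"
  by (metis red_pres_eq red_free_eq pres_eq.sym pres_eq.trans)

lemma length_push: "length (push l t) \<le> Suc (length t)" "length t \<le> Suc (length (push l t))"
  by (cases t; simp)+

lemma length_red: "length (red w) \<le> length w"
  by (induction w) (auto intro: order.trans[OF length_push(1)])

lemma length_foldr_push:
  "length (foldr push s t) \<le> length s + length t" "length t \<le> length s + length (foldr push s t)"
proof (induction s)
  case (Cons l s)
  { case 1 then show ?case using Cons length_push(1)[of l "foldr push s t"] by simp }
  { case 2 then show ?case using Cons length_push(2)[of "foldr push s t" l] by simp }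
qed auto

lemma set_push: "set (push l t) \<subseteq> insert l (set t)"
  by (cases t) auto

lemma set_red: "set (red w) \<subseteq> set w"
  by (induction w) (use set_push in fastforce)+

lemma take_rev_push:
  "n < length t \<Longrightarrow> take n (rev (push l t)) = take n (rev t)"
  by (cases t) auto

text \<open>Reduced words are the vertices of a tree rooted at the empty word, read from the last
  letter on: \<open>take n (rev t)\<close> is the ancestor of \<open>t\<close> at depth
  \<open>n\<close>. Pushing \<open>length s\<close> letters onto a word that is deeper by at least
  this amount keeps the ancestor.\<close>

lemma take_rev_foldr_push:
  "n + length s \<le> length t \<Longrightarrow> take n (rev (foldr push s t)) = take n (rev t)"
proof (induction s)
  case (Cons l s)
  have "n < length (foldr push s t)" using length_foldr_push(2)[of t s] Cons.prems
    by (cases "length (foldr push s t) = n") (simp_all, (use length_foldr_push(2)[of t s] in linarith)?)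
  then show ?case using Cons by (simp add: take_rev_push)
qed simp

subsection \<open>Powers of letters\<close>

definition sg :: "bool \<Rightarrow> int" where "sg b = (if b then -1 else 1)"

definition ipow :: "nat \<Rightarrow> int \<Rightarrow> word" where
  "ipow i n = replicate (nat \<bar>n\<bar>) (i, n < 0)"

lemma ipow_0 [simp]: "ipow i 0 = []" by (simp add: ipow_def)
lemma ipow_1 [simp]: "ipow i 1 = [(i, False)]" by (simp add: ipow_def)
lemma ipow_m1 [simp]: "ipow i (-1) = [(i, True)]" by (simp add: ipow_def)
lemma ipow_sg: "ipow i (sg b) = [(i, b)]" by (simp add: sg_def)
lemma winv_ipow [simp]: "winv (ipow i n) = ipow i (- n)"
  by (cases "n = 0") (simp_all add: ipow_def winv_def map_replicate inv_letter_def, auto)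
lemma length_ipow [simp]: "length (ipow i n) = nat \<bar>n\<bar>" by (simp add: ipow_def)
lemma words_over_ipow [simp]: "i < s \<Longrightarrow> ipow i n \<in> words_over s"
  by (simp add: ipow_def)

lemma filter_ipow [simp]: "filter P (ipow i n) = (if P (i, n < 0) then ipow i n else [])"
  by (simp add: ipow_def)

lemma ipow_step: "pres_eq R (ipow i n @ ipow i (sg b)) (ipow i (n + sg b))"
proof -
  have rep: "replicate m a @ [a] = replicate (Suc m) a" for m and a :: "nat \<times> bool"
    by (simp add: replicate_append_same)
  consider "n \<ge> 0" "\<not> b" | "n < 0" "b" | "n > 0" "b" | "n = 0" "b" | "n < 0" "\<not> b" by fastforce
  then show ?thesis
  proof cases
    case 1
    then have "nat \<bar>n + 1\<bar> = Suc (nat \<bar>n\<bar>)" by simp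
    then show ?thesis using 1 rep by (simp add: ipow_def sg_def pres_eq.refl)
  next
    case 2
    then have "nat \<bar>n - 1\<bar> = Suc (nat \<bar>n\<bar>)" by simp
    then show ?thesis using 2 rep by (simp add: ipow_def sg_def pres_eq.refl)
  next
    case 3
    then have "nat \<bar>n\<bar> = Suc (nat \<bar>n - 1\<bar>)" by simp
    then have e: "ipow i n = replicate (nat \<bar>n - 1\<bar>) (i, False) @ [(i,False)]"
      using 3 by (simp add: ipow_def replicate_append_same)
    have "pres_eq R (replicate (nat \<bar>n - 1\<bar>) (i, False) @ [(i,False), inv_letter (i,False)] @ []) (replicate (nat \<bar>n - 1\<bar>) (i, False) @ [])"
      by (rule pres_eq.cancel)
    then show ?thesis using 3 by (simp add: e sg_def) (simp add: ipow_def)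
  next
    case 4 then show ?thesis by (simp add: sg_def pres_eq.refl)
  next
    case 5
    then have "nat \<bar>n\<bar> = Suc (nat \<bar>n + 1\<bar>)" by simp
    then have e: "ipow i n = replicate (nat \<bar>n + 1\<bar>) (i, True) @ [(i,True)]"
      using 5 by (simp add: ipow_def replicate_append_same)
    have c: "pres_eq R (replicate (nat \<bar>n + 1\<bar>) (i, True) @ [(i,True), inv_letter (i,True)] @ []) (replicate (nat \<bar>n + 1\<bar>) (i, True) @ [])"
      by (rule pres_eq.cancel)
    have "replicate (nat \<bar>n + 1\<bar>) (i, True) = ipow i (n + 1)"
      using 5 by (cases "n = -1") (simp_all add: ipow_def)
    then show ?thesis using 5 c by (simp add: e sg_def)
  qed
qed

lemma ipow_add: "pres_eq R (ipow i m @ ipow i n) (ipow i (m + n))"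
proof -
  have *: "pres_eq R (ipow i m @ ipow i (sg b * int k)) (ipow i (m + sg b * int k))" for k b
  proof (induction k)
    case (Suc k)
    have k1: "ipow i (sg b * int (Suc k)) = ipow i (sg b * int k) @ ipow i (sg b)"
      by (simp add: ipow_def sg_def nat_add_distrib replicate_append_same[symmetric])
    have "pres_eq R ((ipow i m @ ipow i (sg b * int k)) @ ipow i (sg b)) (ipow i (m + sg b * int k) @ ipow i (sg b))"
      by (rule pres_eq_right[OF Suc])
    moreover have "pres_eq R (ipow i (m + sg b * int k) @ ipow i (sg b)) (ipow i (m + sg b * int (Suc k)))"
      using ipow_step[of R i "m + sg b * int k" b] by (simp add: algebra_simps)
    ultimately show ?case unfolding k1 append_assoc[symmetric] by (rule pres_eq.trans)
  qed (simp add: pres_eq.refl)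
  show ?thesis using *[of "n < 0" "nat \<bar>n\<bar>"] by (simp add: sg_def split: if_splits)
qed

subsection \<open>Invariants of words\<close>

text \<open>The letters 0, 1, 2, 3 stand for \<open>x\<close>, \<open>y\<close>, \<open>y'\<close>, \<open>w'\<close>.\<close>

definition p1 :: "word \<Rightarrow> word" where "p1 w = filter (\<lambda>l. fst l \<le> 1) w"
definition p2 :: "word \<Rightarrow> word" where "p2 w = filter (\<lambda>l. fst l \<in> {0, 2, 3}) w"

text \<open>\<open>cnt w a\<close> counts the letters \<open>y\<close> at height \<open>a\<close>, where the height is the exponent sum of \<open>x\<close> up to
  the letter; \<open>cent q w d\<close> counts the pairs of a primed letter and a later \<open>y\<close> that is \<open>d\<close> higher.\<close>
fun cnt :: "word \<Rightarrow> int \<Rightarrow> int" where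
  "cnt [] a = 0"
| "cnt ((i, b) # w) a = (if i = 0 then cnt w (a - sg b)
     else if i = 1 then cnt w a + (if a = 0 then sg b else 0) else cnt w a)"

fun cent :: "(int \<Rightarrow> int) \<Rightarrow> word \<Rightarrow> int \<Rightarrow> int" where
  "cent q [] d = 0"
| "cent q ((i, b) # w) d = cent q w d + (if i = 2 then sg b * cnt w d
     else if i = 3 then sg b * q d * cnt w d else 0)"

fun ht :: "word \<Rightarrow> int" where
  "ht [] = 0"
| "ht ((i, b) # w) = (if i = 0 then sg b else 0) + ht w"

text \<open>Since \<open>x mod 0 = x\<close>, the value \<open>N d = 0\<close> stands for a
  coordinate of infinite order, and \<open>N d = 1\<close> makes it trivial. With \<open>cnt\<close>
  on board, every component for \<open>l # w\<close> is a function of the components for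
  \<open>w\<close>.\<close>

definition st :: "(int \<Rightarrow> int) \<Rightarrow> (int \<Rightarrow> int) \<Rightarrow> word \<Rightarrow> word \<times> word \<times> (int \<Rightarrow> int) \<times> (int \<Rightarrow> int)" where
  "st N q w = (red (p1 w), red (p2 w), cnt w, \<lambda>d. cent q w d mod N d)"

lemma p1_simps [simp]: "p1 [] = []" "p1 (u @ v) = p1 u @ p1 v"
  "p1 (l # u) = (if fst l \<le> 1 then l # p1 u else p1 u)" "p1 (winv u) = winv (p1 u)"
  "p1 (p1 u) = p1 u" "length (p1 u) \<le> length u"
  by (simp_all add: p1_def winv_def rev_filter[symmetric] filter_map o_def)

lemma p2_simps [simp]: "p2 [] = []" "p2 (u @ v) = p2 u @ p2 v"
  "p2 (l # u) = (if fst l \<in> {0,2,3} then l # p2 u else p2 u)" "p2 (winv u) = winv (p2 u)"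
  "p2 (p2 u) = p2 u" "length (p2 u) \<le> length u"
  by (simp_all add: p2_def winv_def rev_filter[symmetric] filter_map o_def)

lemma p1_ipow [simp]: "p1 (ipow i n) = (if i \<le> 1 then ipow i n else [])" by (simp add: p1_def)
lemma p2_ipow [simp]: "p2 (ipow i n) = (if i \<in> {0,2,3} then ipow i n else [])" by (simp add: p2_def)

lemma sg_not [simp]: "sg (\<not> b) = - sg b" by (simp add: sg_def)
lemma abs_sg [simp]: "\<bar>sg b\<bar> = 1" by (simp add: sg_def)

lemma ht_append [simp]: "ht (u @ v) = ht u + ht v"
  by (induction u rule: ht.induct) auto

lemma ht_winv [simp]: "ht (winv u) = - ht u"
  by (induction u rule: ht.induct) auto

lemma ht_p1 [simp]: "ht (p1 u) = ht u" by (induction u rule: ht.induct) auto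
lemma ht_p2 [simp]: "ht (p2 u) = ht u" by (induction u rule: ht.induct) auto

lemma cnt_append: "cnt (u @ v) a = cnt u a + cnt v (a - ht u)"
  by (induction u a rule: cnt.induct) (auto simp: algebra_simps)

lemma cnt_p1 [simp]: "cnt (p1 v) = cnt v"
proof
  show "cnt (p1 v) a = cnt v a" for a by (induction v a rule: cnt.induct) auto
qed

lemma cnt_p2 [simp]: "cnt (p2 v) = (\<lambda>_. 0)"
proof
  show "cnt (p2 v) a = 0" for a by (induction v a rule: cnt.induct) auto
qed

lemma cent_p1 [simp]: "cent q (p1 v) = (\<lambda>_. 0)"
proof
  show "cent q (p1 v) a = 0" for a by (induction q v a rule: cent.induct) auto
qed

text \<open>The cross term is the cocycle of the central extension: primed letters of
  \<open>u\<close> are paired with letters \<open>y\<close> of \<open>v\<close>. Only the two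
  projections enter, because both retain the letters \<open>x\<close> that carry the height.\<close>

lemma cent_append: "cent q (u @ v) d = cent q u d + cent q (p2 u @ p1 v) d + cent q v d"
  by (induction q u d rule: cent.induct) (auto simp: cnt_append algebra_simps)

lemma cent_p2_append: "cent q (p2 u @ v) d = cent q (p2 u @ p1 v) d + cent q v d"
proof -
  have "cent q (p2 u) d = 0" for d by (induction q u d rule: cent.induct) auto
  then show ?thesis using cent_append[of q "p2 u" v] by simp
qed

lemma cnt_ipow0 [simp]: "cnt (ipow 0 n @ v) a = cnt v (a - n)"
proof -
  have "cnt (replicate k (0, b) @ v) a = cnt v (a - int k * sg b)" for k b
    by (induction k arbitrary: a) (auto simp: algebra_simps)
  then show ?thesis by (auto simp: ipow_def sg_def)
qed

lemma cnt_ipow1 [simp]: "cnt (ipow 1 n @ v) a = cnt v a + (if a = 0 then n else 0)"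
proof -
  have "cnt (replicate k (1, b) @ v) a = cnt v a + (if a = 0 then int k * sg b else 0)" for k b
    by (induction k arbitrary: a) (auto simp: algebra_simps)
  then show ?thesis by (auto simp: ipow_def sg_def)
qed

lemmas [simp] = cnt_ipow1[unfolded One_nat_def]

lemma cnt_ipow_primed [simp]: "1 < i \<Longrightarrow> cnt (ipow i n @ v) = cnt v"
proof -
  assume i: "1 < i"
  have "cnt (replicate k (i, b) @ v) a = cnt v a" for k b a
    by (induction k arbitrary: a) (use i in \<open>auto simp: algebra_simps\<close>)
  then show ?thesis by (auto simp: ipow_def)
qed

lemma cent_ipow01 [simp]: "i \<le> 1 \<Longrightarrow> cent q (ipow i n @ v) = cent q v"
proof -
  assume i: "i \<le> 1"
  have "cent q (replicate k (i, b) @ v) a = cent q v a" for k b a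
    by (induction k arbitrary: a) (use i in \<open>auto simp: algebra_simps\<close>)
  then show ?thesis by (auto simp: ipow_def)
qed

lemma cent_ipow2 [simp]: "cent q (ipow 2 n @ v) d = cent q v d + n * cnt v d"
proof -
  have "cnt (replicate k (2, b) @ v) = cnt v" for k b
    using cnt_ipow_primed[of 2 "sg b * int k" v] by (cases "k = 0") (auto simp: ipow_def sg_def split: if_splits)
  then have "cent q (replicate k (2, b) @ v) d = cent q v d + sg b * int k * cnt v d" for k b
    by (induction k arbitrary: d) (auto simp: algebra_simps)
  then show ?thesis by (auto simp: ipow_def sg_def)
qed

lemma ht_ipow [simp]: "ht (ipow i n) = (if i = 0 then n else 0)"
proof -
  have "ht (replicate k (i, b)) = (if i = 0 then int k * sg b else 0)" for k b
    by (induction k) (auto simp: algebra_simps)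
  then show ?thesis by (auto simp: ipow_def sg_def)
qed

text \<open>Prepending a letter acts on invariants, so congruence in the right factor is an
  induction on the left one. Congruence in the left factor is obtained only from completeness of the
  relators.\<close>

lemma st_append_cong: "st N q v = st N q v' \<Longrightarrow> st N q (u @ v) = st N q (u @ v')"
proof (induction u)
  case (Cons l u)
  obtain i b where l: "l = (i, b)" by (cases l)
  have IH: "red (p1 (u @ v)) = red (p1 (u @ v'))" "red (p2 (u @ v)) = red (p2 (u @ v'))"
    "cnt (u @ v) = cnt (u @ v')" "(\<lambda>d. cent q (u @ v) d mod N d) = (\<lambda>d. cent q (u @ v') d mod N d)"
    using Cons unfolding st_def by (simp_all del: p1_simps p2_simps)
  have "cent q (l # u @ v) d mod N d = cent q (l # u @ v') d mod N d" for d
    using fun_cong[OF IH(4), of d] IH(3) by (auto simp: l intro: mod_add_cong)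
  moreover have "cnt (l # u @ v) = cnt (l # u @ v')"
    using IH(3) by (intro ext) (simp add: l)
  ultimately show ?case using IH(1,2) by (simp add: st_def)
qed simp

lemma st_cancel: "st N q (u @ [x, inv_letter x] @ v) = st N q (u @ v)"
proof (rule st_append_cong)
  have "red (p1 ([x, inv_letter x] @ v)) = red (p1 v)" by (simp add: push_push reduced_red)
  moreover have "red (p2 ([x, inv_letter x] @ v)) = red (p2 v)" by (simp add: push_push reduced_red)
  moreover have "cnt ([x, inv_letter x] @ v) = cnt v" by (cases x) (auto simp: algebra_simps)
  moreover have "cent q ([x, inv_letter x] @ v) = cent q v" by (cases x) (auto simp: algebra_simps)
  ultimately show "st N q ([x, inv_letter x] @ v) = st N q v" unfolding st_def by (simp del: p1_simps p2_simps)
qed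

lemma st_pres_eqI:
  assumes "\<And>r v. r \<in> R \<Longrightarrow> st N q (r @ v) = st N q v"
  shows "pres_eq R u v \<Longrightarrow> st N q u = st N q v"
proof (induction rule: pres_eq.induct)
  case (cancel u x v) show ?case by (rule st_cancel)
next
  case (relator r u v) then show ?case by (intro st_append_cong assms)
qed auto

lemma st_free: "pres_eq {} u v \<Longrightarrow> st N q u = st N q v"
  by (rule st_pres_eqI) auto

subsection \<open>The presentation\<close>

definition Yp :: "int \<Rightarrow> int \<Rightarrow> word" where
  "Yp d b = ipow 0 d @ ipow 1 b @ ipow 0 (- d)"

text \<open>The commutator of \<open>y' ^ a\<close> and \<open>Y d ^ b\<close>, which adds
  \<open>a * b\<close> to coordinate \<open>d\<close> and changes nothing else. Thus
  \<open>Zw d 1 1\<close> is the generator \<open>z d\<close>.\<close>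

definition Zw :: "int \<Rightarrow> int \<Rightarrow> int \<Rightarrow> word" where
  "Zw d a b = ipow 2 a @ Yp d b @ ipow 2 (- a) @ Yp d (- b)"

definition rel_central :: "nat \<Rightarrow> int \<Rightarrow> word" where
  "rel_central g d = Zw d 1 1 @ [(g, False)] @ winv (Zw d 1 1) @ [(g, True)]"

text \<open>Conjugation of \<open>Y d\<close> by \<open>w'\<close> is made equal to conjugation by
  \<open>y' ^ q d\<close>; this is \<open>[w', Y d] = q d * z d\<close> written without a word of
  central letters.\<close>

definition rel_w :: "(int \<Rightarrow> int) \<Rightarrow> int \<Rightarrow> word" where
  "rel_w q d = [(3, False)] @ Yp d 1 @ [(3, True)] @ ipow 2 (q d) @ Yp d (-1) @ ipow 2 (- q d)"

text \<open>The torsion relator is the single commutator with \<open>y' ^ N d\<close> instead of a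
  power of \<open>z d\<close>; for \<open>N d = 0\<close> it is freely trivial, which leaves the
  order infinite.\<close>

definition rels :: "nat \<Rightarrow> (int \<Rightarrow> int) \<Rightarrow> (int \<Rightarrow> int) \<Rightarrow> word set" where
  "rels s N q = {rel_central g d | g d. g < s} \<union> {Zw d (N d) 1 | d. True}
     \<union> (if s = 4 then range (rel_w q) else {})"

lemma winv_Yp [simp]: "winv (Yp d b) = Yp d (- b)" by (simp add: Yp_def)
lemma ht_Yp [simp]: "ht (Yp d b) = 0" by (simp add: Yp_def)
lemma cnt_Yp [simp]: "cnt (Yp d b @ v) a = cnt v a + (if a = d then b else 0)"
  by (auto simp: Yp_def)
lemma cent_Yp [simp]: "cent q (Yp d b @ v) = cent q v" by (simp add: Yp_def)
lemma p1_Yp [simp]: "p1 (Yp d b) = Yp d b" by (simp add: Yp_def)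
lemma p2_Yp [simp]: "p2 (Yp d b) = ipow 0 d @ ipow 0 (- d)" by (simp add: Yp_def)

lemma words_over_Yp [simp]: "2 < s \<Longrightarrow> Yp d b \<in> words_over s" by (simp add: Yp_def)
lemma words_over_Zw [simp]: "2 < s \<Longrightarrow> Zw d a b \<in> words_over s" by (simp add: Zw_def)

lemma red_triv_append: "pres_eq {} u [] \<Longrightarrow> red (u @ v) = red v"
  using pres_eq_right[of "{}" u "[]" v] red_pres_eq by simp

lemma pres_eq_append_triv: "pres_eq R u [] \<Longrightarrow> pres_eq R v [] \<Longrightarrow> pres_eq R (u @ v) []"
  using pres_eq_append[of R u "[]" v "[]"] by simp

lemma pres_eq_conj_triv: "pres_eq R v [] \<Longrightarrow> pres_eq R (u @ v @ winv u) []"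
  using pres_eq_ctx[of R v "[]" u "winv u"] pres_eq_cancel_right[of R u] pres_eq.trans by fastforce

lemma free_ipow: "pres_eq R (ipow i n @ ipow i (- n)) []"
  using pres_eq_cancel_right[of R "ipow i n"] by simp

lemma free_Yp: "pres_eq R (Yp d b @ Yp d (- b)) []"
  using pres_eq_cancel_right[of R "Yp d b"] by simp

lemma p12_Zw: "pres_eq {} (p1 (Zw d a b)) []" "pres_eq {} (p2 (Zw d a b)) []"
proof -
  show "pres_eq {} (p1 (Zw d a b)) []" by (simp add: Zw_def free_Yp)
  have "pres_eq {} (ipow 2 a @ (ipow 0 d @ ipow 0 (- d)) @ winv (ipow 2 a)) []"
    by (intro pres_eq_conj_triv free_ipow)
  from pres_eq_append_triv[OF this free_ipow[of _ 0 d]]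
  show "pres_eq {} (p2 (Zw d a b)) []" by (simp add: Zw_def)
qed

lemma cnt_Zw [simp]: "cnt (Zw d a b @ v) = cnt v"
  by (rule ext) (simp add: Zw_def)

lemma cent_Zw [simp]: "cent q (Zw d a b @ v) d' = cent q v d' + (if d' = d then a * b else 0)"
  by (simp add: Zw_def algebra_simps)

lemma ht_Zw [simp]: "ht (Zw d a b) = 0" by (simp add: Zw_def)

lemma red_Zw [simp]: "red (p1 (Zw d a b) @ v) = red v" "red (p2 (Zw d a b) @ v) = red v"
  using p12_Zw by (simp_all add: red_triv_append)

lemma cent_Zw_inv [simp]: "cent q (winv (Zw d a b) @ v) d' = cent q v d' - (if d' = d then a * b else 0)"
proof -
  have "cent q (Zw d a b @ winv (Zw d a b) @ v) = cent q v"
    using st_free[OF pres_eq_right[OF pres_eq_cancel_right[of _ "Zw d a b"], where b=v], of "\<lambda>_. 0" q]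
    by (simp add: st_def del: cent_Zw cnt_Zw)
  then have "cent q (Zw d a b @ winv (Zw d a b) @ v) d' = cent q v d'" by simp
  then show ?thesis unfolding cent_Zw by simp
qed

lemma rel_sound:
  assumes "r \<in> rels s N q" shows "st N q (r @ v) = st N q v"
proof -
  consider g d where "r = rel_central g d" | d where "r = Zw d (N d) 1" | d where "r = rel_w q d"
    using assms by (auto simp: rels_def split: if_splits)
  then show ?thesis
  proof cases
    case 1
    have a: "st N q (winv (Zw d 1 1) @ Zw d 1 1 @ w) = st N q w" for w
      using st_free[OF pres_eq_right[OF pres_eq_cancel_left[of _ "Zw d 1 1"], where b=w], of N q] by simp
    have b: "st N q (l # Zw d 1 1 @ w) = st N q (Zw d 1 1 @ l # w)" for l w
    proof -
      obtain i b where l: "l = (i, b)" by (cases l)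
      have "cent q (l # Zw d 1 1 @ w) = cent q (Zw d 1 1 @ l # w)"
        by (rule ext) (simp add: l)
      moreover have "cnt (l # Zw d 1 1 @ w) = cnt (Zw d 1 1 @ l # w)"
        by (rule ext) (simp add: l)
      ultimately show ?thesis by (simp add: st_def)
    qed
    \<comment> \<open>The rule for the inverse follows from the previous one by inserting
      \<open>Zw d 1 1 @ winv (Zw d 1 1)\<close> behind the letter.\<close>
    have c: "st N q (winv (Zw d 1 1) @ l # w) = st N q (l # winv (Zw d 1 1) @ w)" for l w
    proof -
      have f: "pres_eq {} (Zw d 1 1 @ winv (Zw d 1 1) @ w) w"
        using pres_eq_right[OF pres_eq_cancel_right[of _ "Zw d 1 1"], where b=w] by simp
      have "st N q (winv (Zw d 1 1) @ l # Zw d 1 1 @ winv (Zw d 1 1) @ w) = st N q (l # winv (Zw d 1 1) @ w)"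
        using st_append_cong[OF b[of l "winv (Zw d 1 1) @ w"], of "winv (Zw d 1 1)"] a by simp
      moreover have "st N q (winv (Zw d 1 1) @ l # Zw d 1 1 @ winv (Zw d 1 1) @ w) = st N q (winv (Zw d 1 1) @ l # w)"
        using st_free[OF pres_eq_left[OF f, where a="winv (Zw d 1 1) @ [l]"]] by simp
      ultimately show ?thesis by simp
    qed
    have "st N q (r @ v) = st N q (Zw d 1 1 @ [(g, False)] @ (winv (Zw d 1 1) @ (g, True) # v))"
      using 1 by (simp add: rel_central_def)
    also have "\<dots> = st N q (Zw d 1 1 @ [(g, False)] @ ((g, True) # winv (Zw d 1 1) @ v))"
      by (intro st_append_cong c)
    also have "\<dots> = st N q (Zw d 1 1 @ winv (Zw d 1 1) @ v)"
      using st_cancel[of N q "Zw d 1 1" "(g, False)" "winv (Zw d 1 1) @ v"] by simp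
    also have "\<dots> = st N q v"
      using st_free[OF pres_eq_right[OF pres_eq_cancel_right[of _ "Zw d 1 1"], where b=v], of N q] by simp
    finally show ?thesis .
  next
    case 2
    have "cent q (r @ v) d' mod N d' = cent q v d' mod N d'" for d' by (simp add: 2)
    then show ?thesis using 2 by (simp add: st_def)
  next
    case 3
    have w1: "cent q ((3, b) # u) d = cent q u d + sg b * q d * cnt u d" for b u d by simp
    have w2: "cnt ((3, b) # u) d = cnt u d" for b u d by simp
    have "cnt (r @ v) = cnt v"
      by (rule ext) (simp add: 3 rel_w_def del: cnt.simps add: w2 cnt.simps(1))
    \<comment> \<open>The two letters \<open>w'\<close> together contribute \<open>q d\<close> to
      coordinate \<open>d\<close>, the two powers of \<open>y'\<close> contribute
      \<open>- q d\<close>.\<close>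
    moreover have "cent q (r @ v) = cent q v"
      by (rule ext) (auto simp: 3 rel_w_def w1 w2 algebra_simps sg_def simp del: cnt.simps cent.simps)
    moreover have "red (p1 (r @ v)) = red (p1 v)"
      using red_triv_append[OF free_Yp[of _ d 1], of "p1 v"] by (simp add: 3 rel_w_def)
    moreover have "red (p2 (r @ v)) = red (p2 v)"
    proof -
      have a: "pres_eq {} ([(3, False)] @ (ipow 0 d @ ipow 0 (-d)) @ winv [(3, False)]) []"
        by (intro pres_eq_conj_triv free_ipow)
      have b: "pres_eq {} (ipow 2 (q d) @ (ipow 0 d @ ipow 0 (-d)) @ winv (ipow 2 (q d))) []"
        by (intro pres_eq_conj_triv free_ipow)
      show ?thesis using red_triv_append[OF pres_eq_append_triv[OF a b], of "p2 v"]
        by (simp add: 3 rel_w_def)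
    qed
    ultimately show ?thesis by (simp add: st_def del: p1_simps p2_simps)
  qed
qed

lemma rels_sound: "pres_eq (rels s N q) u v \<Longrightarrow> st N q u = st N q v"
  by (rule st_pres_eqI) (rule rel_sound)

section \<open>Normal form and completeness of the relators\<close>

declare pres_eq.trans [trans]

lemma pres_eq_insert:
  "pres_eq R (a @ b) (a @ u @ winv u @ b)" "pres_eq R (a @ b) (a @ winv u @ u @ b)"
  using pres_eq_ctx[OF pres_eq_cancel_right[of R u], of a b] pres_eq_ctx[OF pres_eq_cancel_left[of R u], of a b]
  by (auto intro: pres_eq.sym)

definition zl :: "int \<times> bool \<Rightarrow> word" where
  "zl p = (if snd p then winv (Zw (fst p) 1 1) else Zw (fst p) 1 1)"

text \<open>A list of indices with signs is a formal product of central generators. Concatenation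
  and inversion of such products stay within lists, so no exponents have to be tracked before the
  very end.\<close>

definition zw :: "(int \<times> bool) list \<Rightarrow> word" where
  "zw L = concat (map zl L)"

lemma zw_simps [simp]: "zw [] = []" "zw (p # L) = zl p @ zw L" "zw (L @ L') = zw L @ zw L'"
  by (simp_all add: zw_def)

definition csum :: "(int \<times> bool) list \<Rightarrow> int \<Rightarrow> int" where
  "csum L d = (\<Sum>p\<leftarrow>L. if fst p = d then sg (snd p) else 0)"

lemma cent_zw: "cent q (zw L) d = csum L d"
proof -
  have "cent q (zw L @ v) d = csum L d + cent q v d" for v
    by (induction L) (auto simp: csum_def zl_def sg_def)
  from this[of "[]"] show ?thesis by simp
qed

text \<open>Substitutes \<open>z d\<close> for every letter and keeps the signs. As free equality is
  respected, the power laws of \<open>ipow\<close> carry over to powers of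
  \<open>z d\<close>.\<close>

definition zsub :: "int \<Rightarrow> word \<Rightarrow> word" where
  "zsub d u = zw (map (\<lambda>l. (d, snd l)) u)"

lemma zsub_append [simp]: "zsub d (u @ v) = zsub d u @ zsub d v"
  by (simp add: zsub_def)

lemma zsub_free: "pres_eq {} u v \<Longrightarrow> pres_eq R (zsub d u) (zsub d v)"
proof (induction rule: pres_eq.induct)
  case (cancel u x v)
  have "zsub d (u @ [x, inv_letter x] @ v) = zsub d u @ zl (d, snd x) @ winv (zl (d, snd x)) @ zsub d v"
    by (simp add: zsub_def zl_def inv_letter_def)
  then show ?case using pres_eq_insert(1)[of R "zsub d u" "zsub d v" "zl (d, snd x)"]
    by (auto intro: pres_eq.sym)
qed (auto intro: pres_eq.intros)

lemma single_letter_free: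
  "\<forall>l \<in> set u. fst l = i \<Longrightarrow> pres_eq {} u (ipow i (\<Sum>l\<leftarrow>u. sg (snd l)))"
proof (induction u)
  case (Cons l u)
  let ?n = "\<Sum>l\<leftarrow>u. sg (snd l)"
  have "pres_eq {} (l # u) ([l] @ ipow i ?n)" using Cons pres_eq_left[where a = "[l]"] by fastforce
  also have "[l] = ipow i (sg (snd l))" using Cons by (cases l) (auto simp: ipow_sg)
  also have "pres_eq {} (ipow i (sg (snd l)) @ ipow i ?n) (ipow i (sg (snd l) + ?n))" by (rule ipow_add)
  finally show ?case by simp
qed (simp add: pres_eq.refl)

context
  fixes s :: nat and N q :: "int \<Rightarrow> int" and R :: "word set"
  assumes R_def: "R = rels s N q" and s: "s = 3 \<or> s = 4" and N_nonneg: "\<And>d. 0 \<le> N d"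
begin

private abbreviation eqv (infix "\<sim>" 50) where "u \<sim> v \<equiv> pres_eq R u v"

private definition central :: "word \<Rightarrow> bool" where
  "central z \<longleftrightarrow> (\<forall>w\<in>words_over s. z @ w \<sim> w @ z)"

private lemma rels_mem:
  "g < s \<Longrightarrow> rel_central g d \<in> R" "Zw d (N d) 1 \<in> R" "s = 4 \<Longrightarrow> rel_w q d \<in> R"
  by (auto simp: R_def rels_def)

private lemma centralD: "central z \<Longrightarrow> w \<in> words_over s \<Longrightarrow> a @ z @ w @ b \<sim> a @ w @ z @ b"
  using pres_eq_ctx[of R "z @ w" "w @ z" a b] by (simp add: central_def)

private lemma central_append: assumes "central z" "central z'" shows "central (z @ z')"
  unfolding central_def
proof
  fix w assume w: "w \<in> words_over s"
  have "z @ z' @ w \<sim> z @ w @ z'" using centralD[OF assms(2) w, of z "[]"] by simp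
  also have "\<dots> \<sim> w @ z @ z'" using centralD[OF assms(1) w, of "[]" z'] by simp
  finally show "(z @ z') @ w \<sim> w @ z @ z'" by simp
qed

private lemma central_winv: assumes "central z" shows "central (winv z)"
  unfolding central_def
proof
  fix w assume w: "w \<in> words_over s"
  have "winv z @ w \<sim> winv z @ w @ z @ winv z" using pres_eq_insert(1)[of R "winv z @ w" "[]" z] by simp
  also have "\<dots> \<sim> winv z @ z @ w @ winv z" by (rule pres_eq.sym[OF centralD[OF assms w]])
  also have "\<dots> \<sim> w @ winv z" using pres_eq.sym[OF pres_eq_insert(2)[of R "[]" "w @ winv z" z]] by simp
  finally show "winv z @ w \<sim> w @ winv z" .
qed

private lemma central_Zw: "central (Zw d 1 1)"
proof -
  let ?z = "Zw d 1 1"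
  have pos: "?z @ [(g, False)] \<sim> [(g, False)] @ ?z" if "g < s" for g
  proof -
    have "?z @ [(g, False)] \<sim> ?z @ [(g, False)] @ winv ?z @ ?z"
      using pres_eq_insert(2)[of R "?z @ [(g, False)]" "[]" ?z] by simp
    also have "\<dots> \<sim> ?z @ [(g, False)] @ winv ?z @ [(g, True)] @ [(g, False)] @ ?z"
      using pres_eq_insert(2)[of R "?z @ [(g, False)] @ winv ?z" ?z "[(g, False)]"] by simp
    also have "\<dots> \<sim> [(g, False)] @ ?z"
      using pres_eq.relator[OF rels_mem(1)[OF that, of d], of "[]" "[(g, False)] @ ?z"]
      by (simp add: rel_central_def)
    finally show ?thesis .
  qed
  have neg: "?z @ [(g, True)] \<sim> [(g, True)] @ ?z" if "g < s" for g
  proof -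
    have "?z @ [(g, True)] \<sim> [(g, True)] @ [(g, False)] @ ?z @ [(g, True)]"
      using pres_eq_insert(2)[of R "[]" "?z @ [(g, True)]" "[(g, False)]"] by simp
    also have "\<dots> \<sim> [(g, True)] @ ?z @ [(g, False)] @ [(g, True)]"
      using pres_eq_ctx[OF pres_eq.sym[OF pos[OF that]], of "[(g, True)]" "[(g, True)]"] by simp
    also have "\<dots> \<sim> [(g, True)] @ ?z"
      using pres_eq.sym[OF pres_eq_insert(1)[of R "[(g, True)] @ ?z" "[]" "[(g, False)]"]] by simp
    finally show ?thesis .
  qed
  have "?z @ w \<sim> w @ ?z" if "w \<in> words_over s" for w using that
  proof (induction w)
    case (Cons l w)
    obtain g b where l: "l = (g, b)" by (cases l)
    have 1: "?z @ [l] \<sim> [l] @ ?z" using Cons.prems l pos[of g] neg[of g] by (cases b) auto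
    have "?z @ [l] @ w \<sim> [l] @ ?z @ w" using pres_eq_right[OF 1, of w] by simp
    also have "\<dots> \<sim> [l] @ w @ ?z" using Cons by (intro pres_eq_left) auto
    finally show ?case by simp
  qed (simp add: pres_eq.refl)
  then show ?thesis by (simp add: central_def)
qed

private lemma central_zw: "central (zw L)"
proof (induction L)
  case Nil then show ?case by (simp add: central_def pres_eq.refl)
next
  case (Cons p L)
  then show ?case by (auto simp: zl_def intro!: central_append central_winv central_Zw)
qed

private lemma zw_words: "zw L \<in> words_over s"
  by (induction L) (use s in \<open>auto simp: zl_def\<close>)

private definition winvL :: "(int \<times> bool) list \<Rightarrow> (int \<times> bool) list" where
  "winvL L = rev (map (\<lambda>p. (fst p, \<not> snd p)) L)"

private lemma zw_winvL: "zw (winvL L) = winv (zw L)"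
  by (induction L) (auto simp: winvL_def zl_def)

text \<open>Commutation up to a central factor. Centrality makes these pairs closed under products
  and inverses in either argument, which spreads the basic commutators from single letters to
  words.\<close>

private definition com :: "word \<Rightarrow> word \<Rightarrow> (int \<times> bool) list \<Rightarrow> bool" where
  "com g h L \<longleftrightarrow> g \<in> words_over s \<and> h \<in> words_over s \<and> g @ h \<sim> zw L @ h @ g"

private lemma com_ctx: "com g h L \<Longrightarrow> a @ g @ h @ b \<sim> a @ zw L @ h @ g @ b"
  using pres_eq_ctx[of R "g @ h" "zw L @ h @ g" a b] by (simp add: com_def)

private lemma zw_ctx: "w \<in> words_over s \<Longrightarrow> a @ zw L @ w @ b \<sim> a @ w @ zw L @ b"
  by (rule centralD[OF central_zw])

private lemma com_inv_left: assumes "com g h L" shows "com (winv g) h (winvL L)"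
proof -
  let ?z = "zw L"
  have w: "g \<in> words_over s" "h \<in> words_over s" using assms by (auto simp: com_def)
  have "winv g @ h \<sim> winv ?z @ ?z @ winv g @ h"
    using pres_eq_insert(2)[of R "[]" "winv g @ h" ?z] by simp
  also have "\<dots> \<sim> winv ?z @ winv g @ ?z @ h" using w by (intro zw_ctx) simp
  also have "\<dots> \<sim> winv ?z @ winv g @ ?z @ h @ g @ winv g"
    using pres_eq_insert(1)[of R "winv ?z @ winv g @ ?z @ h" "[]" g] by simp
  also have "\<dots> \<sim> winv ?z @ winv g @ g @ h @ winv g"
    using pres_eq.sym[OF com_ctx[OF assms, of "winv ?z @ winv g" "winv g"]] by simp
  also have "\<dots> \<sim> winv ?z @ h @ winv g"
    using pres_eq.sym[OF pres_eq_insert(2)[of R "winv ?z" "h @ winv g" g]] by simp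
  finally show ?thesis using w by (simp add: com_def zw_winvL)
qed

private lemma com_inv_right: assumes "com g h L" shows "com g (winv h) (winvL L)"
proof -
  let ?z = "zw L"
  have w: "g \<in> words_over s" "h \<in> words_over s" using assms by (auto simp: com_def)
  have "g @ winv h \<sim> winv ?z @ ?z @ g @ winv h"
    using pres_eq_insert(2)[of R "[]" "g @ winv h" ?z] by simp
  also have "\<dots> \<sim> winv ?z @ ?z @ winv h @ h @ g @ winv h"
    using pres_eq_insert(2)[of R "winv ?z @ ?z" "g @ winv h" h] by simp
  also have "\<dots> \<sim> winv ?z @ winv h @ ?z @ h @ g @ winv h" using w by (intro zw_ctx) simp
  also have "\<dots> \<sim> winv ?z @ winv h @ g @ h @ winv h"
    using pres_eq.sym[OF com_ctx[OF assms, of "winv ?z @ winv h" "winv h"]] by simp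
  also have "\<dots> \<sim> winv ?z @ winv h @ g"
    using pres_eq.sym[OF pres_eq_insert(1)[of R "winv ?z @ winv h @ g" "[]" h]] by simp
  finally show ?thesis using w by (simp add: com_def zw_winvL)
qed

private lemma com_append_left:
  assumes "com g h L" "com g' h L'" shows "com (g @ g') h (L @ L')"
proof -
  have w: "g \<in> words_over s" "g' \<in> words_over s" "h \<in> words_over s" using assms by (auto simp: com_def)
  have "g @ g' @ h \<sim> g @ zw L' @ h @ g'" using com_ctx[OF assms(2), of g "[]"] by simp
  also have "\<dots> \<sim> zw L' @ g @ h @ g'"
    using pres_eq.sym[OF zw_ctx[OF w(1), of "[]" L' "h @ g'"]] by simp
  also have "\<dots> \<sim> zw L' @ zw L @ h @ g @ g'" by (rule com_ctx[OF assms(1)])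
  also have "\<dots> \<sim> zw L @ zw L' @ h @ g @ g'"
    using zw_ctx[OF zw_words[of L], of "[]" L' "h @ g @ g'"] by simp
  finally show ?thesis using w by (simp add: com_def)
qed

private lemma com_append_right:
  assumes "com g h L" "com g h' L'" shows "com g (h @ h') (L @ L')"
proof -
  have w: "g \<in> words_over s" "h \<in> words_over s" "h' \<in> words_over s" using assms by (auto simp: com_def)
  have "g @ h @ h' \<sim> zw L @ h @ g @ h'" using com_ctx[OF assms(1), of "[]" h'] by simp
  also have "\<dots> \<sim> zw L @ h @ zw L' @ h' @ g" using com_ctx[OF assms(2), of "zw L @ h" "[]"] by simp
  also have "\<dots> \<sim> zw L @ zw L' @ h @ h' @ g"
    by (rule pres_eq.sym[OF zw_ctx[OF w(2)]])
  finally show ?thesis using w by (simp add: com_def)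
qed

private lemma com_cong: assumes "com g h L" "h \<sim> h'" "h' \<in> words_over s" shows "com g h' L"
proof -
  have "g @ h' \<sim> g @ h" by (rule pres_eq_left[OF pres_eq.sym[OF assms(2)]])
  also have "\<dots> \<sim> zw L @ h @ g" using assms(1) by (simp add: com_def)
  also have "\<dots> \<sim> zw L @ h' @ g" by (rule pres_eq_ctx[OF assms(2)])
  finally show ?thesis using assms by (simp add: com_def)
qed

private lemma com_y: "com [(2, False)] (Yp d 1) [(d, False)]"
proof -
  have "[(2, False)] @ Yp d 1 \<sim> [(2, False)] @ Yp d 1 @ [(2, True)] @ [(2, False)]"
    using pres_eq_insert(2)[of R "[(2, False)] @ Yp d 1" "[]" "[(2, False)]"] by simp
  also have "\<dots> \<sim> [(2, False)] @ Yp d 1 @ [(2, True)] @ Yp d (-1) @ Yp d 1 @ [(2, False)]"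
    using pres_eq_insert(2)[of R "[(2, False)] @ Yp d 1 @ [(2, True)]" "[(2, False)]" "Yp d 1"] by simp
  finally show ?thesis using s by (auto simp: com_def zl_def Zw_def)
qed

private lemma com_y_power: "com (ipow 2 (int n)) (Yp d 1) (replicate n (d, False))"
proof (induction n)
  case 0 then show ?case using s by (auto simp: com_def pres_eq.refl)
next
  case (Suc n)
  have "ipow 2 (int (Suc n)) = [(2, False)] @ ipow 2 (int n)" by (simp add: ipow_def nat_add_distrib)
  then show ?case using com_append_left[OF com_y Suc] by simp
qed

private lemma com_y_int: "\<exists>L. com (ipow 2 n) (Yp d 1) L"
proof (cases "n \<ge> 0")
  case True then show ?thesis using com_y_power[of "nat n" d] by auto
next
  case False then show ?thesis using com_inv_left[OF com_y_power[of "nat (- n)" d]] by auto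
qed

text \<open>The relator replaces conjugation by \<open>w'\<close> with conjugation by
  \<open>y' ^ q d\<close>, whose commutator with \<open>Y d\<close> is already known to be a central
  product.\<close>

private lemma com_w: assumes "s = 4" shows "\<exists>L. com [(3, False)] (Yp d 1) L"
proof -
  let ?u = "ipow 2 (q d) @ Yp d (-1) @ ipow 2 (- q d)"
  have wu: "winv ?u = ipow 2 (q d) @ Yp d 1 @ ipow 2 (- q d)" by simp
  obtain L where L: "com (ipow 2 (q d)) (Yp d 1) L" using com_y_int by blast
  have "[(3, False)] @ Yp d 1 \<sim> [(3, False)] @ Yp d 1 @ [(3, True)] @ [(3, False)]"
    using pres_eq_insert(2)[of R "[(3, False)] @ Yp d 1" "[]" "[(3, False)]"] by simp
  also have "\<dots> \<sim> [(3, False)] @ Yp d 1 @ [(3, True)] @ ?u @ winv ?u @ [(3, False)]"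
    using pres_eq_insert(1)[of R "[(3, False)] @ Yp d 1 @ [(3, True)]" "[(3, False)]" ?u] by simp
  also have "\<dots> \<sim> winv ?u @ [(3, False)]"
    using pres_eq.relator[OF rels_mem(3)[OF assms, of d], of "[]" "winv ?u @ [(3, False)]"]
    by (simp add: rel_w_def)
  also have "\<dots> \<sim> zw L @ Yp d 1 @ ipow 2 (q d) @ ipow 2 (- q d) @ [(3, False)]"
    using com_ctx[OF L, of "[]" "ipow 2 (- q d) @ [(3, False)]"] by (simp add: wu)
  also have "\<dots> \<sim> zw L @ Yp d 1 @ [(3, False)]"
    using pres_eq.sym[OF pres_eq_insert(1)[of R "zw L @ Yp d 1" "[(3, False)]" "ipow 2 (q d)"]] by simp
  finally have "[(3, False)] @ Yp d 1 \<sim> zw L @ Yp d 1 @ [(3, False)]" .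
  moreover have "[(3, False)] \<in> words_over s" "Yp d 1 \<in> words_over s" using assms by auto
  ultimately have "com [(3, False)] (Yp d 1) L" unfolding com_def by blast
  then show ?thesis by blast
qed

private lemma com_primed: assumes "fst l < s" "2 \<le> fst l" shows "\<exists>L. com [l] (Yp d (sg b)) L"
proof -
  obtain i c where l: "l = (i, c)" by (cases l)
  have i: "i = 2 \<or> i = 3 \<and> s = 4" using assms s l by auto
  obtain L where "com [(i, False)] (Yp d 1) L" using i com_w[of d] com_y[of d] by blast
  then obtain L where L: "com [(i, c)] (Yp d 1) L" using com_inv_left by (cases c) fastforce+
  then show ?thesis using com_inv_right[OF L] l by (cases b) (auto simp: sg_def)
qed

text \<open>\<open>u @ ipow 0 (- ht u)\<close> is a product of conjugates of \<open>y\<close> and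
  its inverse: appending \<open>y\<close> multiplies it by the conjugate at the current height
  \<open>ht u\<close>, and appending \<open>x\<close> leaves it unchanged.\<close>

private lemma com_primed_word:
  assumes "fst l < s" "2 \<le> fst l" "u \<in> words_over 2"
  shows "\<exists>L. com [l] (u @ ipow 0 (- ht u)) L"
  using assms(3)
proof (induction u rule: rev_induct)
  case Nil
  have "com [l] [] []" using assms by (simp add: com_def pres_eq.refl)
  then show ?case by auto
next
  case (snoc a u)
  obtain i b where a: "a = (i, b)" by (cases a)
  obtain L where L: "com [l] (u @ ipow 0 (- ht u)) L" using snoc by auto
  have u: "u \<in> words_over s" using snoc.prems s by (auto simp: words_over_def)
  consider "i = 0" | "i = 1" using snoc.prems a by fastforce
  then show ?case
  proof cases
    case 1
    have "u @ ipow 0 (sg b) @ ipow 0 (- ht u - sg b) \<sim> u @ ipow 0 (- ht u)"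
      using pres_eq_left[OF ipow_add[of R 0 "sg b" "- ht u - sg b"], of u] by simp
    then have "u @ ipow 0 (- ht u) \<sim> (u @ [a]) @ ipow 0 (- ht (u @ [a]))"
      using 1 a by (simp add: ipow_sg pres_eq.sym)
    then show ?thesis using com_cong[OF L] u s 1 a by force
  next
    case 2
    obtain L' where L': "com [l] (Yp (ht u) (sg b)) L'" using com_primed[OF assms(1,2)] by blast
    have "u @ ipow 0 (- ht u) @ ipow 0 (ht u) @ [a] @ ipow 0 (- ht u) \<sim> u @ [a] @ ipow 0 (- ht u)"
      using pres_eq.sym[OF pres_eq_insert(1)[of R u "[a] @ ipow 0 (- ht u)" "ipow 0 (- ht u)"]] by simp
    then have "(u @ ipow 0 (- ht u)) @ Yp (ht u) (sg b) \<sim> (u @ [a]) @ ipow 0 (- ht (u @ [a]))"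
      using 2 a ipow_sg[of 1 b] by (simp add: Yp_def)
    then show ?thesis using com_cong[OF com_append_right[OF L L']] u s 2 a by force
  qed
qed

text \<open>A central product, the part in the first tree, the part in the second;
  \<open>ipow 0 (- ht v)\<close> removes the exponent of \<open>x\<close> that both projections
  contain. It also brings the first part to height zero, so that a prepended primed letter can pass
  it at the price of a central factor.\<close>

private lemma normal_form:
  assumes "v \<in> words_over s"
  shows "\<exists>L. v \<sim> zw L @ p1 v @ ipow 0 (- ht v) @ p2 v"
  using assms
proof (induction v)
  case Nil
  have "[] \<sim> zw [] @ p1 [] @ ipow 0 (- ht []) @ p2 []" by (simp add: pres_eq.refl)
  then show ?case by blast
next
  case (Cons l v)
  obtain i b where l: "l = (i, b)" by (cases l)
  obtain L where L: "v \<sim> zw L @ p1 v @ ipow 0 (- ht v) @ p2 v" using Cons by auto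
  have ls: "[l] \<in> words_over s" using Cons.prems by simp
  have "[l] @ v \<sim> [l] @ zw L @ p1 v @ ipow 0 (- ht v) @ p2 v" by (rule pres_eq_left[OF L])
  also have "\<dots> \<sim> zw L @ [l] @ p1 v @ ipow 0 (- ht v) @ p2 v"
    using pres_eq.sym[OF zw_ctx[OF ls, of "[]" L]] by simp
  finally have 1: "l # v \<sim> zw L @ [l] @ p1 v @ ipow 0 (- ht v) @ p2 v" by simp
  consider "i = 0" | "i = 1" | "2 \<le> i" by linarith
  then show ?case
  proof cases
    case 1
    have "ipow 0 (- ht v) \<sim> ipow 0 (- ht (l # v)) @ ipow 0 (sg b)"
      using pres_eq.sym[OF ipow_add[of R 0 "- ht (l # v)" "sg b"]] 1 l by simp
    from pres_eq_ctx[OF this, of "zw L @ [l] @ p1 v" "p2 v"]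
    have "zw L @ [l] @ p1 v @ ipow 0 (- ht v) @ p2 v \<sim> zw L @ p1 (l # v) @ ipow 0 (- ht (l # v)) @ p2 (l # v)"
      using 1 l ipow_sg[of 0 b] by (simp del: ht.simps)
    then show ?thesis using \<open>l # v \<sim> _\<close> pres_eq.trans by blast
  next
    case 2 then show ?thesis using \<open>l # v \<sim> _\<close> l by auto
  next
    case 3
    have "p1 v \<in> words_over 2" by (auto simp: p1_def words_over_def)
    then obtain L' where L': "com [l] (p1 v @ ipow 0 (- ht v)) L'"
      using com_primed_word[of l "p1 v"] Cons.prems 3 l by auto
    have "zw L @ [l] @ p1 v @ ipow 0 (- ht v) @ p2 v \<sim> zw L @ zw L' @ p1 v @ ipow 0 (- ht v) @ [l] @ p2 v"
      using com_ctx[OF L', of "zw L" "p2 v"] by simp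
    then have "zw L @ [l] @ p1 v @ ipow 0 (- ht v) @ p2 v \<sim> zw (L @ L') @ p1 (l # v) @ ipow 0 (- ht (l # v)) @ p2 (l # v)"
      using 3 l Cons.prems s by auto
    then show ?thesis using \<open>l # v \<sim> _\<close> pres_eq.trans by blast
  qed
qed

text \<open>The relator kills the commutator of \<open>y' ^ N d\<close> with \<open>Y d\<close>;
  \<open>com_y_power\<close> identifies that commutator with the \<open>N d\<close>-th power of
  \<open>z d\<close>.\<close>

private lemma zsub_torsion: "zsub d (ipow 0 (N d * k)) \<sim> []"
proof -
  have 1: "zsub d (ipow 0 (N d)) \<sim> []"
  proof -
    let ?y = "ipow 2 (N d)"
    have e: "zsub d (ipow 0 (N d)) = zw (replicate (nat (N d)) (d, False))"
      using N_nonneg[of d] by (simp add: zsub_def ipow_def)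
    have c: "com ?y (Yp d 1) (replicate (nat (N d)) (d, False))"
      using com_y_power[of "nat (N d)" d] N_nonneg[of d] by simp
    have "zsub d (ipow 0 (N d)) \<sim> zsub d (ipow 0 (N d)) @ Yp d 1 @ Yp d (-1)"
      using pres_eq_insert(1)[of R "zsub d (ipow 0 (N d))" "[]" "Yp d 1"] by simp
    also have "\<dots> \<sim> zsub d (ipow 0 (N d)) @ Yp d 1 @ ?y @ winv ?y @ Yp d (-1)"
      using pres_eq_insert(1)[of R "zsub d (ipow 0 (N d)) @ Yp d 1" "Yp d (-1)" ?y] by simp
    also have "\<dots> \<sim> Zw d (N d) 1"
      using pres_eq.sym[OF com_ctx[OF c, of "[]" "winv ?y @ Yp d (-1)"]] by (simp add: Zw_def e)
    also have "Zw d (N d) 1 \<sim> []"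
      using pres_eq.relator[OF rels_mem(2)[of d], of "[]" "[]"] by simp
    finally show ?thesis .
  qed
  have 2: "zsub d (ipow 0 (- N d)) \<sim> []"
  proof -
    have "[] \<sim> zsub d (ipow 0 (N d) @ ipow 0 (- N d))"
      using zsub_free[OF pres_eq.sym[OF free_ipow[of "{}" 0 "N d"]], of R d] by (simp add: zsub_def)
    also have "zsub d (ipow 0 (N d) @ ipow 0 (- N d)) \<sim> [] @ zsub d (ipow 0 (- N d))"
      unfolding zsub_append by (rule pres_eq_right[OF 1])
    finally show ?thesis by (simp add: pres_eq.sym)
  qed
  have 3: "zsub d (ipow 0 (N d * (sg b * int k))) \<sim> []" for b k
  proof (induction k)
    case (Suc k)
    have a: "N d * (sg b * int (Suc k)) = N d * sg b + N d * (sg b * int k)" by (simp add: algebra_simps)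
    have "zsub d (ipow 0 (N d * (sg b * int (Suc k)))) \<sim> zsub d (ipow 0 (N d * sg b)) @ zsub d (ipow 0 (N d * (sg b * int k)))"
      unfolding a zsub_append[symmetric] by (rule zsub_free[OF pres_eq.sym[OF ipow_add]])
    also have "\<dots> \<sim> zsub d (ipow 0 (N d * sg b)) @ []" by (rule pres_eq_left[OF Suc])
    also have "\<dots> \<sim> []" using 1 2 by (auto simp: sg_def)
    finally show ?case .
  qed (simp add: zsub_def pres_eq.refl)
  show ?thesis using 3[of "k < 0" "nat \<bar>k\<bar>"] by (auto simp: sg_def split: if_splits)
qed

private lemma zw_partition:
  "zw L \<sim> zw (filter (\<lambda>p. fst p = d) L) @ zw (filter (\<lambda>p. fst p \<noteq> d) L)"
proof (induction L)
  case (Cons p L)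
  let ?A = "zw (filter (\<lambda>p. fst p = d) L)" and ?B = "zw (filter (\<lambda>p. fst p \<noteq> d) L)"
  have 1: "zl p @ zw L \<sim> zl p @ ?A @ ?B" by (rule pres_eq_left[OF Cons])
  have 2: "zl p @ ?A @ ?B \<sim> ?A @ zl p @ ?B"
    using zw_ctx[OF zw_words[of "filter (\<lambda>p. fst p = d) L"], of "[]" "[p]" ?B] by simp
  show ?case
  proof (cases "fst p = d")
    case True then show ?thesis using 1 by simp
  next
    case False then show ?thesis using pres_eq.trans[OF 1 2] by simp
  qed
qed (simp add: pres_eq.refl)

text \<open>Centrality gathers all factors that share the index of the first one; they cancel by
  torsion, and the remaining list is shorter.\<close>

private lemma zw_trivial:
  assumes "\<And>d. N d dvd csum L d" shows "zw L \<sim> []"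
  using assms
proof (induction "length L" arbitrary: L rule: less_induct)
  case less
  show ?case
  proof (cases L)
    case Nil then show ?thesis by (simp add: pres_eq.refl)
  next
    case (Cons p L0)
    define d where "d = fst p"
    let ?A = "filter (\<lambda>p. fst p = d) L" and ?B = "filter (\<lambda>p. fst p \<noteq> d) L"
    have "length ?B < length L" using length_filter_le[of "\<lambda>p. fst p \<noteq> d" L0] by (simp add: Cons d_def less_Suc_eq_le)
    moreover have "N d' dvd csum ?B d'" for d'
    proof -
      have "csum ?B d' = (if d' = d then 0 else csum L d')"
        by (induction L) (auto simp: csum_def)
      then show ?thesis using less.prems[of d'] by simp
    qed
    ultimately have B: "zw ?B \<sim> []" using less.hyps by blast
    let ?u = "map (\<lambda>p. (0::nat, snd p)) ?A"
    have "(\<Sum>l\<leftarrow>?u. sg (snd l)) = csum L d" by (induction L) (auto simp: csum_def)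
    moreover have "pres_eq {} ?u (ipow 0 (\<Sum>l\<leftarrow>?u. sg (snd l)))" by (rule single_letter_free) auto
    ultimately have "pres_eq {} ?u (ipow 0 (csum L d))" by metis
    then have "zsub d ?u \<sim> zsub d (ipow 0 (csum L d))" by (rule zsub_free)
    also have "\<dots> \<sim> []" using zsub_torsion[of d] less.prems[of d] by (auto elim: dvdE)
    also have "zsub d ?u = zw ?A" unfolding zsub_def map_map o_def
      by (rule arg_cong[where f = zw]) (induction L; auto)
    finally have A: "zw ?A \<sim> []" .
    have "zw L \<sim> zw ?A @ zw ?B" by (rule zw_partition)
    also have "\<dots> \<sim> []" by (rule pres_eq_append_triv[OF A B])
    finally show ?thesis .
  qed
qed

text \<open>Trivial projections remove both tree parts and the height from the normal form. What is
  left is a central product, and soundness reads its exponents off the invariant.\<close>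

lemma rels_complete_nil:
  assumes v: "v \<in> words_over s" and t: "st N q v = st N q []"
  shows "pres_eq R v []"
proof -
  obtain L where L: "v \<sim> zw L @ p1 v @ ipow 0 (- ht v) @ p2 v" using normal_form[OF v] by blast
  have f: "pres_eq R' (p1 v) []" "pres_eq R' (p2 v) []" for R'
    using t pres_eq.sym[OF red_free_eq[of R' "p1 v"]] pres_eq.sym[OF red_free_eq[of R' "p2 v"]] by (auto simp: st_def)
  have "ht u = ht u'" if "pres_eq {} u u'" for u u' using that
  proof (induction rule: pres_eq.induct)
    case (cancel u x v) then show ?case by (cases x) simp
  qed auto
  from this[OF f(1)] have h: "ht v = 0" by simp
  have "v \<sim> zw L @ p1 v @ p2 v" using L h by simp
  also have "\<dots> \<sim> zw L @ [] @ []" by (intro pres_eq_append f pres_eq.refl)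
  finally have "v \<sim> zw L @ [] @ []" .
  then have vL: "v \<sim> zw L" by simp
  then have "st N q (zw L) = st N q []" using rels_sound[of s N q] t R_def by metis
  then have "csum L d mod N d = 0" for d unfolding st_def cent_zw by (auto dest: fun_cong[where x = d])
  then have "zw L \<sim> []" by (intro zw_trivial) (simp add: mod_eq_0_iff_dvd)
  with vL show ?thesis by (rule pres_eq.trans)
qed

lemma rels_complete:
  assumes "u \<in> words_over s" "v \<in> words_over s"
  shows "pres_eq R u v \<longleftrightarrow> st N q u = st N q v"
proof
  show "pres_eq R u v \<Longrightarrow> st N q u = st N q v" unfolding R_def by (rule rels_sound)
  assume "st N q u = st N q v"
  then have "st N q (winv v @ u) = st N q (winv v @ v)" by (rule st_append_cong)
  also have "\<dots> = st N q []" by (rule st_free[OF pres_eq_cancel_left])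
  finally have "pres_eq R (winv v @ u) []" using assms by (intro rels_complete_nil) auto
  then show "pres_eq R u v" by (simp add: pres_eq_iff_quotient[of R u v])
qed

end

subsection \<open>Coloured families\<close>

inductive chain :: "('a \<Rightarrow> 'a \<Rightarrow> nat) \<Rightarrow> nat \<Rightarrow> 'a set \<Rightarrow> 'a \<Rightarrow> 'a \<Rightarrow> bool"
  for \<delta> r A where
  start: "x \<in> A \<Longrightarrow> chain \<delta> r A x x"
| step: "chain \<delta> r A x y \<Longrightarrow> z \<in> A \<Longrightarrow> \<delta> y z \<le> r \<Longrightarrow> chain \<delta> r A x z"

text \<open>Instead of \<open>p + 1\<close> families covering \<open>S\<close> one asks for \<open>K\<close> families such that every point
  misses at most \<open>p\<close> of them; this version passes through fibrations.\<close>
definition fam :: "('a \<Rightarrow> 'a \<Rightarrow> nat) \<Rightarrow> nat \<Rightarrow> 'a set \<Rightarrow> nat \<Rightarrow> nat \<Rightarrow> nat \<Rightarrow> bool" where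
  "fam \<delta> K S p r R \<longleftrightarrow> (\<exists>A. (\<forall>x\<in>S. card {i. i < K \<and> x \<notin> A i} \<le> p)
     \<and> (\<forall>i<K. \<forall>x y. chain \<delta> r (A i \<inter> S) x y \<longrightarrow> \<delta> x y \<le> R))"

lemma chain_in: "chain \<delta> r A x y \<Longrightarrow> x \<in> A \<and> y \<in> A"
  by (induction rule: chain.induct) auto

lemma chain_mono: "chain \<delta> r A x y \<Longrightarrow> A \<subseteq> B \<Longrightarrow> r \<le> r' \<Longrightarrow> chain \<delta> r' B x y"
  by (induction rule: chain.induct) (auto intro: chain.intros)

lemma chain_trans:
  assumes "chain \<delta> r A y z" "chain \<delta> r A x y" shows "chain \<delta> r A x z"
  using assms by (induction rule: chain.induct) (auto intro: chain.intros)

text \<open>Confines a chain to a level set: the second conclusion keeps the chain inside the points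
  with property \<open>P\<close>, where a finer bound is available.\<close>

lemma chain_inv:
  assumes "chain \<delta> r A x y" "P x" "\<And>y z. P y \<Longrightarrow> y \<in> A \<Longrightarrow> z \<in> A \<Longrightarrow> \<delta> y z \<le> r \<Longrightarrow> P z"
  shows "P y \<and> chain \<delta> r {z \<in> A. P z} x y"
  using assms(1,2)
proof (induction rule: chain.induct)
  case (step x y z)
  then have "P z" using assms(3)[of y z] chain_in[OF step(1)] by auto
  then show ?case using step by (auto intro: chain.step)
qed (auto intro: chain.intros)

lemma fam_mono: "fam \<delta> K S p r R \<Longrightarrow> p \<le> p' \<Longrightarrow> r' \<le> r \<Longrightarrow> R \<le> R' \<Longrightarrow> fam \<delta> K S p' r' R'"
  unfolding fam_def by (meson order_trans chain_mono subset_refl)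

text \<open>The quotient numbers the intervals between the gaps of length \<open>g\<close> that
  start at \<open>G\<close> modulo \<open>P\<close>; the added \<open>P\<close> avoids truncated
  subtraction. Outside the gaps the remainder is at least \<open>g\<close>, so an upward step
  shorter than \<open>g\<close> cannot enter a new interval.\<close>

lemma shifted_div:
  fixes a P G g :: nat
  assumes P: "0 < P" and G: "G + g \<le> P"
  shows "(a + P - G) div P = (if a mod P < G then a div P else Suc (a div P))" (is ?thesis1)
    and "a mod P < G \<or> G + g \<le> a mod P \<Longrightarrow> P * ((a + P - G) div P) + g \<le> a + P - G"
proof -
  define b c where "b = a mod P" and "c = a div P"
  have a: "a = P * c + b" and b: "b < P" using P by (simp_all add: b_def c_def)
  have 1: "a + P - G = P * c + (b + P - G)" using a G by linarith
  have 2: "b < G \<Longrightarrow> b + P - G < P" using G by linarith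
  have 3: "\<not> b < G \<Longrightarrow> a + P - G = P * Suc c + (b - G)" using a by simp
  have 4: "\<not> b < G \<Longrightarrow> b - G < P" using b by linarith
  show J: ?thesis1
  proof (cases "b < G")
    case True
    then show ?thesis using 1 2 P by (simp add: b_def[symmetric] c_def[symmetric])
  next
    case False
    have "(a + P - G) div P = Suc c + (b - G) div P"
      unfolding 3[OF False] using P by (intro div_mult_self4) simp
    also have "\<dots> = Suc c" using 4[OF False] by simp
    finally have "(a + P - G) div P = Suc c" .
    then show ?thesis using False by (simp add: b_def[symmetric] c_def[symmetric])
  qed
  assume "a mod P < G \<or> G + g \<le> a mod P"
  then consider "b < G" | "\<not> b < G" "G + g \<le> b" unfolding b_def by linarith
  then show "P * ((a + P - G) div P) + g \<le> a + P - G"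
  proof cases
    case 1
    then have "(a + P - G) div P = c" using J by (simp add: b_def c_def)
    then show ?thesis using \<open>a + P - G = P * c + _\<close> G by simp
  next
    case 2
    then have "(a + P - G) div P = Suc c" using J by (simp add: b_def c_def)
    then show ?thesis using 3[OF 2(1)] 2(2) by simp
  qed
qed

section \<open>Families in a pseudometric space\<close>

locale pseudometric =
  fixes \<delta> :: "'a \<Rightarrow> 'a \<Rightarrow> nat"
  assumes dist_self [simp]: "\<delta> x x = 0"
    and dist_sym: "\<delta> x y = \<delta> y x"
    and dist_tri: "\<delta> x z \<le> \<delta> x y + \<delta> y z"
begin

lemma chain_sym:
  assumes "chain \<delta> r A x y" shows "chain \<delta> r A y x"
  using assms
proof (induction rule: chain.induct)
  case (step x y z)
  have "chain \<delta> r A z y"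
    using step chain_in[OF step(1)] dist_sym by (metis chain.intros)
  then show ?case using chain_trans step.IH by metis
qed (auto intro: chain.intros)

text \<open>Chains at scale \<open>r\<close> never pass between different
  \<open>r\<close>-components, so families chosen independently on the components can be
  united.\<close>

lemma fam_components:
  assumes "\<And>x. x \<in> S \<Longrightarrow> fam \<delta> K {y. chain \<delta> r S x y} p r R"
  shows "fam \<delta> K S p r R"
proof -
  define C where "C x = {y. chain \<delta> r S x y}" for x
  have same: "C x = C y" if "chain \<delta> r S x y" for x y
    unfolding C_def using that chain_sym[OF that] by (auto intro: chain_trans)
  let ?ok = "\<lambda>D A. (\<forall>x\<in>D. card {i. i < K \<and> x \<notin> A i} \<le> p)
     \<and> (\<forall>i<K. \<forall>x y. chain \<delta> r (A i \<inter> D) x y \<longrightarrow> \<delta> x y \<le> R)"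
  define F where "F D = (SOME A. ?ok D A)" for D
  have F: "?ok (C x) (F (C x))" if "x \<in> S" for x
  proof -
    have "\<exists>A. ?ok (C x) A" using assms[OF that] unfolding C_def fam_def by blast
    then show ?thesis unfolding F_def by (rule someI_ex)
  qed
  define A where "A i = {x. x \<in> F (C x) i}" for i
  have "card {i. i < K \<and> x \<notin> A i} \<le> p" if "x \<in> S" for x
  proof -
    have "x \<in> C x" using chain.start[OF that] by (simp add: C_def)
    then show ?thesis using F[OF that] by (auto simp: A_def)
  qed
  moreover have "\<delta> x y \<le> R" if "i < K" "chain \<delta> r (A i \<inter> S) x y" for i x y
  proof -
    have xX: "x \<in> S" using chain_in[OF that(2)] by auto
    have "C y = C x \<and> chain \<delta> r {z \<in> A i \<inter> S. C z = C x} x y"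
    proof (rule chain_inv[OF that(2)])
      fix y z assume "C y = C x" "y \<in> A i \<inter> S" "z \<in> A i \<inter> S" "\<delta> y z \<le> r"
      then show "C z = C x" using same[of y z] by (auto intro: chain.intros)
    qed simp
    then have "chain \<delta> r (F (C x) i \<inter> C x) x y"
    proof (elim conjE chain_mono)
      show "{z \<in> A i \<inter> S. C z = C x} \<subseteq> F (C x) i \<inter> C x"
      proof
        fix z assume z: "z \<in> {z \<in> A i \<inter> S. C z = C x}"
        then have "z \<in> C z" by (auto simp: C_def intro: chain.start)
        then show "z \<in> F (C x) i \<inter> C x" using z by (auto simp: A_def)
      qed
    qed simp
    then show ?thesis using F[OF xX] that(1) by blast
  qed
  ultimately show ?thesis unfolding fam_def by blast
qed

text \<open>Restricting to \<open>r\<close>-components supplies the connectivity and the bounded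
  height variation that \<open>hyp\<close> asks for.\<close>

lemma fam_slab:
  assumes hyp: "\<And>B. B \<subseteq> S \<Longrightarrow> (\<forall>x\<in>B. \<forall>y\<in>B. chain \<delta> r B x y)
      \<Longrightarrow> (\<forall>x\<in>B. \<forall>y\<in>B. h x \<le> h y + w) \<Longrightarrow> fam \<delta> K B p r R"
    and Y: "Y \<subseteq> S" "\<And>x y. chain \<delta> r Y x y \<Longrightarrow> h x \<le> h y + (w::nat)"
  shows "fam \<delta> K Y p r R"
proof (rule fam_components, rule hyp)
  fix x assume x: "x \<in> Y"
  let ?C = "{y. chain \<delta> r Y x y}"
  show "?C \<subseteq> S" using chain_in[of \<delta> r Y x] Y(1) by auto
  have c: "chain \<delta> r ?C x y" if "chain \<delta> r Y x y" for y
    using that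
  proof (induction rule: chain.induct)
    case (start x) then show ?case by (simp add: chain.start)
  next
    case (step x y z)
    then show ?case using chain.step[OF step.IH] chain.step[OF step(1)] by simp
  qed
  show "\<forall>y\<in>?C. \<forall>z\<in>?C. chain \<delta> r ?C y z"
  proof (intro ballI)
    fix y z assume "y \<in> ?C" "z \<in> ?C"
    then show "chain \<delta> r ?C y z" using chain_trans[OF c[of z] chain_sym[OF c[of y]]] by simp
  qed
  show "\<forall>y\<in>?C. \<forall>z\<in>?C. h y \<le> h z + w"
  proof (intro ballI)
    fix y z assume "y \<in> ?C" "z \<in> ?C"
    then have "chain \<delta> r Y y z" using chain_trans[of \<delta> r Y x z y] chain_sym[of r Y x y] by simp
    then show "h y \<le> h z + w" by (rule Y(2))
  qed
qed

text \<open>The zones \<open>h mod P < W\<close> are coloured at scale \<open>r\<close>, the annuli between consecutive multiples of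
  \<open>P\<close> at a scale that absorbs the pieces of the zones. Colour \<open>i\<close> changes from one annulus to the
  next in its own gap inside the zone, so that only one more colour is lost.\<close>
lemma fam_tree_step:
  assumes h: "\<And>x y. x \<in> S \<Longrightarrow> y \<in> S \<Longrightarrow> h x \<le> h y + \<delta> x y"
    and hyp: "\<And>r w B. B \<subseteq> S \<Longrightarrow> (\<forall>x\<in>B. \<forall>y\<in>B. chain \<delta> r B x y)
      \<Longrightarrow> (\<forall>x\<in>B. \<forall>y\<in>B. h x \<le> h y + w) \<Longrightarrow> fam \<delta> K B p r (F r w)"
    and K: "0 < K" and W: "W = K * Suc r"
  shows "fam \<delta> K S (Suc p) r (F (F r W + 2 * r) (2 * W) + 2 * (F r W + r))"
proof -
  \<comment> \<open>A zone has room for one gap of width \<open>Suc r\<close> per colour. The other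
    half of the period keeps zones of different annuli more than \<open>r\<close> apart.\<close>
  define P where "P = 2 * W"
  have "1 * Suc r \<le> W" unfolding W using K by (intro mult_le_mono1) simp
  then have Wr: "r < W" "0 < P" by (simp_all add: P_def)
  define Z where "Z = {x \<in> S. h x mod P < W}"
  define M where "M j = {x \<in> S. h x div P = j}" for j
  define R' where "R' = F r W"
  \<comment> \<open>A chain may leave the off-zone points, cross one zone piece of diameter
    \<open>R'\<close> with a step of length \<open>r\<close> at either end, and come back.\<close>
  define r2 where "r2 = R' + 2 * r"
  define R2 where "R2 = F r2 P"
  have near: "h x div P = h y div P" if "x \<in> Z" "y \<in> Z" "\<delta> x y \<le> r" for x y
  proof (rule ccontr)
    assume ne: "h x div P \<noteq> h y div P"
    have *: False if "x \<in> Z" "y \<in> Z" "h x div P < h y div P" "\<delta> x y \<le> r" for x y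
    proof -
      have "h x = P * (h x div P) + h x mod P" "h y \<ge> P * (h y div P)" by simp_all
      moreover have "P * (h x div P) + P \<le> P * (h y div P)"
        using that(3) mult_le_mono2[of "Suc (h x div P)" "h y div P" P] by simp
      moreover have "h x mod P < W" "h y \<le> h x + r"
        using that h[of y x] dist_sym[of x y] by (auto simp: Z_def)
      moreover have "P = W + W" by (simp add: P_def)
      ultimately show False using Wr by linarith
    qed
    show False using *[of x y] *[of y x] ne that dist_sym by (metis linorder_neqE_nat)
  qed
  have "fam \<delta> K Z p r R'" unfolding R'_def
  proof (rule fam_slab[OF hyp])
    show "Z \<subseteq> S" by (auto simp: Z_def)
    fix x y assume c: "chain \<delta> r Z x y"
    have "h y div P = h x div P \<and> chain \<delta> r {z \<in> Z. h z div P = h x div P} x y"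
    proof (rule chain_inv[OF c])
      fix y z assume "h y div P = h x div P" "y \<in> Z" "z \<in> Z" "\<delta> y z \<le> r"
      then show "h z div P = h x div P" using near[of y z] by metis
    qed simp
    then have "P * (h y div P) = P * (h x div P)" by simp
    moreover have "h x = P * (h x div P) + h x mod P" "h y = P * (h y div P) + h y mod P" by simp_all
    moreover have "h x mod P < W" using chain_in[OF c] by (auto simp: Z_def)
    ultimately show "h x \<le> h y + W" by linarith
  qed
  then obtain A where A1: "\<And>x. x \<in> Z \<Longrightarrow> card {i. i < K \<and> x \<notin> A i} \<le> p"
    and A2: "\<And>i x y. i < K \<Longrightarrow> chain \<delta> r (A i \<inter> Z) x y \<Longrightarrow> \<delta> x y \<le> R'"
    unfolding fam_def by blast
  have "fam \<delta> K (M j) p r2 R2" for j unfolding R2_def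
  proof (rule fam_slab[OF hyp])
    show "M j \<subseteq> S" by (auto simp: M_def)
    fix x y assume "chain \<delta> r2 (M j) x y"
    from chain_in[OF this] have "P * (h x div P) = P * (h y div P)" by (auto simp: M_def)
    moreover have "h x = P * (h x div P) + h x mod P" "h y = P * (h y div P) + h y mod P" by simp_all
    moreover have "h x mod P < P" using Wr by simp
    ultimately show "h x \<le> h y + P" by linarith
  qed
  then have "\<forall>j. \<exists>A. (\<forall>x\<in>M j. card {i. i < K \<and> x \<notin> A i} \<le> p)
     \<and> (\<forall>i<K. \<forall>x y. chain \<delta> r2 (A i \<inter> M j) x y \<longrightarrow> \<delta> x y \<le> R2)" unfolding fam_def by blast
  from choice[OF this] obtain C where C: "\<forall>j. (\<forall>x\<in>M j. card {i. i < K \<and> x \<notin> C j i} \<le> p)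
     \<and> (\<forall>i<K. \<forall>x y. chain \<delta> r2 (C j i \<inter> M j) x y \<longrightarrow> \<delta> x y \<le> R2)" by blast
  have C1: "card {i. i < K \<and> x \<notin> C j i} \<le> p" if "x \<in> M j" for j x
    using C that by blast
  have C2: "\<delta> x y \<le> R2" if "i < K" "chain \<delta> r2 (C j i \<inter> M j) x y" for j i x y
    using C that by blast
  let ?g = "Suc r"
  define gap where "gap i = {x. h x mod P div ?g = i}" for i
  define D where "D i = {x. if x \<in> Z then x \<in> A i \<and> x \<notin> gap i else x \<in> C (h x div P) i}" for i
  have "card {i. i < K \<and> x \<notin> D i} \<le> Suc p" if "x \<in> S" for x
  proof (cases "x \<in> Z")
    case True
    then have "{i. i < K \<and> x \<notin> D i} \<subseteq> insert (h x mod P div ?g) {i. i < K \<and> x \<notin> A i}"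
      by (auto simp: D_def gap_def)
    then have "card {i. i < K \<and> x \<notin> D i} \<le> card (insert (h x mod P div ?g) {i. i < K \<and> x \<notin> A i})"
      by (intro card_mono) auto
    also have "\<dots> \<le> Suc (card {i. i < K \<and> x \<notin> A i})" by (rule card_insert_le_m1) auto
    finally show ?thesis using A1[OF True] by simp
  next
    case False
    then show ?thesis using C1[of x "h x div P"] that by (simp add: D_def M_def le_SucI)
  qed
  moreover have "\<delta> x y \<le> R2 + 2 * (R' + r)" if i: "i < K" and c: "chain \<delta> r (D i \<inter> S) x y" for i x y
  proof -
    \<comment> \<open>\<open>J\<close> numbers the strips between consecutive gaps of colour
      \<open>i\<close>. A strip contains off-zone points of one annulus only, the one with number
      \<open>J - 1\<close>.\<close>
    define J where "J x = (h x + P - i * ?g) div P" for x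
    have iW: "i * ?g + ?g \<le> W" using i W mult_le_mono1[of "Suc i" K ?g] by simp
    have GP: "i * ?g + ?g \<le> P" using iW by (simp add: P_def)
    have J_eq: "J x = (if h x mod P < i * ?g then h x div P else Suc (h x div P))" for x
      unfolding J_def by (rule shifted_div(1)[OF Wr(2) GP])
    have J_rem: "P * J x + ?g \<le> h x + P - i * ?g" if x: "x \<in> D i" "x \<in> S" for x
      unfolding J_def
    proof (rule shifted_div(2)[OF Wr(2) GP])
      show "h x mod P < i * ?g \<or> i * ?g + ?g \<le> h x mod P"
      proof (cases "x \<in> Z")
        case True
        then have "h x mod P div ?g \<noteq> i" using x by (auto simp: D_def gap_def)
        then consider "h x mod P div ?g < i" | "Suc i \<le> h x mod P div ?g" by linarith
        then show ?thesis
        proof cases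
          case 1 then show ?thesis by (metis div_less_iff_less_mult zero_less_Suc)
        next
          case 2
          then have "Suc i * ?g \<le> h x mod P" by (metis less_eq_div_iff_mult_less_eq zero_less_Suc)
          then show ?thesis by simp
        qed
      next
        case False
        then show ?thesis using x iW by (simp add: Z_def)
      qed
    qed
    have J_step: "J y = J z" if "y \<in> D i \<inter> S" "z \<in> D i \<inter> S" "\<delta> y z \<le> r" for y z
    proof (rule ccontr)
      assume ne: "J y \<noteq> J z"
      have *: False if "y \<in> D i \<inter> S" "z \<in> D i \<inter> S" "\<delta> y z \<le> r" "J y < J z" for y z
      proof -
        have "h y + P - i * ?g < P * Suc (J y)" unfolding J_def using Wr(2)
          by (metis dividend_less_times_div mult_Suc_right)
        moreover have "P * Suc (J y) \<le> P * J z" using that(4) by (intro mult_le_mono2) simp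
        moreover have "h z + P - i * ?g \<ge> P * J z + ?g" using that by (intro J_rem) auto
        moreover have "h z \<le> h y + r" using h[of z y] that dist_sym[of y z] by auto
        ultimately show False by linarith
      qed
      show False using *[of y z] *[of z y] ne that dist_sym by (metis linorder_neqE_nat)
    qed
    define j where "j = J x - 1"
    let ?S = "{z \<in> D i \<inter> S. J z = J x}"
    have c': "chain \<delta> r ?S x y"
    proof -
      have "J y = J x \<and> chain \<delta> r ?S x y"
      proof (rule chain_inv[OF c])
        fix y z assume "J y = J x" "y \<in> D i \<inter> S" "z \<in> D i \<inter> S" "\<delta> y z \<le> r"
        then show "J z = J x" using J_step[of y z] by metis
      qed simp
      then show ?thesis by simp
    qed
    have off: "z \<in> C j i \<inter> M j" if "z \<in> ?S" "z \<notin> Z" for z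
    proof -
      have "h z mod P \<ge> i * ?g" using that iW by (auto simp: Z_def)
      then have "J z = Suc (h z div P)" using J_eq[of z] by simp
      moreover have "J z = J x" using that by blast
      ultimately have "h z div P = j" by (simp add: j_def)
      then show ?thesis using that by (auto simp: D_def M_def)
    qed
    have on: "z \<in> A i \<inter> Z" if "z \<in> ?S" "z \<in> Z" for z
      using that by (auto simp: D_def)
    \<comment> \<open>Either the chain has stayed in the zones, or \<open>a\<close> and
      \<open>c\<close> are its first and last points off the zones: between them it becomes a chain
      at scale \<open>r2\<close>, and at most one zone piece remains at each end.\<close>
    have "chain \<delta> r (A i \<inter> Z) x y \<or> (\<exists>a c. \<delta> x a \<le> R' + r \<and> chain \<delta> r2 (C j i \<inter> M j) a c \<and>
        (y = c \<or> (\<exists>z. \<delta> c z \<le> r \<and> chain \<delta> r (A i \<inter> Z) z y)))"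
      using c'
    proof (induction rule: chain.induct)
      case (start x)
      show ?case
      proof (cases "x \<in> Z")
        case True then show ?thesis using on[OF start] by (auto intro: chain.intros)
      next
        case False
        then have "chain \<delta> r2 (C j i \<inter> M j) x x" using off[OF start] by (auto intro: chain.intros)
        then show ?thesis by (intro disjI2 exI[of _ x]) simp
      qed
    next
      case (step x y z)
      show ?case
      proof (cases "z \<in> Z")
        case True
        then have z: "chain \<delta> r (A i \<inter> Z) z z" "z \<in> A i \<inter> Z" using on step by (auto intro: chain.intros)
        from step.IH show ?thesis
        proof (elim disjE exE conjE)
          assume "chain \<delta> r (A i \<inter> Z) x y"
          from chain.step[OF this z(2) step(3)] show ?thesis by simp
        next
          fix a c assume "\<delta> x a \<le> R' + r" "chain \<delta> r2 (C j i \<inter> M j) a c" "y = c"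
          then show ?thesis using step(3) z(1) by (intro disjI2 exI[of _ a] exI[of _ c]) auto
        next
          fix a c z' assume *: "\<delta> x a \<le> R' + r" "chain \<delta> r2 (C j i \<inter> M j) a c" "\<delta> c z' \<le> r"
            "chain \<delta> r (A i \<inter> Z) z' y"
          have "chain \<delta> r (A i \<inter> Z) z' z" by (rule chain.step[OF *(4) z(2) step(3)])
          then show ?thesis using * by (intro disjI2 exI[of _ a] exI[of _ c]) auto
        qed
      next
        case False
        have zC: "z \<in> C j i \<inter> M j" using off[OF step(2) False] .
        from step.IH show ?thesis
        proof (elim disjE exE conjE)
          assume "chain \<delta> r (A i \<inter> Z) x y"
          then have "\<delta> x z \<le> R' + r" using A2[OF i, of x y] dist_tri[of x z y] step(3) by simp
          then show ?thesis using chain.start[OF zC] by (intro disjI2 exI[of _ z]) auto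
        next
          fix a c assume "\<delta> x a \<le> R' + r" "chain \<delta> r2 (C j i \<inter> M j) a c" "y = c"
          then show ?thesis using step(3) chain.step[OF _ zC, of \<delta> r2 a c]
            by (intro disjI2 exI[of _ a] exI[of _ z]) (auto simp: r2_def)
        next
          fix a c z' assume *: "\<delta> x a \<le> R' + r" "chain \<delta> r2 (C j i \<inter> M j) a c" "\<delta> c z' \<le> r"
            "chain \<delta> r (A i \<inter> Z) z' y"
          have "\<delta> c z \<le> r2" using A2[OF i *(4)] *(3) step(3) dist_tri[of c z z'] dist_tri[of z' z y]
            by (simp add: r2_def)
          then show ?thesis using * chain.step[OF _ zC, of \<delta> r2 a c]
            by (intro disjI2 exI[of _ a] exI[of _ z]) auto
        qed
      qed
    qed
    then show ?thesis
    proof (elim disjE exE conjE)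
      assume "chain \<delta> r (A i \<inter> Z) x y" then show ?thesis using A2[OF i, of x y] by simp
    next
      fix a c assume "\<delta> x a \<le> R' + r" "chain \<delta> r2 (C j i \<inter> M j) a c" "y = c"
      then show ?thesis using C2[OF i, of j a c] dist_tri[of x y a] by simp
    next
      fix a c z assume "\<delta> x a \<le> R' + r" "chain \<delta> r2 (C j i \<inter> M j) a c" "\<delta> c z \<le> r" "chain \<delta> r (A i \<inter> Z) z y"
      then show ?thesis using C2[OF i, of j a c] A2[OF i, of z y]
        dist_tri[of x y a] dist_tri[of a y c] dist_tri[of c y z] by simp
    qed
  qed
  ultimately have "fam \<delta> K S (Suc p) r (R2 + 2 * (R' + r))" unfolding fam_def by blast
  then show ?thesis by (simp add: R2_def R'_def r2_def P_def)
qed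

text \<open>The members are the \<open>r\<close>-components of the \<open>p + 1\<close> families. A
  ball of radius \<open>s\<close> has diameter at most \<open>2 * c * s \<le> r\<close> for
  \<open>\<delta>\<close>, so its points in one family lie in a single component.\<close>

lemma fam_cover:
  fixes dd :: "'a \<Rightarrow> 'a \<Rightarrow> real"
  assumes fam: "fam \<delta> (Suc p) M p r R"
    and d1: "\<And>x y. x \<in> M \<Longrightarrow> y \<in> M \<Longrightarrow> dd x y \<le> c * \<delta> x y"
    and d2: "\<And>x y. x \<in> M \<Longrightarrow> y \<in> M \<Longrightarrow> \<delta> x y \<le> c * dd x y"
    and c: "0 \<le> c" and s: "2 * c * s \<le> r"
  shows "\<exists>\<U>. \<Union>\<U> = M \<and> (\<forall>U\<in>\<U>. \<forall>x\<in>U. \<forall>y\<in>U. dd x y \<le> c * R) \<and> meets_at_most M dd \<U> s p"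
proof -
  obtain A where A1: "\<And>x. x \<in> M \<Longrightarrow> card {i. i < Suc p \<and> x \<notin> A i} \<le> p"
    and A2: "\<And>i x y. i < Suc p \<Longrightarrow> chain \<delta> r (A i \<inter> M) x y \<Longrightarrow> \<delta> x y \<le> R"
    using fam unfolding fam_def by blast
  define cc where "cc i x = {y. chain \<delta> r (A i \<inter> M) x y}" for i x
  define \<U> where "\<U> = {cc i x | i x. i < Suc p \<and> x \<in> A i \<inter> M}"
  have "\<Union>\<U> = M"
  proof
    show "\<Union>\<U> \<subseteq> M" by (auto simp: \<U>_def cc_def dest: chain_in)
    show "M \<subseteq> \<Union>\<U>"
    proof
      fix x assume x: "x \<in> M"
      have "\<exists>i<Suc p. x \<in> A i"
      proof (rule ccontr)
        assume "\<not> ?thesis"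
        then have "{i. i < Suc p \<and> x \<notin> A i} = {..<Suc p}" by auto
        then show False using A1[OF x] by simp
      qed
      then obtain i where "i < Suc p" "x \<in> A i" by blast
      then have "x \<in> cc i x" "cc i x \<in> \<U>" using x by (auto simp: cc_def \<U>_def intro: chain.intros)
      then show "x \<in> \<Union>\<U>" by blast
    qed
  qed
  moreover have "dd x y \<le> c * R" if U: "U \<in> \<U>" "x \<in> U" "y \<in> U" for U x y
  proof -
    obtain i z where i: "i < Suc p" "chain \<delta> r (A i \<inter> M) z x" "chain \<delta> r (A i \<inter> M) z y"
      using U by (fastforce simp: \<U>_def cc_def)
    then have "chain \<delta> r (A i \<inter> M) x y" using chain_trans[OF i(3) chain_sym[OF i(2)]] by blast
    from A2[OF i(1) this] chain_in[OF this] have "\<delta> x y \<le> R" "x \<in> M" "y \<in> M" by auto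
    then have "dd x y \<le> c * real (\<delta> x y)" "c * real (\<delta> x y) \<le> c * R" using d1 c by (auto intro: mult_left_mono)
    then show ?thesis by linarith
  qed
  moreover have "meets_at_most M dd \<U> s p" unfolding meets_at_most_def
  proof
    fix x assume x: "x \<in> M"
    define B where "B = cball_in M dd x s"
    define f where "f i = (\<Union>z\<in>B \<inter> A i. cc i z)" for i
    have close: "\<delta> y z \<le> r" if "y \<in> B" "z \<in> B" for y z
    proof -
      have "dd x y \<le> s" "dd x z \<le> s" "y \<in> M" "z \<in> M" using that by (auto simp: B_def cball_in_def)
      then have "real (\<delta> x y) \<le> c * s" "real (\<delta> x z) \<le> c * s"
        using d2[OF x, of y] d2[OF x, of z] mult_left_mono[of "dd x y" s c] mult_left_mono[of "dd x z" s c] c by auto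
      moreover have "real (\<delta> y z) \<le> real (\<delta> x y) + real (\<delta> x z)"
        using dist_tri[of y z x] dist_sym[of x y] by linarith
      ultimately show ?thesis using s by linarith
    qed
    have "{U \<in> \<U>. U \<inter> B \<noteq> {}} \<subseteq> f ` {..p}"
    proof
      fix U assume "U \<in> {U \<in> \<U>. U \<inter> B \<noteq> {}}"
      then obtain i z y where U: "U = cc i z" "i < Suc p" "y \<in> cc i z" "y \<in> B" by (auto simp: \<U>_def)
      have y: "chain \<delta> r (A i \<inter> M) z y" "y \<in> A i \<inter> M" using U chain_in[of \<delta> r "A i \<inter> M" z y] by (auto simp: cc_def)
      have "cc i y' = cc i z" if "y' \<in> B" "y' \<in> A i" for y'
      proof -
        have "y' \<in> M" using that by (auto simp: B_def cball_in_def)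
        then have "y' \<in> A i \<inter> M" using that by simp
        from chain.step[of \<delta> r "A i \<inter> M" y y y', OF chain.start[OF y(2)] this close[OF U(4) that(1)]]
        have "chain \<delta> r (A i \<inter> M) z y'" by (rule chain_trans[OF _ y(1)])
        note t = this chain_sym[OF this]
        show ?thesis unfolding cc_def using chain_trans[OF _ t(1)] chain_trans[OF _ t(2)] by blast
      qed
      then have "f i = U" unfolding f_def using U(1,4) y(2) by blast
      then show "U \<in> f ` {..p}" using U(2) by (intro image_eqI[of U f i]) auto
    qed
    then have "finite {U \<in> \<U>. U \<inter> B \<noteq> {}}" "card {U \<in> \<U>. U \<inter> B \<noteq> {}} \<le> card {..p}"
      using surj_card_le[of "{..p}" _ f] by (auto intro: finite_surj[of "{..p}"])
    then show "finite {U \<in> \<U>. U \<inter> cball_in M dd x s \<noteq> {}} \<and> card {U \<in> \<U>. U \<inter> cball_in M dd x s \<noteq> {}} \<le> p + 1"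
      by (simp add: B_def)
  qed
  ultimately show ?thesis by (intro exI[of _ \<U>]) simp
qed

end

subsection \<open>The word norm\<close>

definition nrm :: "(int \<Rightarrow> int) \<Rightarrow> (int \<Rightarrow> int) \<Rightarrow> nat \<Rightarrow> word \<Rightarrow> nat" where
  "nrm N q s w = (LEAST n. \<exists>w'\<in>words_over s. length w' = n \<and> st N q w' = st N q w)"

text \<open>Restricting to the letters below \<open>s\<close> makes this a pseudometric on all words.\<close>
definition wd :: "(int \<Rightarrow> int) \<Rightarrow> (int \<Rightarrow> int) \<Rightarrow> nat \<Rightarrow> word \<Rightarrow> word \<Rightarrow> nat" where
  "wd N q s u v = nrm N q s (winv (filter (\<lambda>l. fst l < s) u) @ filter (\<lambda>l. fst l < s) v)"

lemma filter_words_over: "u \<in> words_over s \<Longrightarrow> filter (\<lambda>l. fst l < s) u = u"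
  by (auto simp: words_over_def)

lemma wd_words_over:
  "u \<in> words_over s \<Longrightarrow> v \<in> words_over s \<Longrightarrow> wd N q s u v = nrm N q s (winv u @ v)"
  by (simp add: wd_def filter_words_over)

lemma nrm_le: "w' \<in> words_over s \<Longrightarrow> st N q w' = st N q w \<Longrightarrow> nrm N q s w \<le> length w'"
  unfolding nrm_def by (rule Least_le) blast

lemma nrm_attained:
  assumes "w \<in> words_over s"
  obtains w' where "w' \<in> words_over s" "length w' = nrm N q s w" "st N q w' = st N q w"
proof -
  have "\<exists>w'\<in>words_over s. length w' = nrm N q s w \<and> st N q w' = st N q w"
    unfolding nrm_def by (rule LeastI[of _ "length w"]) (use assms in blast)
  then show ?thesis using that by blast
qed

lemma nrm_cong: "st N q w = st N q w' \<Longrightarrow> nrm N q s w = nrm N q s w'"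
  by (simp add: nrm_def)

lemma red_p_determined:
  assumes "f = p1 \<or> f = p2" "st N q u = st N q v" shows "red (f u) = red (f v)"
  using assms by (auto simp: st_def)

lemma cnt_determined: assumes "red (p1 u) = red (p1 v)" shows "cnt u = cnt v"
proof -
  have "st (\<lambda>_. 0) (\<lambda>_. 0) (p1 u) = st (\<lambda>_. 0) (\<lambda>_. 0) (p1 v)" using assms by (intro st_free) (simp add: red_eq_iff)
  then show ?thesis by (simp add: st_def)
qed

lemma ht_free: "pres_eq {} u v \<Longrightarrow> ht u = ht v"
proof (induction rule: pres_eq.induct)
  case (cancel u x v) then show ?case by (cases x) simp
qed auto

lemma abs_ht_le: "\<bar>ht u\<bar> \<le> int (length u)"
  by (induction u rule: ht.induct) (auto simp: sg_def)

lemma abs_cnt_le: "\<bar>cnt w a\<bar> \<le> int (length w)"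
  by (induction w a rule: cnt.induct) (auto simp: sg_def)

lemma cnt_far: "int (length w) < \<bar>a\<bar> \<Longrightarrow> cnt w a = 0"
  by (induction w a rule: cnt.induct) (auto simp: sg_def)

text \<open>Pairs of letters are counted, hence the square. If \<open>q d\<close> is nonzero, one
  letter \<open>w'\<close> weighs \<open>q d\<close> and the bound is lost, which is what collapses
  the coordinate in the larger group.\<close>

lemma abs_cent_le: "q d = 0 \<Longrightarrow> \<bar>cent q w d\<bar> \<le> (int (length w))\<^sup>2"
proof (induction w)
  case (Cons l w)
  obtain i b where l: "l = (i, b)" by (cases l)
  have "\<bar>cent q (l # w) d\<bar> \<le> \<bar>cent q w d\<bar> + \<bar>cnt w d\<bar>"
    using Cons.prems by (auto simp: l sg_def)
  moreover have "\<bar>cent q w d\<bar> \<le> (int (length w))\<^sup>2" using Cons by simp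
  moreover have "(int (length w))\<^sup>2 + int (length w) \<le> (int (length (l # w)))\<^sup>2"
    by (simp add: power2_eq_square algebra_simps)
  ultimately show ?case using abs_cnt_le[of w d] by linarith
qed simp

text \<open>A pair at height difference \<open>d\<close> needs that many letters \<open>x\<close> in
  between: this is the part of the norm of \<open>z d\<close> that is linear in
  \<open>d\<close>.\<close>

lemma cent_far: "int (length w) < \<bar>d\<bar> \<Longrightarrow> cent q w d = 0"
  by (induction q w d rule: cent.induct) (auto simp: cnt_far)

lemma wd_step:
  assumes uv: "u \<in> words_over s" "v \<in> words_over s"
  obtains w where "w \<in> words_over s" "length w = wd N q s u v" "st N q w = st N q (winv u @ v)"
  using nrm_attained[of "winv u @ v" s N q] uv by (auto simp: wd_words_over)

text \<open>Reduction works at the front of a word, whereas the metric compares \<open>u\<close> and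
  \<open>v\<close> through \<open>winv u @ v\<close>. The vertex of \<open>u\<close> is therefore
  the reduced projection of its inverse, since \<open>winv u\<close> arises from
  \<open>winv v\<close> by prepending \<open>winv u @ v\<close>.\<close>

lemma tree_step:
  assumes f: "f = p1 \<or> f = p2" and uv: "u \<in> words_over s" "v \<in> words_over s"
  obtains t where "length t \<le> wd N q s u v" "red (f (winv u)) = foldr push t (red (f (winv v)))"
proof -
  obtain w where w: "length w = wd N q s u v" "st N q w = st N q (winv u @ v)"
    using wd_step[OF uv] by blast
  have 1: "pres_eq {} (f w) (f (winv u @ v))"
    using red_p_determined[OF f w(2)] by (simp add: red_eq_iff)
  have app: "f (a @ b) = f a @ f b" "length (f a) \<le> length a" for a b using f by auto
  have "pres_eq {} (f (winv u @ v) @ f (winv v)) (f (winv u) @ [])"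
    unfolding app append_assoc using f by (intro pres_eq_left) (auto intro: pres_eq_cancel_right)
  then have "red (f (winv u)) = red (f (winv u @ v) @ f (winv v))" by (simp add: red_eq_iff pres_eq.sym)
  also have "\<dots> = red (f w @ f (winv v))" using pres_eq_right[OF 1] by (simp add: red_eq_iff pres_eq.sym)
  finally have "red (f (winv u)) = foldr push (f w) (red (f (winv v)))" by (simp add: red_append)
  moreover have "length (f w) \<le> wd N q s u v" using w app(2)[of w] by simp
  ultimately show ?thesis by (intro that)
qed

lemma tree_height_lipschitz:
  assumes f: "f = p1 \<or> f = p2" and uv: "u \<in> words_over s" "v \<in> words_over s"
  shows "length (red (f (winv u))) \<le> length (red (f (winv v))) + wd N q s u v"
proof -
  obtain t where "length t \<le> wd N q s u v" "red (f (winv u)) = foldr push t (red (f (winv v)))"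
    using tree_step[OF f uv] by blast
  then show ?thesis using length_foldr_push(1)[of t "red (f (winv v))"] by simp
qed

text \<open>A chain inside a slab of the tree cannot leave the branch that it starts in, the branch being
  cut at distance \<open>r\<close> below the slab.\<close>
lemma tree_slab_bounded:
  assumes f: "f = p1 \<or> f = p2" and B: "B \<subseteq> words_over s"
    and conn: "\<And>x y. x \<in> B \<Longrightarrow> y \<in> B \<Longrightarrow> chain (wd N q s) r B x y"
    and slab: "\<And>x y. x \<in> B \<Longrightarrow> y \<in> B \<Longrightarrow> length (red (f (winv x))) \<le> length (red (f (winv y))) + w"
    and xy: "x \<in> B" "y \<in> B"
  shows "length (red (f (winv x @ y))) \<le> 4 * w + 2 * r"
proof -
  define \<tau> where "\<tau> u = red (f (winv u))" for u
  \<comment> \<open>Depth of the ancestor at which the branch is cut; the truncated difference is 0,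
    the root, for slabs close to the root.\<close>
  define n where "n = length (\<tau> x) - (w + r)"
  have big: "n = 0 \<or> n + r \<le> length (\<tau> z)" if "z \<in> B" for z
    using slab[OF xy(1) that] by (auto simp: n_def \<tau>_def)
  have "take n (rev (\<tau> y)) = take n (rev (\<tau> x))"
  proof -
    have "take n (rev (\<tau> y)) = take n (rev (\<tau> x)) \<and> chain (wd N q s) r {z \<in> B. take n (rev (\<tau> z)) = take n (rev (\<tau> x))} x y"
    proof (rule chain_inv[OF conn[OF xy]])
      fix y z assume a: "take n (rev (\<tau> y)) = take n (rev (\<tau> x))" "y \<in> B" "z \<in> B" "wd N q s y z \<le> r"
      then obtain t where t: "length t \<le> wd N q s y z" "\<tau> y = foldr push t (\<tau> z)"
        using tree_step[OF f, of y s z N q] B unfolding \<tau>_def by blast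
      have "take n (rev (\<tau> y)) = take n (rev (\<tau> z))"
        using take_rev_foldr_push[of n t "\<tau> z"] big[OF a(3)] t a(4) by auto
      then show "take n (rev (\<tau> z)) = take n (rev (\<tau> x))" using a by simp
    qed simp
    then show ?thesis by simp
  qed
  then obtain c where c: "take n (rev (\<tau> x)) = rev c" "take n (rev (\<tau> y)) = rev c"
    by (metis rev_rev_ident)
  have split: "\<exists>a. \<tau> z = a @ c \<and> length a \<le> 2 * w + r" if z: "z \<in> B" "take n (rev (\<tau> z)) = rev c" for z
  proof -
    have "rev (\<tau> z) = rev c @ drop n (rev (\<tau> z))" using append_take_drop_id[of n "rev (\<tau> z)"] z(2) by simp
    then have "\<tau> z = rev (drop n (rev (\<tau> z))) @ c" by (metis rev_append rev_rev_ident)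
    moreover have "length (rev (drop n (rev (\<tau> z)))) \<le> 2 * w + r"
      using slab[OF z(1) xy(1)] by (simp add: n_def \<tau>_def)
    ultimately show ?thesis by blast
  qed
  obtain a where a: "\<tau> x = a @ c" "length a \<le> 2 * w + r" using split xy c by blast
  obtain b where b: "\<tau> y = b @ c" "length b \<le> 2 * w + r" using split xy c by blast
  have app: "f (u @ v) = f u @ f v" "f (winv u) = winv (f u)" for u v using f by auto
  have "pres_eq {} (f (winv x @ y)) (\<tau> x @ winv (\<tau> y))"
    unfolding app(1)
  proof (rule pres_eq_append)
    show "pres_eq {} (f (winv x)) (\<tau> x)" unfolding \<tau>_def by (rule pres_eq.sym[OF red_free_eq])
    have "pres_eq {} (winv (f (winv y))) (winv (\<tau> y))" unfolding \<tau>_def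
      by (rule pres_eq_winv[OF pres_eq.sym[OF red_free_eq]])
    then show "pres_eq {} (f y) (winv (\<tau> y))" by (simp add: app)
  qed
  also have "pres_eq {} (\<tau> x @ winv (\<tau> y)) (a @ winv b)"
    unfolding a b using pres_eq.sym[OF pres_eq_insert(1)[of "{}" a "winv b" c]] by simp
  finally have "red (f (winv x @ y)) = red (a @ winv b)" by (simp add: red_eq_iff)
  then show ?thesis using length_red[of "a @ winv b"] a b by simp
qed

context
  fixes s :: nat and N q :: "int \<Rightarrow> int"
  assumes s: "s = 3 \<or> s = 4" and N_nonneg: "\<And>d. 0 \<le> N d"
begin

text \<open>Completeness turns equal invariants into equality modulo the relators, where products
  are congruent in both factors, and soundness leads back.\<close>

lemma st_append_cong2:
  assumes "u \<in> words_over s" "u' \<in> words_over s" "v \<in> words_over s" "v' \<in> words_over s"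
    and "st N q u = st N q u'" "st N q v = st N q v'"
  shows "st N q (u @ v) = st N q (u' @ v')"
proof -
  note c = rels_complete[where N = N and q = q and s = s, OF HOL.refl s N_nonneg]
  have "pres_eq (rels s N q) (u @ v) (u' @ v')" by (intro pres_eq_append) (use assms c in auto)
  then show ?thesis by (rule rels_sound)
qed

lemma st_winv_cong:
  assumes "u \<in> words_over s" "u' \<in> words_over s" "st N q u = st N q u'"
  shows "st N q (winv u) = st N q (winv u')"
proof -
  note c = rels_complete[where N = N and q = q and s = s, OF HOL.refl s N_nonneg]
  have "pres_eq (rels s N q) (winv u) (winv u')" by (intro pres_eq_winv) (use assms c in auto)
  then show ?thesis by (rule rels_sound)
qed

lemma nrm_append:
  assumes "u \<in> words_over s" "v \<in> words_over s"
  shows "nrm N q s (u @ v) \<le> nrm N q s u + nrm N q s v"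
proof -
  obtain u' where u': "u' \<in> words_over s" "length u' = nrm N q s u" "st N q u' = st N q u"
    using nrm_attained[OF assms(1)] by blast
  obtain v' where v': "v' \<in> words_over s" "length v' = nrm N q s v" "st N q v' = st N q v"
    using nrm_attained[OF assms(2)] by blast
  have "st N q (u' @ v') = st N q (u @ v)" by (intro st_append_cong2 u' v' assms)
  then show ?thesis using nrm_le[of "u' @ v'" s N q "u @ v"] u' v' by simp
qed

lemma nrm_winv_le: assumes "u \<in> words_over s" shows "nrm N q s (winv u) \<le> nrm N q s u"
proof -
  obtain u' where u': "u' \<in> words_over s" "length u' = nrm N q s u" "st N q u' = st N q u"
    using nrm_attained[OF assms(1)] by blast
  then show ?thesis using nrm_le[of "winv u'" s N q "winv u"] st_winv_cong[OF u'(1) assms] by simp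
qed

lemma nrm_winv: "u \<in> words_over s \<Longrightarrow> nrm N q s (winv u) = nrm N q s u"
  using nrm_winv_le[of u] nrm_winv_le[of "winv u"] by simp

lemma pseudometric_wd: "pseudometric (wd N q s)"
proof
  fix x y z :: word
  let ?f = "\<lambda>u :: word. filter (\<lambda>l. fst l < s) u"
  have f: "?f u \<in> words_over s" for u by (auto simp: words_over_def)
  have "st N q (winv (?f x) @ ?f x) = st N q []" by (rule st_free[OF pres_eq_cancel_left])
  then show "wd N q s x x = 0" using nrm_le[of "[]" s N q "winv (?f x) @ ?f x"] by (simp add: wd_def)
  show "wd N q s x y = wd N q s y x"
    using nrm_winv[of "winv (?f x) @ ?f y"] f by (simp add: wd_def)
  have "st N q (winv (?f x) @ ?f z) = st N q ((winv (?f x) @ ?f y) @ (winv (?f y) @ ?f z))"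
    using st_free[OF pres_eq_insert(1)[of "{}" "winv (?f x)" "?f z" "?f y"]] by simp
  then have "wd N q s x z = nrm N q s ((winv (?f x) @ ?f y) @ (winv (?f y) @ ?f z))"
    unfolding wd_def by (rule nrm_cong)
  also have "\<dots> \<le> wd N q s x y + wd N q s y z"
    unfolding wd_def by (rule nrm_append) (simp_all only: words_over_simps f simp_thms)
  finally show "wd N q s x z \<le> wd N q s x y + wd N q s y z" .
qed

end

text \<open>Both values keep a distance of at least \<open>g\<close> from the lower end of their
  interval, so a move by less than \<open>g\<close> in either direction cannot change the
  interval.\<close>

lemma shifted_div_int:
  fixes a e P G g :: int
  assumes P: "0 < P" and G: "0 \<le> G" "G + g \<le> P" and e: "\<bar>e\<bar> < g"
    and gap: "\<not> (G \<le> a mod P \<and> a mod P < G + g)" "\<not> (G \<le> (a + e) mod P \<and> (a + e) mod P < G + g)"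
  shows "(a + e - G) div P = (a - G) div P"
proof -
  have rem: "g \<le> (b - G) mod P" if gb: "\<not> (G \<le> b mod P \<and> b mod P < G + g)" for b
  proof -
    define c where "c = b mod P"
    have m: "(b - G) mod P = (c - G) mod P" by (simp add: c_def mod_diff_left_eq)
    have c: "0 \<le> c" "c < P" using P by (auto simp: c_def)
    show ?thesis
    proof (cases "c < G")
      case True
      have "(c - G + P) mod P = c - G + P" using True c G e by (intro mod_pos_pos_trivial) linarith+
      then have "(b - G) mod P = c - G + P" using m by simp
      then show ?thesis using G c by linarith
    next
      case False
      then have "(c - G) mod P = c - G" using c G by (intro mod_pos_pos_trivial) linarith+
      then show ?thesis using m gb False unfolding c_def[symmetric] by linarith
    qed
  qed
  have mono: "\<not> c div P < d div P" if "g \<le> d mod P" "d < c + g" for c d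
  proof
    assume "c div P < d div P"
    then have "P * (c div P) + P \<le> P * (d div P)"
      using mult_left_mono[of "c div P + 1" "d div P" P] P by (simp add: algebra_simps)
    moreover have "c = P * (c div P) + c mod P" "d = P * (d div P) + d mod P" by simp_all
    moreover have "c mod P < P" using P by simp
    ultimately show False using that by linarith
  qed
  have "\<not> (a - G) div P < (a + e - G) div P"
    using rem[OF gap(2)] e by (intro mono) auto
  moreover have "\<not> (a + e - G) div P < (a - G) div P"
    using rem[OF gap(1)] e by (intro mono) auto
  ultimately show ?thesis by linarith
qed

section \<open>Central coordinates over bounded parts of both trees\<close>

context
  fixes s :: nat and N q :: "int \<Rightarrow> int"
  assumes s: "s = 3 \<or> s = 4" and N_nonneg: "\<And>d. 0 \<le> N d"
begin

text \<open>The correction is the cocycle evaluated on reduced projections, so it is controlled by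
  lengths in the trees however long \<open>v\<close> and \<open>w\<close> are.\<close>

lemma cent_append_reduced:
  "\<exists>e. cent q (v @ w) d mod N d = (cent q v d + cent q w d + e) mod N d
     \<and> (q d = 0 \<longrightarrow> \<bar>e\<bar> \<le> (int (length (red (p2 v)) + length (red (p1 w))))\<^sup>2)
     \<and> (int (length (red (p2 v)) + length (red (p1 w))) < \<bar>d\<bar> \<longrightarrow> e = 0)"
proof (intro exI conjI impI)
  let ?x = "red (p2 v) @ red (p1 w)"
  let ?e = "cent q ?x d"
  have "pres_eq {} (p2 v @ p1 w) ?x" by (intro pres_eq_append pres_eq.sym[OF red_free_eq])
  then have "st N q (p2 v @ p1 w) = st N q ?x" by (rule st_free)
  then have e: "cent q (p2 v @ p1 w) d mod N d = ?e mod N d"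
    by (auto simp: st_def dest: fun_cong[where x = d])
  have "cent q (v @ w) d = cent q v d + cent q w d + cent q (p2 v @ p1 w) d"
    using cent_append[of q v w d] by simp
  then show "cent q (v @ w) d mod N d = (cent q v d + cent q w d + ?e) mod N d"
    using e by (simp only:) (intro mod_add_cong HOL.refl)
  show "\<bar>?e\<bar> \<le> (int (length (red (p2 v)) + length (red (p1 w))))\<^sup>2" if "q d = 0"
    using abs_cent_le[of q d, OF that, of ?x] by simp
  show "?e = 0" if "int (length (red (p2 v)) + length (red (p1 w))) < \<bar>d\<bar>"
    using cent_far[of ?x d q] that by simp
qed

text \<open>The central coordinates of a bounded part are measured from a base point of this part and
  cut at gaps that are periodic modulo \<open>P\<close>, a divisor of the orders of the active coordinates.\<close>
lemma fam_base:
  fixes P :: int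
  assumes B: "B \<subseteq> words_over s"
    and conn: "\<And>x y. x \<in> B \<Longrightarrow> y \<in> B \<Longrightarrow> chain (wd N q s) r B x y"
    and bd1: "\<And>x y. x \<in> B \<Longrightarrow> y \<in> B \<Longrightarrow> length (red (p1 (winv x @ y))) \<le> \<rho>"
    and bd2: "\<And>x y. x \<in> B \<Longrightarrow> y \<in> B \<Longrightarrow> length (red (p2 (winv x @ y))) \<le> \<rho>"
    and r: "r \<le> \<rho>"
    and act: "finite act" "card act \<le> p" "\<And>d. d \<in> act \<Longrightarrow> q d = 0 \<and> P dvd N d"
    and P: "int K * ((2 * int \<rho>)\<^sup>2 + 1) \<le> P" "0 < P"
    and N1: "\<And>d. d \<le> 0 \<Longrightarrow> N d = 1"
    and bound: "\<And>w. w \<in> words_over s \<Longrightarrow> length (red (p1 w)) \<le> \<rho> \<Longrightarrow> length (red (p2 w)) \<le> \<rho>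
      \<Longrightarrow> (\<And>d. 2 * int \<rho> < d \<Longrightarrow> N d dvd cent q w d)
      \<Longrightarrow> (\<And>d. d \<in> act \<Longrightarrow> \<exists>t. \<bar>t\<bar> \<le> P + (2 * int \<rho>)\<^sup>2 \<and> cent q w d mod N d = t mod N d)
      \<Longrightarrow> nrm N q s w \<le> R"
  shows "fam (wd N q s) K B p r R"
proof (cases "B = {}")
  case True
  have "\<not> chain (wd N q s) r {} x y" for x y using chain_in[of "wd N q s" r "{}" x y] by auto
  then show ?thesis unfolding fam_def True by simp
next
  case False
  then obtain b where b: "b \<in> B" by blast
  define \<kappa> where "\<kappa> u d = cent q (winv b @ u) d" for u d
  define T where "T = (2 * int \<rho>)\<^sup>2"
  have sq: "int (m + n)^2 \<le> T" if "m \<le> \<rho>" "n \<le> \<rho>" for m n :: nat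
    unfolding T_def by (rule power_mono) (use that in auto)
  have st_split: "st N q (winv b @ v) = st N q ((winv b @ u) @ (winv u @ v))" for u v
    using st_free[OF pres_eq_insert(1)[of "{}" "winv b" v u]] by simp
  have step: "\<exists>e. \<kappa> v d mod N d = (\<kappa> u d + e) mod N d \<and> (q d = 0 \<longrightarrow> \<bar>e\<bar> \<le> T) \<and> (2 * int \<rho> < \<bar>d\<bar> \<longrightarrow> e = 0)"
    if uv: "u \<in> B" "v \<in> B" "wd N q s u v \<le> r" for u v d
  proof -
    obtain w where w: "length w = wd N q s u v" "st N q w = st N q (winv u @ v)"
      using wd_step[of u s v N q] uv B by blast
    have "pres_eq {} (p2 (winv b @ u) @ w) (red (p2 (winv b @ u)) @ w)"
      by (intro pres_eq_right pres_eq.sym[OF red_free_eq])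
    then have f: "st N q (p2 (winv b @ u) @ w) = st N q (red (p2 (winv b @ u)) @ w)" by (rule st_free)
    let ?e = "cent q (red (p2 (winv b @ u)) @ w) d"
    have "st N q (winv b @ v) = st N q ((winv b @ u) @ w)"
      unfolding st_split[of v u] by (rule st_append_cong) (simp add: w(2))
    then have "\<kappa> v d mod N d = cent q ((winv b @ u) @ w) d mod N d"
      unfolding \<kappa>_def by (auto simp: st_def dest: fun_cong[where x = d])
    also have "cent q ((winv b @ u) @ w) d = \<kappa> u d + cent q (p2 (winv b @ u) @ w) d"
      using cent_append[of q "winv b @ u" w d] cent_p2_append[of q "winv b @ u" w d] by (simp add: \<kappa>_def)
    also have "\<dots> mod N d = (\<kappa> u d + ?e) mod N d"
      using f by (intro mod_add_cong HOL.refl) (auto simp: st_def dest: fun_cong[where x = d])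
    finally have 1: "\<kappa> v d mod N d = (\<kappa> u d + ?e) mod N d" .
    have l: "length (red (p2 (winv b @ u))) \<le> \<rho>" "length w \<le> \<rho>" using bd2[OF b uv(1)] w uv(3) r by auto
    have 2: "\<bar>?e\<bar> \<le> T" if "q d = 0"
      using abs_cent_le[of q d, OF that, of "red (p2 (winv b @ u)) @ w"] sq[OF l] by simp
    have 3: "?e = 0" if "2 * int \<rho> < \<bar>d\<bar>"
      using cent_far[of "red (p2 (winv b @ u)) @ w" d q] that l by simp
    show ?thesis using 1 2 3 by blast
  qed
  \<comment> \<open>A step does not affect a coordinate beyond \<open>2 * \<rho>\<close>, and all of
    \<open>B\<close> is reached from \<open>b\<close> by such steps. This is why \<open>B\<close>
    has to be connected.\<close>
  have far: "N d dvd \<kappa> u d" if u: "u \<in> B" and d: "2 * int \<rho> < d" for u d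
  proof -
    have "N d dvd \<kappa> u d \<and> chain (wd N q s) r {z \<in> B. N d dvd \<kappa> z d} b u"
    proof (rule chain_inv[OF conn[OF b u]])
      have "st N q (winv b @ b) = st N q []" by (rule st_free[OF pres_eq_cancel_left])
      then show "N d dvd \<kappa> b d" unfolding \<kappa>_def by (auto simp: st_def mod_0_imp_dvd dest: fun_cong[where x = d])
      fix y z assume "N d dvd \<kappa> y d" "y \<in> B" "z \<in> B" "wd N q s y z \<le> r"
      then show "N d dvd \<kappa> z d" using step[of y z d] d by (auto simp: dvd_eq_mod_eq_0)
    qed
    then show ?thesis by simp
  qed
  define g where "g = T + 1"
  \<comment> \<open>Family \<open>i\<close> omits the \<open>i\<close>-th gap of every active
    coordinate. Gaps of distinct families are disjoint, so each coordinate excludes a point from at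
    most one family.\<close>
  define A where "A i = {u. \<forall>d\<in>act. \<not> (int i * g \<le> \<kappa> u d mod P \<and> \<kappa> u d mod P < int i * g + g)}" for i
  have g: "0 < g" by (simp add: g_def T_def)
  have "card {i. i < K \<and> u \<notin> A i} \<le> p" for u
  proof -
    have "{i. i < K \<and> u \<notin> A i} \<subseteq> (\<lambda>d. nat ((\<kappa> u d mod P) div g)) ` act"
    proof
      fix i assume "i \<in> {i. i < K \<and> u \<notin> A i}"
      then obtain d where d: "d \<in> act" "int i * g \<le> \<kappa> u d mod P" "\<kappa> u d mod P < int i * g + g"
        by (auto simp: A_def)
      define c where "c = \<kappa> u d mod P - int i * g"
      have "\<kappa> u d mod P = c + int i * g" "0 \<le> c" "c < g" using d by (auto simp: c_def)
      then have "\<kappa> u d mod P div g = int i" using g by simp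
      then show "i \<in> (\<lambda>d. nat ((\<kappa> u d mod P) div g)) ` act" using d(1) by force
    qed
    from surj_card_le[OF act(1) this] have "card {i. i < K \<and> u \<notin> A i} \<le> card act" .
    then show ?thesis using act(2) by simp
  qed
  moreover have "wd N q s u v \<le> R" if i: "i < K" and c: "chain (wd N q s) r (A i \<inter> B) u v" for i u v
  proof -
    have uv: "u \<in> B" "v \<in> B" using chain_in[OF c] by auto
    have iP: "int i * g + g \<le> P"
    proof -
      have "int i * g + g = int (Suc i) * g" by (simp add: algebra_simps)
      also have "\<dots> \<le> int K * g" using i g by (intro mult_right_mono) auto
      finally show ?thesis using P(1) by (simp add: g_def T_def)
    qed
    \<comment> \<open>An integer \<open>k\<close>, starting at \<open>\<kappa> u d\<close>, follows
      the class of the coordinate along the chain. As \<open>P\<close> divides \<open>N d\<close>,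
      the class alone decides whether a gap is hit, and \<open>k\<close> never leaves its interval
      of length \<open>P\<close>.\<close>
    have lift: "\<exists>k. k mod N d = \<kappa> v d mod N d \<and> \<bar>k - \<kappa> u d\<bar> \<le> P" if d: "d \<in> act" for d
    proof -
      let ?G = "int i * g"
      let ?Q = "\<lambda>z. \<exists>k. k mod N d = \<kappa> z d mod N d \<and> (k - ?G) div P = (\<kappa> u d - ?G) div P"
      have qd: "q d = 0" "P dvd N d" using act(3)[OF d] by auto
      have "?Q v \<and> chain (wd N q s) r {z \<in> A i \<inter> B. ?Q z} u v"
      proof (rule chain_inv[OF c])
        show "?Q u" by blast
        fix y z assume "?Q y" and yz: "y \<in> A i \<inter> B" "z \<in> A i \<inter> B" "wd N q s y z \<le> r"
        then obtain k where k: "k mod N d = \<kappa> y d mod N d" "(k - ?G) div P = (\<kappa> u d - ?G) div P" by blast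
        obtain e where e: "\<kappa> z d mod N d = (\<kappa> y d + e) mod N d" "\<bar>e\<bar> \<le> T"
          using step[of y z d] yz qd by auto
        have kz: "(k + e) mod N d = \<kappa> z d mod N d" unfolding e(1) by (intro mod_add_cong k HOL.refl)
        have modP: "a mod P = a' mod P" if "a mod N d = a' mod N d" for a a' :: int
          using that qd(2) by (metis mod_mod_cancel)
        have "(k + e - ?G) div P = (k - ?G) div P"
        proof (rule shifted_div_int[where g = g])
          show "\<bar>e\<bar> < g" using e by (simp add: g_def)
          show "\<not> (?G \<le> k mod P \<and> k mod P < ?G + g)" using yz(1) d modP[OF k(1)] by (auto simp: A_def)
          show "\<not> (?G \<le> (k + e) mod P \<and> (k + e) mod P < ?G + g)" using yz(2) d modP[OF kz] by (auto simp: A_def)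
        qed (use P g iP in auto)
        then show "?Q z" using kz k by metis
      qed
      then obtain k where k: "k mod N d = \<kappa> v d mod N d" "(k - ?G) div P = (\<kappa> u d - ?G) div P" by blast
      have "k - ?G = P * ((k - ?G) div P) + (k - ?G) mod P"
        "\<kappa> u d - ?G = P * ((\<kappa> u d - ?G) div P) + (\<kappa> u d - ?G) mod P" by simp_all
      moreover have "0 \<le> (k - ?G) mod P" "(k - ?G) mod P < P" "0 \<le> (\<kappa> u d - ?G) mod P" "(\<kappa> u d - ?G) mod P < P"
        using P by auto
      moreover have "P * ((k - ?G) div P) = P * ((\<kappa> u d - ?G) div P)" using k(2) by simp
      ultimately have "\<bar>k - \<kappa> u d\<bar> \<le> P" by linarith
      then show ?thesis using k by blast
    qed
    let ?w = "winv u @ v"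
    have ww: "?w \<in> words_over s" using uv B by auto
    have cent_w: "\<exists>e. \<kappa> v d mod N d = (\<kappa> u d + cent q ?w d + e) mod N d \<and> (q d = 0 \<longrightarrow> \<bar>e\<bar> \<le> T) \<and> (2 * int \<rho> < \<bar>d\<bar> \<longrightarrow> e = 0)" for d
    proof -
      have "\<kappa> v d mod N d = cent q ((winv b @ u) @ ?w) d mod N d"
        using st_split[of v u] unfolding \<kappa>_def by (auto simp: st_def dest: fun_cong[where x = d])
      moreover have l: "length (red (p2 (winv b @ u))) \<le> \<rho>" "length (red (p1 ?w)) \<le> \<rho>"
        using bd2[OF b uv(1)] bd1[OF uv] .
      moreover have "int (length (red (p2 (winv b @ u))) + length (red (p1 ?w))) < \<bar>d\<bar>" if "2 * int \<rho> < \<bar>d\<bar>"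
        using l that by linarith
      ultimately show ?thesis using cent_append_reduced[of "winv b @ u" ?w d] sq[OF l] unfolding \<kappa>_def[symmetric]
        by (metis order_trans)
    qed
    have "nrm N q s ?w \<le> R"
    proof (rule bound[OF ww bd1[OF uv] bd2[OF uv]])
      fix d assume d: "2 * int \<rho> < d"
      then obtain e where "\<kappa> v d mod N d = (\<kappa> u d + cent q ?w d + e) mod N d" "e = 0"
        using cent_w[of d] by auto
      then show "N d dvd cent q ?w d"
        using far[OF uv(1) d] far[OF uv(2) d] by (metis add.right_neutral dvd_add_right_iff dvd_eq_mod_eq_0)
    next
      fix d assume d: "d \<in> act"
      obtain e where e: "\<kappa> v d mod N d = (\<kappa> u d + cent q ?w d + e) mod N d" "\<bar>e\<bar> \<le> T"
        using cent_w[of d] act(3)[OF d] by auto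
      obtain k where k: "k mod N d = \<kappa> v d mod N d" "\<bar>k - \<kappa> u d\<bar> \<le> P" using lift[OF d] by blast
      have "(k - \<kappa> u d - e) mod N d = (\<kappa> u d + cent q ?w d + e - \<kappa> u d - e) mod N d"
        using k(1) e(1) by (intro mod_diff_cong HOL.refl) simp
      then have "cent q ?w d mod N d = (k - \<kappa> u d - e) mod N d" by simp
      moreover have "\<bar>k - \<kappa> u d - e\<bar> \<le> P + (2 * int \<rho>)\<^sup>2" using k e by (simp add: T_def)
      ultimately show "\<exists>t. \<bar>t\<bar> \<le> P + (2 * int \<rho>)\<^sup>2 \<and> cent q ?w d mod N d = t mod N d" by blast
    qed
    then show ?thesis using uv B by (simp add: wd_words_over subset_iff)
  qed
  ultimately show ?thesis unfolding fam_def by blast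
qed

subsection \<open>Upper bounds for the word norm\<close>

text \<open>The word \<open>z\<close> plays the part of the central element \<open>c * z d\<close>.
  Quantifying over all continuations \<open>v\<close> makes such words compose by
  concatenation.\<close>

definition zact :: "word \<Rightarrow> int \<Rightarrow> int \<Rightarrow> bool" where
  "zact z d c \<longleftrightarrow> z \<in> words_over s \<and> (\<forall>v. red (p1 (z @ v)) = red (p1 v) \<and> red (p2 (z @ v)) = red (p2 v)
     \<and> cnt (z @ v) = cnt v \<and> (\<forall>d'. cent q (z @ v) d' = cent q v d' + (if d' = d then c else 0)))"

lemma zact_Zw: "zact (Zw d a b) d (a * b)"
  using s by (auto simp: zact_def)

lemma zact_append: "zact z d c \<Longrightarrow> zact z' d c' \<Longrightarrow> zact (z @ z') d (c + c')"
  by (simp add: zact_def del: p1_simps p2_simps)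

lemma length_Zw: "length (Zw d a b) = nat (2 * \<bar>a\<bar> + 2 * \<bar>b\<bar> + 4 * \<bar>d\<bar>)"
  by (simp add: Zw_def Yp_def nat_add_distrib nat_mult_distrib)

lemma square_split:
  fixes t m :: int assumes m: "0 < m" and t: "\<bar>t\<bar> \<le> m\<^sup>2"
  shows "\<bar>t div m\<bar> \<le> m" "\<bar>t mod m\<bar> \<le> m"
proof -
  have "t div m \<le> m\<^sup>2 div m" using t m by (intro zdiv_mono1) auto
  moreover have "(- m) * m div m \<le> t div m" using t m by (intro zdiv_mono1) (auto simp: power2_eq_square)
  then have "- m \<le> t div m" using m by (metis nonzero_mult_div_cancel_right less_irrefl)
  ultimately show "\<bar>t div m\<bar> \<le> m" using m by (simp add: power2_eq_square)
  show "\<bar>t mod m\<bar> \<le> m" using m by (simp add: abs_le_iff less_imp_le order_trans[of _ 0])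
qed

text \<open>Division by \<open>m\<close> gives \<open>t = a * m + b\<close> with both digits at most
  \<open>m\<close> in absolute value. The commutators with exponents \<open>a\<close>,
  \<open>m\<close> and \<open>b\<close>, 1 have lengths at most \<open>4 * m + 4 * d\<close> and
  \<open>2 * m + 2 + 4 * d\<close>.\<close>

lemma zact_sqrt:
  assumes "0 < m" "\<bar>t\<bar> \<le> (int m)\<^sup>2"
  shows "\<exists>z. zact z (int d) t \<and> length z \<le> 6 * m + 8 * d + 2"
proof -
  let ?a = "t div int m" and ?b = "t mod int m"
  have ab: "\<bar>?a\<bar> \<le> int m" "\<bar>?b\<bar> \<le> int m" using square_split[of "int m" t] assms by auto
  have "zact (Zw (int d) ?a (int m) @ Zw (int d) ?b 1) (int d) (?a * int m + ?b * 1)"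
    by (intro zact_append zact_Zw)
  moreover have "length (Zw (int d) ?a (int m) @ Zw (int d) ?b 1) \<le> 6 * m + 8 * d + 2"
    using ab by (simp add: length_Zw)
  moreover have "?a * int m + ?b * 1 = t" by simp
  ultimately show ?thesis by metis
qed

definition Ww :: "int \<Rightarrow> int \<Rightarrow> int \<Rightarrow> word" where
  "Ww d a b = ipow 3 a @ Yp d b @ ipow 3 (- a) @ Yp d (- b)"

lemma cent_ipow3: "cent q (ipow 3 n @ v) d = cent q v d + n * q d * cnt v d"
proof -
  have "cnt (replicate k (3, b) @ v) = cnt v" for k b
    using cnt_ipow_primed[of 3 "sg b * int k" v] by (cases "k = 0") (auto simp: ipow_def sg_def split: if_splits)
  then have "cent q (replicate k (3, b) @ v) d = cent q v d + sg b * int k * q d * cnt v d" for k b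
    by (induction k arbitrary: d) (auto simp: algebra_simps)
  then show ?thesis by (auto simp: ipow_def sg_def)
qed

lemma zact_Ww: assumes "s = 4" shows "zact (Ww d a b) d (a * b * q d)"
proof -
  have c: "cnt (Ww d a b @ v) = cnt v" for v by (rule ext) (simp add: Ww_def)
  have e: "cent q (Ww d a b @ v) d' = cent q v d' + (if d' = d then a * b * q d else 0)" for v d'
    by (simp add: Ww_def cent_ipow3 algebra_simps)
  have 1: "pres_eq {} (p1 (Ww d a b)) []" by (simp add: Ww_def free_Yp)
  have "pres_eq {} (ipow 3 a @ (ipow 0 d @ ipow 0 (- d)) @ winv (ipow 3 a)) []"
    by (intro pres_eq_conj_triv free_ipow)
  from pres_eq_append_triv[OF this free_ipow[of _ 0 d]]
  have 2: "pres_eq {} (p2 (Ww d a b)) []" by (simp add: Ww_def)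
  have w: "Ww d a b \<in> words_over s" using assms by (simp add: Ww_def)
  show ?thesis unfolding zact_def using c e w red_triv_append[OF 1] red_triv_append[OF 2] by simp
qed

text \<open>Here \<open>t\<close> is written in base \<open>q (int d)\<close>: the leading digit is
  produced by commutators with \<open>w'\<close>, which count \<open>q (int d)\<close> each, the
  other one by \<open>y'\<close>. Both digits are at most the square of \<open>m\<close> and are
  split once more, so a fourth root of the order suffices.\<close>

lemma zact_collapsed:
  assumes "s = 4" "0 < m" and q: "0 < q (int d)" "q (int d) \<le> (int m)\<^sup>2" and t: "0 \<le> t" "t < (q (int d))\<^sup>2"
  shows "\<exists>z. zact z (int d) t \<and> length z \<le> 12 * m + 16 * d + 4"
proof -
  let ?q = "q (int d)"
  define a where "a = t div ?q"
  have aq: "0 \<le> a" "a < ?q"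
  proof -
    show "0 \<le> a" using q t by (simp add: a_def pos_imp_zdiv_nonneg_iff)
    have "t = ?q * a + t mod ?q" "0 \<le> t mod ?q" using q by (simp_all add: a_def)
    then have "?q * a < ?q * ?q" using t by (simp add: power2_eq_square)
    then show "a < ?q" using q by simp
  qed
  have bq: "0 \<le> t mod ?q" "t mod ?q < ?q" using q by auto
  obtain z where z: "zact z (int d) (t mod ?q)" "length z \<le> 6 * m + 8 * d + 2"
    using zact_sqrt[OF assms(2), of "t mod ?q" d] bq q by auto
  let ?a = "a div int m" and ?b = "a mod int m"
  have ab: "\<bar>?a\<bar> \<le> int m" "\<bar>?b\<bar> \<le> int m" using square_split[of "int m" a] assms(2) aq q by auto
  have "zact ((Ww (int d) ?a (int m) @ Ww (int d) ?b 1) @ z) (int d) ((?a * int m * ?q + ?b * 1 * ?q) + t mod ?q)"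
    by (intro zact_append zact_Ww z assms)
  moreover have "?a * int m * ?q + ?b * 1 * ?q + t mod ?q = t"
  proof -
    have "?a * int m * ?q + ?b * 1 * ?q = (?a * int m + ?b) * ?q" by (simp only: distrib_right mult_1_right)
    also have "?a * int m + ?b = a" by simp
    finally show ?thesis by (simp add: a_def)
  qed
  moreover have "length ((Ww (int d) ?a (int m) @ Ww (int d) ?b 1) @ z) \<le> 12 * m + 16 * d + 4"
  proof -
    have "nat \<bar>?a\<bar> \<le> m" "nat \<bar>?b\<bar> \<le> m" using ab by simp_all
    then show ?thesis using z(2) by (simp add: Ww_def Yp_def)
  qed
  ultimately show ?thesis by metis
qed

text \<open>The word is rebuilt from its reduced projections and a power of \<open>x\<close>, each
  of length at most \<open>\<rho>\<close>, preceded by one corrector for every coordinate from 1 to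
  \<open>D\<close>. Beyond \<open>D\<close> the coordinates vanish by \<open>far\<close>, below 1 by
  \<open>N1\<close>.\<close>

lemma nrm_normal_form:
  fixes zb :: "nat \<Rightarrow> nat"
  assumes w: "w \<in> words_over s" and l: "length (red (p1 w)) \<le> \<rho>" "length (red (p2 w)) \<le> \<rho>"
    and N1: "\<And>d. d \<le> 0 \<Longrightarrow> N d = 1"
    and far: "\<And>d. int D < d \<Longrightarrow> N d dvd cent q w d"
    and z: "\<And>d. 1 \<le> d \<Longrightarrow> d \<le> D \<Longrightarrow> \<exists>z c. zact z (int d) c \<and> c mod N (int d) = cent q w (int d) mod N (int d)
      \<and> length z \<le> zb d"
  shows "nrm N q s w \<le> 3 * \<rho> + (\<Sum>d = 1..D. zb d)"
proof -
  have ex: "\<exists>Z\<in>words_over s. length Z \<le> (\<Sum>d = 1..n. zb d) \<and> (\<forall>v. red (p1 (Z @ v)) = red (p1 v) \<and> red (p2 (Z @ v)) = red (p2 v)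
     \<and> cnt (Z @ v) = cnt v \<and> (\<forall>d. cent q (Z @ v) d mod N d = (cent q v d + (if 1 \<le> d \<and> d \<le> int n then cent q w d else 0)) mod N d))"
    if "n \<le> D" for n
    using that
  proof (induction n)
    case 0
    have "(1 \<le> d \<and> d \<le> int 0) = False" for d by auto
    then show ?case by (intro bexI[of _ "[]"]) simp_all
  next
    case (Suc n)
    then obtain Z where Z: "Z \<in> words_over s" "length Z \<le> (\<Sum>d = 1..n. zb d)"
      "\<And>v. red (p1 (Z @ v)) = red (p1 v)" "\<And>v. red (p2 (Z @ v)) = red (p2 v)" "\<And>v. cnt (Z @ v) = cnt v"
      "\<And>v d. cent q (Z @ v) d mod N d = (cent q v d + (if 1 \<le> d \<and> d \<le> int n then cent q w d else 0)) mod N d"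
      by (auto simp del: p1_simps p2_simps)
    obtain z c where z: "zact z (int (Suc n)) c" "c mod N (int (Suc n)) = cent q w (int (Suc n)) mod N (int (Suc n))"
      "length z \<le> zb (Suc n)" using z[of "Suc n"] Suc.prems by auto
    have zz: "red (p1 (z @ v)) = red (p1 v)" "red (p2 (z @ v)) = red (p2 v)"
     "cnt (z @ v) = cnt v" "cent q (z @ v) d' = cent q v d' + (if d' = int (Suc n) then c else 0)" for v d'
      using z(1) unfolding zact_def by blast+
    have "cent q (z @ Z @ v) d mod N d = (cent q v d + (if 1 \<le> d \<and> d \<le> int (Suc n) then cent q w d else 0)) mod N d" for v d
    proof (cases "d = int (Suc n)")
      case True
      have "cent q (z @ Z @ v) d mod N d = (cent q (Z @ v) d + c) mod N d" using True zz(4) by simp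
      also have "\<dots> = (cent q v d + cent q w d) mod N d"
        using Z(6)[of v d] z(2) True by (intro mod_add_cong) auto
      finally show ?thesis using True by simp
    next
      case False
      then have "(1 \<le> d \<and> d \<le> int (Suc n)) = (1 \<le> d \<and> d \<le> int n)" by auto
      then show ?thesis using False Z(6)[of v d] zz(4)[of "Z @ v" d] by (simp only: if_False add_0_right)
    qed
    then show ?case using Z zz z(3) z(1)
      by (intro bexI[of _ "z @ Z"]) (auto simp: zact_def simp del: p1_simps p2_simps)
  qed
  obtain Z where Z: "Z \<in> words_over s" "length Z \<le> (\<Sum>d = 1..D. zb d)"
      "\<And>v. red (p1 (Z @ v)) = red (p1 v)" "\<And>v. red (p2 (Z @ v)) = red (p2 v)" "\<And>v. cnt (Z @ v) = cnt v"
      "\<And>v d. cent q (Z @ v) d mod N d = (cent q v d + (if 1 \<le> d \<and> d \<le> int D then cent q w d else 0)) mod N d"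
    using ex[of D] by (auto simp del: p1_simps p2_simps)
  define a b where "a = red (p1 w)" and "b = red (p2 w)"
  let ?v = "a @ ipow 0 (- ht w) @ b"
  have sa: "set a \<subseteq> set w" "\<forall>l\<in>set a. fst l \<le> 1" and sb: "set b \<subseteq> set w" "\<forall>l\<in>set b. fst l \<in> {0,2,3}"
    using set_red[of "p1 w"] set_red[of "p2 w"] by (auto simp: a_def b_def p1_def p2_def)
  have pa: "p1 a = a" "p2 b = b" using sa sb by (auto simp: p1_def p2_def)
  have vw: "?v \<in> words_over s" using sa(1) sb(1) w s by (auto simp: words_over_def ipow_def)
  have x_only: "pres_eq {} u (ipow 0 (ht u))" if "\<forall>l\<in>set u. fst l = 0" for u
  proof -
    have "ht u = (\<Sum>l\<leftarrow>u. sg (snd l))" using that by (induction u rule: ht.induct) auto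
    then show ?thesis using single_letter_free[OF that] by simp
  qed
  have hta: "ht a = ht w" "ht b = ht w"
    using ht_free[OF red_free_eq[of "{}" "p1 w"]] ht_free[OF red_free_eq[of "{}" "p2 w"]] by (simp_all add: a_def b_def)
  have triv: "pres_eq {} (ipow 0 (ht w) @ ipow 0 (- ht w)) []" "pres_eq {} (ipow 0 (- ht w) @ ipow 0 (ht w)) []"
    using free_ipow[of "{}" 0 "ht w"] free_ipow[of "{}" 0 "- ht w"] by simp_all
  have x12: "\<forall>l\<in>set (p1 b). fst l = 0" "\<forall>l\<in>set (p2 a). fst l = 0"
    using sa sb by (fastforce simp: p1_def p2_def)+
  have "pres_eq {} (p1 b) (ipow 0 (ht w))" using x_only[OF x12(1)] hta by simp
  from pres_eq_left[OF this, of "ipow 0 (- ht w)"]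
  have "pres_eq {} (ipow 0 (- ht w) @ p1 b) []" using triv(2) by (rule pres_eq.trans)
  from pres_eq_left[OF this, of a] have r1: "red (p1 ?v) = red (p1 w)"
    using pa red_free_eq[of "{}" "p1 w"] by (simp add: red_eq_iff a_def pres_eq.trans)
  have "pres_eq {} (p2 a) (ipow 0 (ht w))" using x_only[OF x12(2)] hta by simp
  from pres_eq_right[OF this, of "ipow 0 (- ht w)"]
  have "pres_eq {} (p2 a @ ipow 0 (- ht w)) []" using triv(1) by (rule pres_eq.trans)
  from pres_eq_right[OF this, of b] have r2: "red (p2 ?v) = red (p2 w)"
    using pa red_free_eq[of "{}" "p2 w"] by (simp add: red_eq_iff b_def) (meson pres_eq.trans)
  \<comment> \<open>In \<open>?v\<close> all letters \<open>y\<close> stand before the primed ones,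
    so no pair is counted.\<close>
  have "cent q ?v = (\<lambda>_. 0)"
  proof
    fix d
    have "cent q (p2 a @ p1 (ipow 0 (- ht w) @ b)) d = 0"
    proof -
      have "cent q u d = 0" if "\<forall>l\<in>set u. fst l = 0" for u
        using that by (induction q u d rule: cent.induct) auto
      moreover have "\<forall>l\<in>set (p2 a @ p1 (ipow 0 (- ht w) @ b)). fst l = 0"
      proof -
        have "\<forall>l\<in>set (ipow 0 (- ht w)). fst l = 0" by (auto simp: ipow_def)
        then show ?thesis using x12 by auto
      qed
      ultimately show ?thesis by blast
    qed
    moreover have "cent q b d = 0" using sb
    proof -
      have "cnt u e = 0" if "\<forall>l\<in>set u. fst l \<in> {0,2,3}" for u e
        using that by (induction u e rule: cnt.induct) auto
      then show ?thesis using sb(2) by (induction b) (auto split: prod.splits)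
    qed
    moreover have "cent q a d = 0" using cent_p1[of q a] pa by simp
    ultimately show "cent q ?v d = 0" using cent_append[of q a "ipow 0 (- ht w) @ b" d] by simp
  qed
  then have cent: "cent q (Z @ ?v) d mod N d = cent q w d mod N d" for d
    using Z(6)[of ?v d] N1[of d] far[of d] by (cases "1 \<le> d"; cases "d \<le> int D") (auto simp: dvd_eq_mod_eq_0)
  have "st N q (Z @ ?v) = st N q w"
    unfolding st_def Z(3,4,5) r1 r2 using cent cnt_determined[OF r1] by simp
  then have "nrm N q s w \<le> length (Z @ ?v)" using Z(1) vw by (intro nrm_le) auto
  also have "\<dots> \<le> 3 * \<rho> + (\<Sum>d = 1..D. zb d)"
    using Z(2) l abs_ht_le[of a] hta by (simp add: a_def b_def)
  finally show ?thesis .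
qed

end

subsection \<open>Coloured families of the group\<close>

definition tstep :: "(nat \<Rightarrow> nat \<Rightarrow> nat) \<Rightarrow> nat \<Rightarrow> nat \<Rightarrow> nat" where
  "tstep F K r = F (F r (K * Suc r) + 2 * r) (2 * (K * Suc r)) + 2 * (F r (K * Suc r) + r)"

text \<open>Two tree steps, one inside the other. Slabs of widths \<open>w\<close> and
  \<open>w'\<close> bound the tree diameters by \<open>4 * w + 2 * r\<close> and
  \<open>4 * w' + 2 * r\<close>; the argument of \<open>R\<close> dominates both.\<close>

definition twice :: "(nat \<Rightarrow> nat) \<Rightarrow> nat \<Rightarrow> nat \<Rightarrow> nat" where
  "twice R K r = tstep (\<lambda>r w'. tstep (\<lambda>r w. R (4 * w + 4 * w' + 2 * r)) K r) K r"

text \<open>The variable \<open>x\<close> is the slab width of the outer tree: fixed during the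
  inner step, but required to enter linearly for the outer one.\<close>

lemma tstep_linear:
  assumes "\<And>r w. F r w \<le> c * (r + w + x + 1)"
  shows "tstep F K r \<le> (c * (c * (K + 1) + 3 + 2 * K) + 2 * (c * (K + 1) + 1)) * (r + x + 1)"
proof -
  define u where "u = r + x + 1"
  let ?W = "K * Suc r"
  define c1 where "c1 = c * (K + 1)"
  have W: "?W \<le> K * u" unfolding u_def by (intro mult_le_mono2) simp
  have u: "r + x + 1 = u" "2 * r + x + 1 \<le> 3 * u" "r \<le> u" by (simp_all add: u_def)
  have "F r ?W \<le> c * (r + ?W + x + 1)" by (rule assms)
  also have "\<dots> \<le> c * (K * u + u)" using W u(1) by (intro mult_le_mono2) linarith
  also have "\<dots> = c1 * u" by (simp add: c1_def algebra_simps)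
  finally have 1: "F r ?W \<le> c1 * u" .
  have "F (F r ?W + 2 * r) (2 * ?W) \<le> c * ((F r ?W + 2 * r) + 2 * ?W + x + 1)" by (rule assms)
  also have "\<dots> \<le> c * (c1 * u + 3 * u + 2 * (K * u))"
    using 1 W u(2) by (intro mult_le_mono2) linarith
  finally have 2: "F (F r ?W + 2 * r) (2 * ?W) \<le> c * (c1 * u + 3 * u + 2 * (K * u))" .
  have "tstep F K r \<le> c * (c1 * u + 3 * u + 2 * (K * u)) + 2 * (c1 * u + u)"
    unfolding tstep_def using 1 2 u(3) by (intro add_mono mult_le_mono2)
  also have "\<dots> = (c * (c1 + 3 + 2 * K) + 2 * (c1 + 1)) * u" by (simp add: algebra_simps)
  finally show ?thesis by (simp only: c1_def u_def)
qed

lemma twice_linear: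
  "\<exists>C. \<forall>r. twice (\<lambda>\<rho>. c * (\<rho> + 1)) K r \<le> C * (r + 1)"
proof -
  define c1 where "c1 = (4 * c) * ((4 * c) * (K + 1) + 3 + 2 * K) + 2 * ((4 * c) * (K + 1) + 1)"
  have in1: "tstep (\<lambda>r w. c * (4 * w + 4 * w' + 2 * r + 1)) K r \<le> c1 * (r + w' + 1)" for r w'
    unfolding c1_def
  proof (rule tstep_linear)
    fix r w
    have "c * (4 * w + 4 * w' + 2 * r + 1) \<le> c * (4 * (r + w + w' + 1))" by (intro mult_le_mono2) simp
    then show "c * (4 * w + 4 * w' + 2 * r + 1) \<le> 4 * c * (r + w + w' + 1)" by (simp only: ac_simps)
  qed
  have "twice (\<lambda>\<rho>. c * (\<rho> + 1)) K r \<le> (c1 * (c1 * (K + 1) + 3 + 2 * K) + 2 * (c1 * (K + 1) + 1)) * (r + 0 + 1)" for r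
    unfolding twice_def using in1 by (intro tstep_linear) simp
  then show ?thesis unfolding add_0_right by blast
qed

context
  fixes s :: nat and N q :: "int \<Rightarrow> int"
  assumes s: "s = 3 \<or> s = 4" and N_nonneg: "\<And>d. 0 \<le> N d" and N1: "\<And>d. d \<le> 0 \<Longrightarrow> N d = 1"
begin

text \<open>A height bound for the second tree survives passage to subsets, so the first tree can be
  treated inside a slab of the second.\<close>

lemma fam_words:
  assumes base: "\<And>\<rho> r B. B \<subseteq> words_over s \<Longrightarrow> (\<forall>x\<in>B. \<forall>y\<in>B. chain (wd N q s) r B x y)
      \<Longrightarrow> (\<forall>x\<in>B. \<forall>y\<in>B. length (red (p1 (winv x @ y))) \<le> \<rho>)
      \<Longrightarrow> (\<forall>x\<in>B. \<forall>y\<in>B. length (red (p2 (winv x @ y))) \<le> \<rho>)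
      \<Longrightarrow> r \<le> \<rho> \<Longrightarrow> fam (wd N q s) K B p r (R \<rho>)"
    and K: "0 < K"
  shows "fam (wd N q s) K (words_over s) (p + 2) r (twice R K r)"
proof -
  interpret pm: pseudometric "wd N q s"
    by (rule pseudometric_wd[where N = N and q = q and s = s, OF s N_nonneg])
  let ?h1 = "\<lambda>x. length (red (p1 (winv x)))" and ?h2 = "\<lambda>x. length (red (p2 (winv x)))"
  have lip1: "?h1 x \<le> ?h1 y + wd N q s x y" and lip2: "?h2 x \<le> ?h2 y + wd N q s x y"
    if "x \<in> words_over s" "y \<in> words_over s" for x y
    using tree_height_lipschitz[of p1 x s y N q] tree_height_lipschitz[of p2 x s y N q] that by auto
  have 1: "fam (wd N q s) K B2 (Suc p) r' (tstep (\<lambda>r w. R (4 * w + 4 * w2 + 2 * r)) K r')"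
    if B2: "B2 \<subseteq> words_over s" "\<forall>x\<in>B2. \<forall>y\<in>B2. ?h2 x \<le> ?h2 y + w2" for B2 w2 r'
    unfolding tstep_def
  proof (rule pm.fam_tree_step[where h = ?h1])
    fix r w B
    assume B: "B \<subseteq> B2" "\<forall>x\<in>B. \<forall>y\<in>B. chain (wd N q s) r B x y" "\<forall>x\<in>B. \<forall>y\<in>B. ?h1 x \<le> ?h1 y + w"
    have Bs: "B \<subseteq> words_over s" using B B2 by blast
    have h2: "?h2 x \<le> ?h2 y + w2" if "x \<in> B" "y \<in> B" for x y
      using B2(2) B(1) that by blast
    let ?\<rho> = "4 * w + 4 * w2 + 2 * r"
    have "length (red (p1 (winv x @ y))) \<le> ?\<rho>" if "x \<in> B" "y \<in> B" for x y
      using tree_slab_bounded[of p1 B s N q r w x y] Bs B that by (simp add: trans_le_add1)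
    moreover have "length (red (p2 (winv x @ y))) \<le> ?\<rho>" if "x \<in> B" "y \<in> B" for x y
    proof -
      have "length (red (p2 (winv x @ y))) \<le> 4 * w2 + 2 * r"
        by (rule tree_slab_bounded[of p2 B s N q r w2 x y]) (use Bs B(2) h2 that in auto)
      then show ?thesis by simp
    qed
    ultimately show "fam (wd N q s) K B p r (R ?\<rho>)" by (intro base Bs B) auto
  qed (use lip1 B2 K in auto)
  have "fam (wd N q s) K (words_over s) (Suc (Suc p)) r (twice R K r)"
    unfolding twice_def tstep_def[of "\<lambda>r w'. tstep (\<lambda>r w. R (4 * w + 4 * w' + 2 * r)) K r"]
    by (rule pm.fam_tree_step[where h = ?h2]) (use 1 lip2 K in auto)
  then show ?thesis by simp
qed

text \<open>Active coordinates are confined by gaps and cost about \<open>m\<close>, a square root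
  of the gap bound; \<open>zb\<close> records how cheaply each other coordinate can be normalised
  completely.\<close>

lemma fam_base_sum:
  fixes P :: int and zb :: "nat \<Rightarrow> nat" and act :: "nat set"
  assumes B: "B \<subseteq> words_over s" "\<forall>x\<in>B. \<forall>y\<in>B. chain (wd N q s) r B x y"
      "\<forall>x\<in>B. \<forall>y\<in>B. length (red (p1 (winv x @ y))) \<le> \<rho>"
      "\<forall>x\<in>B. \<forall>y\<in>B. length (red (p2 (winv x @ y))) \<le> \<rho>"
    and r: "r \<le> \<rho>"
    and act: "finite act" "card act \<le> p" "\<And>d. d \<in> act \<Longrightarrow> q (int d) = 0 \<and> P dvd N (int d)"
    and P: "int K * ((2 * int \<rho>)\<^sup>2 + 1) \<le> P" "0 < P" "P + (2 * int \<rho>)\<^sup>2 \<le> (int m)\<^sup>2" "0 < m"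
    and zb: "\<And>d c. 1 \<le> d \<Longrightarrow> d \<le> 2 * \<rho> \<Longrightarrow> d \<notin> act \<Longrightarrow>
      \<exists>z c'. zact s q z (int d) c' \<and> c' mod N (int d) = c mod N (int d) \<and> length z \<le> zb d"
  shows "fam (wd N q s) K B p r (3 * \<rho> + (\<Sum>d = 1..2 * \<rho>. if d \<in> act then 6 * m + 8 * d + 2 else zb d))"
proof (rule fam_base[where act = "int ` act" and P = P and \<rho> = \<rho>])
  show "card (int ` act) \<le> p" using act by (simp add: card_image)
  fix w assume w: "w \<in> words_over s" "length (red (p1 w)) \<le> \<rho>" "length (red (p2 w)) \<le> \<rho>"
    and far: "\<And>d. 2 * int \<rho> < d \<Longrightarrow> N d dvd cent q w d"
    and t: "\<And>d. d \<in> int ` act \<Longrightarrow> \<exists>t. \<bar>t\<bar> \<le> P + (2 * int \<rho>)\<^sup>2 \<and> cent q w d mod N d = t mod N d"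
  show "nrm N q s w \<le> 3 * \<rho> + (\<Sum>d = 1..2 * \<rho>. if d \<in> act then 6 * m + 8 * d + 2 else zb d)"
  proof (rule nrm_normal_form)
    fix d assume d: "1 \<le> d" "d \<le> 2 * \<rho>"
    show "\<exists>z c. zact s q z (int d) c \<and> c mod N (int d) = cent q w (int d) mod N (int d)
       \<and> length z \<le> (if d \<in> act then 6 * m + 8 * d + 2 else zb d)"
    proof (cases "d \<in> act")
      case True
      then obtain x where x: "\<bar>x\<bar> \<le> P + (2 * int \<rho>)\<^sup>2" "cent q w (int d) mod N (int d) = x mod N (int d)" using t by blast
      have "\<bar>x\<bar> \<le> (int m)\<^sup>2" using x(1) P(3) by linarith
      then obtain z where "zact s q z (int d) x" "length z \<le> 6 * m + 8 * d + 2"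
        using zact_sqrt[where s = s and N = N and q = q and m = m and t = x and d = d, OF s N_nonneg P(4)] by blast
      then show ?thesis using True x by auto
    next
      case False
      then show ?thesis using zb[OF d False, of "cent q w (int d)"] by simp
    qed
  qed (use s N_nonneg N1 w far in auto)
qed (use s N_nonneg N1 B r act P in auto)

text \<open>Only the \<open>k0\<close> coordinates of infinite order are active. Each of the
  finitely many others up to \<open>2 * \<rho>\<close> is a finite cyclic group, bounded crudely
  through its order; no growth rate is claimed for \<open>R\<close>.\<close>

lemma asdim_fam:
  assumes fin: "\<And>d. k0 < d \<Longrightarrow> N (int d) \<noteq> 0" and q0: "\<And>d. d \<le> k0 \<Longrightarrow> q (int d) = 0 \<and> (1 \<le> d \<longrightarrow> N (int d) = 0)"
    and K: "0 < K"
  shows "\<exists>R. \<forall>r. fam (wd N q s) K (words_over s) (k0 + 2) r (R r)"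
proof -
  define m where "m \<rho> = K * ((2 * \<rho>)\<^sup>2 + 1) + (2 * \<rho>)\<^sup>2" for \<rho>
  define R where "R \<rho> = 3 * \<rho> + (\<Sum>d = 1..2 * \<rho>. if d \<in> {1..k0} then 6 * m \<rho> + 8 * d + 2 else 6 * nat (N (int d)) + 8 * d + 2)" for \<rho>
  have "fam (wd N q s) K (words_over s) (k0 + 2) r (twice R K r)" for r
  proof (rule fam_words)
    fix \<rho> r B
    assume B: "B \<subseteq> words_over s" "\<forall>x\<in>B. \<forall>y\<in>B. chain (wd N q s) r B x y"
      "\<forall>x\<in>B. \<forall>y\<in>B. length (red (p1 (winv x @ y))) \<le> \<rho>"
      "\<forall>x\<in>B. \<forall>y\<in>B. length (red (p2 (winv x @ y))) \<le> \<rho>" "r \<le> \<rho>"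
    let ?P = "int K * ((2 * int \<rho>)\<^sup>2 + 1)"
    have Pm: "?P + (2 * int \<rho>)\<^sup>2 = int (m \<rho>)" by (simp add: m_def algebra_simps)
    have "int (m \<rho>) \<le> (int (m \<rho>))\<^sup>2" by (cases "m \<rho>") (simp_all add: power2_eq_square)
    then have P3: "?P + (2 * int \<rho>)\<^sup>2 \<le> (int (m \<rho>))\<^sup>2" unfolding Pm .
    have m0: "0 < m \<rho>" using K by (simp add: m_def)
    show "fam (wd N q s) K B k0 r (R \<rho>)" unfolding R_def
    proof (rule fam_base_sum[where P = ?P])
      fix d c assume d: "1 \<le> d" "d \<le> 2 * \<rho>" "d \<notin> {1..k0}"
      then have "N (int d) \<noteq> 0" using fin[of d] by simp
      then have n: "0 < N (int d)" using N_nonneg[of "int d"] by linarith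
      let ?c = "c mod N (int d)"
      have "\<bar>?c\<bar> \<le> (int (nat (N (int d))))\<^sup>2"
      proof -
        have "N (int d) \<le> N (int d) * N (int d)" using n by simp
        moreover have "0 \<le> ?c" "?c < N (int d)" using n by auto
        ultimately have "0 \<le> ?c" "?c \<le> N (int d) * N (int d)" by linarith+
        then show ?thesis using n unfolding power2_eq_square by simp
      qed
      then obtain z where "zact s q z (int d) ?c" "length z \<le> 6 * nat (N (int d)) + 8 * d + 2"
        using zact_sqrt[where s = s and N = N and q = q and m = "nat (N (int d))" and t = ?c and d = d, OF s N_nonneg] n by auto
      then show "\<exists>z c'. zact s q z (int d) c' \<and> c' mod N (int d) = c mod N (int d) \<and> length z \<le> 6 * nat (N (int d)) + 8 * d + 2"
        by (intro exI[of _ z] exI[of _ ?c]) simp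
    qed (use B q0 P3 m0 K in auto)
  qed (rule K)
  then show ?thesis by blast
qed

end

subsection \<open>The orders of the central generators\<close>

text \<open>Binary logarithm rounded down, with \<open>lg 0 = 0\<close>; \<open>expo\<close> is the
  one rounded up. Given as least numbers, both are computable by minimisation.\<close>

definition lg :: "nat \<Rightarrow> nat" where "lg n = (LEAST i. n < 2 ^ Suc i)"
definition expo :: "nat \<Rightarrow> nat" where "expo d = (LEAST e. d \<le> 2 ^ e)"

definition bpos :: "nat \<Rightarrow> nat" where "bpos d = expo d - 2 ^ lg (expo d)"
text \<open>For \<open>d = 2 ^ (2 ^ i + c)\<close> this is \<open>2 * 2 ^ i + c - i\<close>. So
  \<open>2 ^ bexp d\<close> exceeds \<open>d\<close> by the factor \<open>2 ^ (2 ^ i - i)\<close>,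
  is at most the square of \<open>d\<close>, as the collapse requires, and by \<open>c < i\<close>
  stays below \<open>2 ^ 2 ^ (i + 1)\<close>, where the next block begins.\<close>

definition bexp :: "nat \<Rightarrow> nat" where "bexp d = 2 ^ lg (expo d) + expo d - lg (expo d)"

text \<open>The nontrivial finite orders sit at \<open>d = 2 ^ (2 ^ i + c)\<close> with \<open>c < min i a\<close>. For given \<open>i\<close> these
  are boundedly many scales comparable to \<open>2 ^ 2 ^ i\<close>, whereas the square roots \<open>2 ^ bexp d\<close> of the
  orders are far larger than all of them and smaller than the scales of the next block.\<close>
definition blk :: "enat \<Rightarrow> enat \<Rightarrow> nat \<Rightarrow> bool" where
  "blk k a d \<longleftrightarrow> k < enat d \<and> d = 2 ^ expo d \<and> bpos d < lg (expo d) \<and> enat (bpos d) < a"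

definition Nn :: "enat \<Rightarrow> enat \<Rightarrow> nat \<Rightarrow> nat" where
  "Nn k a d = (if d = 0 then 1 else if enat d \<le> k then 0 else if blk k a d then 2 ^ (2 * bexp d) else 1)"

text \<open>The positions from \<open>b\<close> on are collapsed, with the square root of the order
  as weight; the first \<open>b\<close> positions of each block survive, and
  \<open>b = \<infinity>\<close> collapses nothing.\<close>

definition qn :: "enat \<Rightarrow> enat \<Rightarrow> enat \<Rightarrow> nat \<Rightarrow> nat" where
  "qn k a b d = (if blk k a d \<and> b \<le> enat (bpos d) then 2 ^ bexp d else 0)"

definition Nz :: "enat \<Rightarrow> enat \<Rightarrow> int \<Rightarrow> int" where "Nz k a d = int (Nn k a (nat d))"
definition qz :: "enat \<Rightarrow> enat \<Rightarrow> enat \<Rightarrow> int \<Rightarrow> int" where "qz k a b d = int (qn k a b (nat d))"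

lemma expo_power [simp]: "expo (2 ^ e) = e"
  unfolding expo_def by (rule Least_equality) auto

lemma lg_bounds: "1 \<le> n \<Longrightarrow> 2 ^ lg n \<le> n" "n < 2 ^ Suc (lg n)"
proof -
  have "n < 2 ^ Suc n" by (metis less_exp less_SucI less_trans lessI power_strict_increasing_iff one_less_numeral_iff semiring_norm(76))
  then show "n < 2 ^ Suc (lg n)" unfolding lg_def by (rule LeastI)
  assume n: "1 \<le> n"
  show "2 ^ lg n \<le> n"
  proof (cases "lg n")
    case (Suc i)
    then have "\<not> n < 2 ^ Suc i" using not_less_Least[of i "\<lambda>i. n < 2 ^ Suc i"] by (simp add: lg_def)
    then show ?thesis using Suc by simp
  qed (use n in simp)
qed

lemma lg_eq: "c < 2 ^ i \<Longrightarrow> lg (2 ^ i + c) = i"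
proof -
  assume c: "c < 2 ^ i"
  let ?n = "2 ^ i + c"
  have "?n < 2 ^ Suc i" using c by simp
  then have 1: "lg ?n \<le> i" unfolding lg_def by (rule Least_le)
  have "2 ^ i < (2::nat) ^ Suc (lg ?n)" using lg_bounds(2)[of ?n] by simp
  then have "i < Suc (lg ?n)" by (simp only: power_strict_increasing_iff one_less_numeral_iff semiring_norm)
  then show ?thesis using 1 by simp
qed

lemma blkD:
  assumes "blk k a d"
  shows "d = 2 ^ (2 ^ lg (expo d) + bpos d)" "bexp d = 2 * 2 ^ lg (expo d) + bpos d - lg (expo d)"
    "bpos d < lg (expo d)" "lg (expo d) < 2 ^ lg (expo d)" "enat (bpos d) < a" "k < enat d"
    "2 ^ lg (expo d) \<le> bexp d" "bexp d < 2 ^ Suc (lg (expo d))"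
proof -
  show 1: "bpos d < lg (expo d)" "enat (bpos d) < a" "k < enat d" using assms by (auto simp: blk_def)
  show 2: "lg (expo d) < 2 ^ lg (expo d)" by simp
  have "expo d \<noteq> 0"
  proof
    assume "expo d = 0"
    moreover have "lg 0 = 0" unfolding lg_def by (rule Least_equality) auto
    ultimately show False using 1 by simp
  qed
  then have e: "expo d = 2 ^ lg (expo d) + bpos d" using lg_bounds(1)[of "expo d"] by (simp add: bpos_def)
  show "d = 2 ^ (2 ^ lg (expo d) + bpos d)" using assms e by (simp add: blk_def)
  show 3: "bexp d = 2 * 2 ^ lg (expo d) + bpos d - lg (expo d)" using e unfolding bexp_def by linarith
  show "2 ^ lg (expo d) \<le> bexp d" "bexp d < 2 ^ Suc (lg (expo d))" using 1 2 3 unfolding power_Suc by linarith+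
qed

lemma blk_power:
  assumes "c < i" "enat c < a" "k < enat (2 ^ (2 ^ i + c))"
  shows "blk k a (2 ^ (2 ^ i + c))" "bpos (2 ^ (2 ^ i + c)) = c" "bexp (2 ^ (2 ^ i + c)) = 2 * 2 ^ i + c - i"
proof -
  have "c < 2 ^ i" using assms(1) by (meson less_exp less_trans)
  then have l: "lg (2 ^ i + c) = i" by (rule lg_eq)
  show b: "bpos (2 ^ (2 ^ i + c)) = c" by (simp add: bpos_def l)
  show "blk k a (2 ^ (2 ^ i + c))" using assms b by (simp add: blk_def l)
  show "bexp (2 ^ (2 ^ i + c)) = 2 * 2 ^ i + c - i" by (simp add: bexp_def l)
qed

text \<open>The exponent lies between \<open>2 ^ i\<close> and \<open>2 ^ (i + 1)\<close>, which
  determines the block; within a block it determines the position. Hence the square roots of the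
  orders are distinct powers of two.\<close>

lemma bexp_inj: "inj_on bexp {d. blk k a d}"
proof (rule inj_onI, clarsimp)
  fix d d' assume b: "blk k a d" "blk k a d'" "bexp d = bexp d'"
  note D = blkD[OF b(1)] blkD[OF b(2)]
  have "2 ^ lg (expo d) < (2::nat) ^ Suc (lg (expo d'))" "2 ^ lg (expo d') < (2::nat) ^ Suc (lg (expo d))"
    using D b(3) by linarith+
  then have "lg (expo d) < Suc (lg (expo d'))" "lg (expo d') < Suc (lg (expo d))"
    by (simp_all only: power_strict_increasing_iff one_less_numeral_iff semiring_norm)
  then have l: "lg (expo d) = lg (expo d')" by simp
  then have "bpos d = bpos d'" using D(2,3,4) D(10,11,12) b(3) unfolding l by linarith
  then show "d = d'" using D(1) D(9) l by metis
qed

text \<open>A geometric series over the image of \<open>g\<close>: unboundedly many inactive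
  coordinates together cost no more than twice the bound for a single one.\<close>

lemma sum_powers_le:
  assumes "finite S" "inj_on g S" "\<And>x. x \<in> S \<Longrightarrow> 2 ^ g x \<le> (B::nat)"
  shows "(\<Sum>x\<in>S. 2 ^ g x) \<le> 2 * B"
proof (cases "S = {}")
  case False
  have fin: "finite (g ` S)" "g ` S \<noteq> {}" using assms False by auto
  have geom: "(\<Sum>e<n. (2::nat) ^ e) < 2 ^ n" for n by (induction n) auto
  let ?m = "Max (g ` S)"
  have "(\<Sum>x\<in>S. 2 ^ g x) = (\<Sum>e\<in>g ` S. (2::nat) ^ e)" using assms(2) by (simp add: sum.reindex)
  also have "\<dots> \<le> (\<Sum>e<Suc ?m. 2 ^ e)" using fin by (intro sum_mono2) (auto simp: less_Suc_eq_le)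
  also have "\<dots> \<le> 2 * 2 ^ ?m" using geom[of "Suc ?m"] by simp
  also have "\<dots> \<le> 2 * B" using Max_in[OF fin] assms(3) by auto
  finally show ?thesis .
qed simp

lemma Nz_nonneg: "0 \<le> Nz k a d" by (simp add: Nz_def)
lemma Nz_nonpos: "d \<le> 0 \<Longrightarrow> Nz k a d = 1" by (simp add: Nz_def Nn_def)

lemma asdim_upper:
  assumes s: "s = 3 \<or> s = 4" and K: "0 < K"
  shows "\<exists>R. \<forall>r. fam (wd (Nz (enat k) a) (qz (enat k) a b) s) K (words_over s) (k + 2) r (R r)"
proof (rule asdim_fam[OF s])
  fix d
  show "k < d \<Longrightarrow> Nz (enat k) a (int d) \<noteq> 0" by (simp add: Nz_def Nn_def)
  show "d \<le> k \<Longrightarrow> qz (enat k) a b (int d) = 0 \<and> (1 \<le> d \<longrightarrow> Nz (enat k) a (int d) = 0)"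
    by (auto simp: Nz_def Nn_def qz_def qn_def blk_def)
qed (use K in \<open>auto simp: Nz_nonneg Nz_nonpos\<close>)

text \<open>An uncollapsed finite coordinate matters only if its index is within reach and its order
  exceeds the gap period. The blocks are so sparse that at each scale all of these lie in one block,
  which leaves at most \<open>f\<close> positions; the other coordinates add up to geometric sums
  linear in \<open>\<rho>\<close>.\<close>

lemma asdim_AN_upper:
  assumes s: "s = 4 \<or> s = 3 \<and> b = \<infinity>" and K: "0 < K" and f: "min a b = enat f"
  shows "\<exists>C. \<forall>r. fam (wd (Nz (enat k) a) (qz (enat k) a b) s) K (words_over s) (k + f + 2) r (C * (r + 1))"
proof -
  let ?N = "Nz (enat k) a" and ?q = "qz (enat k) a b"
  have s34: "s = 3 \<or> s = 4" using s by auto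
  define c where "c = 3 + (k + f) * (12 * (2 * K + 1) + 18) + 128 + 24 * (2 * K + 1)"
  have base: "fam (wd ?N ?q s) K B (k + f) r (c * (\<rho> + 1))"
    if B: "B \<subseteq> words_over s" "\<forall>x\<in>B. \<forall>y\<in>B. chain (wd ?N ?q s) r B x y"
      "\<forall>x\<in>B. \<forall>y\<in>B. length (red (p1 (winv x @ y))) \<le> \<rho>"
      "\<forall>x\<in>B. \<forall>y\<in>B. length (red (p2 (winv x @ y))) \<le> \<rho>" "r \<le> \<rho>" for \<rho> r B
  proof -
    define Y where "Y = K * ((2 * \<rho>)\<^sup>2 + 1)"
    have "1 \<le> Y" using K by (simp add: Y_def)
    then obtain e where e: "2 ^ e \<le> Y" "Y < 2 ^ Suc e" using lg_bounds[of Y] by auto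
    \<comment> \<open>Rounded up to a power of two, the period divides every larger order in a
      block, these being powers of two as well.\<close>
    define P where "P = (2::nat) ^ Suc e"
    have PY: "Y \<le> P" "P \<le> 2 * Y" using e by (auto simp: P_def)
    define m where "m = (2 * K + 1) * (2 * \<rho> + 1)"
    have Pm: "P + (2 * \<rho>)\<^sup>2 \<le> m\<^sup>2"
    proof -
      have "P + (2 * \<rho>)\<^sup>2 \<le> (2 * K + 1) * ((2 * \<rho>)\<^sup>2 + 1)" using PY(2) by (simp add: Y_def algebra_simps)
      also have "\<dots> \<le> (2 * K + 1)\<^sup>2 * (2 * \<rho> + 1)\<^sup>2"
        by (intro mult_le_mono) (simp_all add: power2_eq_square)
      finally show ?thesis by (simp only: m_def power_mult_distrib)
    qed
    define act2 where "act2 = {d \<in> {1..2 * \<rho>}. blk (enat k) a d \<and> enat (bpos d) < b \<and> P < 2 ^ (2 * bexp d)}"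
    define act where "act = {1..min k (2 * \<rho>)} \<union> act2"
    have fin: "finite act" "finite act2" by (auto simp: act_def act2_def)
    have big: "2 * \<rho> < 2 ^ bexp d" if "d \<in> act2" for d
    proof -
      have "1 * ((2 * \<rho>)\<^sup>2 + 1) \<le> Y" unfolding Y_def using K by (intro mult_le_mono1) simp
      then have "(2 * \<rho>)\<^sup>2 < Y" by simp
      then have "(2 * \<rho>)\<^sup>2 < (2 ^ bexp d)\<^sup>2" using that PY(1) by (auto simp: act2_def power_mult[symmetric] mult.commute)
      then show ?thesis by (rule power_less_imp_less_base) simp
    qed
    \<comment> \<open>An index in a later block exceeds \<open>2 ^ bexp d\<close>, hence
      \<open>2 * \<rho>\<close> while \<open>d\<close> is active: the later block is still out of
      reach.\<close>
    have lt: "\<not> lg (expo d) < lg (expo d')" if d: "d \<in> act2" "d' \<in> act2" for d d'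
    proof
      assume l: "lg (expo d) < lg (expo d')"
      have bl: "blk (enat k) a d" "blk (enat k) a d'" "d' \<le> 2 * \<rho>" using d by (auto simp: act2_def)
      have "(2::nat) ^ 2 ^ lg (expo d') \<le> 2 ^ (2 ^ lg (expo d') + bpos d')" by (intro power_increasing) auto
      also have "\<dots> = d'" using blkD(1)[OF bl(2)] by simp
      also have "\<dots> < 2 ^ bexp d" using big[OF d(1)] bl(3) by simp
      finally have "2 ^ lg (expo d') < bexp d" by (simp only: power_strict_increasing_iff one_less_numeral_iff semiring_norm)
      moreover have "(2::nat) ^ Suc (lg (expo d)) \<le> 2 ^ lg (expo d')" using l by (intro power_increasing) auto
      ultimately show False using blkD(8)[OF bl(1)] by simp
    qed
    have "card act2 \<le> card {..<f}"
    proof (rule card_inj_on_le[of bpos])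
      show "inj_on bpos act2"
      proof (rule inj_onI)
        fix d d' assume d: "d \<in> act2" "d' \<in> act2" "bpos d = bpos d'"
        then have "lg (expo d) = lg (expo d')" using lt[of d d'] lt[of d' d] by simp
        moreover have "blk (enat k) a d" "blk (enat k) a d'" using d by (auto simp: act2_def)
        ultimately show "d = d'" using blkD(1) d(3) by metis
      qed
      show "bpos ` act2 \<subseteq> {..<f}"
      proof clarsimp
        fix d assume "d \<in> act2"
        then have "enat (bpos d) < min a b" by (auto simp: act2_def dest: blkD(5))
        then show "bpos d < f" using f by simp
      qed
    qed simp
    then have card: "card act \<le> k + f"
      using card_Un_le[of "{1..min k (2 * \<rho>)}" act2] by (simp add: act_def)
    \<comment> \<open>Small orders cost their square root, collapsed coordinates a multiple of
      \<open>d\<close> whatever their order, trivial ones nothing. The constant 28 is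
      \<open>12 + 16\<close> from \<open>zact_collapsed\<close> with \<open>m = d\<close>.\<close>
    define zb where "zb d = (if blk (enat k) a d then if enat (bpos d) < b then 6 * 2 ^ bexp d + 8 * d + 2 else 28 * d + 4 else 0)" for d
    have fb: "fam (wd ?N ?q s) K B (k + f) r (3 * \<rho> + (\<Sum>d = 1..2 * \<rho>. if d \<in> act then 6 * m + 8 * d + 2 else zb d))"
    proof (rule fam_base_sum[where P = "int P"])
      show "?q (int d) = 0 \<and> int P dvd ?N (int d)" if "d \<in> act" for d
      proof (cases "d \<le> k")
        case True
        then show ?thesis using that by (auto simp: Nz_def Nn_def qz_def qn_def blk_def act_def act2_def)
      next
        case False
        then have d: "d \<in> act2" using that by (auto simp: act_def)
        have "(2::nat) ^ Suc e < 2 ^ (2 * bexp d)" using d by (simp add: act2_def P_def)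
        then have "Suc e \<le> 2 * bexp d" by (simp only: power_strict_increasing_iff one_less_numeral_iff semiring_norm less_imp_le)
        then have "P dvd Nn (enat k) a d" using d False by (auto simp: P_def Nn_def act2_def intro: le_imp_power_dvd simp del: power_Suc)
        then show ?thesis using d by (auto simp: Nz_def qz_def qn_def act2_def not_less[symmetric])
      qed
      have "int K * ((2 * int \<rho>)\<^sup>2 + 1) = int Y" by (simp add: Y_def algebra_simps)
      then show "int K * ((2 * int \<rho>)\<^sup>2 + 1) \<le> int P" using PY by simp
      have "int (P + (2 * \<rho>)\<^sup>2) \<le> int (m\<^sup>2)" using Pm by (simp only: of_nat_le_iff)
      then show "int P + (2 * int \<rho>)\<^sup>2 \<le> (int m)\<^sup>2" by simp
      show "0 < int P" "0 < m" by (simp_all add: P_def m_def)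
      fix d c assume d: "1 \<le> d" "d \<le> 2 * \<rho>" "d \<notin> act"
      then have dk: "\<not> d \<le> k" by (auto simp: act_def)
      show "\<exists>z c'. zact s ?q z (int d) c' \<and> c' mod ?N (int d) = c mod ?N (int d) \<and> length z \<le> zb d"
      proof (cases "blk (enat k) a d")
        case False
        have "zact s ?q [] (int d) 0" by (simp add: zact_def[OF s34 Nz_nonneg])
        then show ?thesis using False dk d by (intro exI[of _ "[]"] exI[of _ 0]) (simp add: Nz_def Nn_def zb_def)
      next
        case True
        have N: "?N (int d) = (2 ^ bexp d)\<^sup>2" using True dk d by (simp add: Nz_def Nn_def power_mult mult.commute)
        define t where "t = c mod ?N (int d)"
        have t: "0 \<le> t" "t < (2 ^ bexp d)\<^sup>2" "t mod ?N (int d) = c mod ?N (int d)" unfolding t_def N by simp_all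
        show ?thesis
        proof (cases "enat (bpos d) < b")
          case True
          have "\<bar>t\<bar> \<le> (int (2 ^ bexp d))\<^sup>2" using t by simp
          then obtain z where "zact s ?q z (int d) t" "length z \<le> 6 * 2 ^ bexp d + 8 * d + 2"
            using zact_sqrt[where s = s and N = ?N and q = ?q and m = "2 ^ bexp d" and t = t and d = d, OF s34 Nz_nonneg] by auto
          then show ?thesis using True t \<open>blk (enat k) a d\<close> by (intro exI[of _ z] exI[of _ t]) (simp add: zb_def)
        next
          case False
          then have s4: "s = 4" using s by auto
          have q: "?q (int d) = 2 ^ bexp d" using False True by (simp add: qz_def qn_def not_less)
          have "bexp d \<le> 2 * (2 ^ lg (expo d) + bpos d)" using blkD(8)[OF True] by simp
          then have "(2::nat) ^ bexp d \<le> d\<^sup>2"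
            by (subst blkD(1)[OF True]) (simp only: power_mult[symmetric] mult.commute[of _ 2] power_increasing_iff one_less_numeral_iff semiring_norm)
          then have "int (2 ^ bexp d) \<le> int (d\<^sup>2)" by (simp only: of_nat_le_iff)
          then have "?q (int d) \<le> (int d)\<^sup>2" using q by simp
          then obtain z where "zact s ?q z (int d) t" "length z \<le> 12 * d + 16 * d + 4"
            using zact_collapsed[where s = s and N = ?N and q = ?q and m = d and t = t and d = d, OF s34 Nz_nonneg s4] d q t by auto
          then show ?thesis using False t True by (intro exI[of _ z] exI[of _ t]) (simp add: zb_def)
        qed
      qed
    qed (use s34 B fin card in \<open>auto simp: Nz_nonneg Nz_nonpos\<close>)
    let ?S = "{d \<in> {1..2 * \<rho>}. blk (enat k) a d}"
    let ?T = "{d \<in> ?S. 2 ^ (2 * bexp d) \<le> P}"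
    have "(\<Sum>d = 1..2 * \<rho>. if d \<in> act then 6 * m + 8 * d + 2 else zb d)
      \<le> (\<Sum>d = 1..2 * \<rho>. (if d \<in> act then 6 * m + 16 * \<rho> + 2 else 0)
          + ((if d \<in> ?S then 32 * 2 ^ expo d else 0) + (if d \<in> ?T then 6 * 2 ^ bexp d else 0)))"
    proof (rule sum_mono)
      fix d assume d: "d \<in> {1..2 * \<rho>}"
      show "(if d \<in> act then 6 * m + 8 * d + 2 else zb d) \<le> (if d \<in> act then 6 * m + 16 * \<rho> + 2 else 0)
          + ((if d \<in> ?S then 32 * 2 ^ expo d else 0) + (if d \<in> ?T then 6 * 2 ^ bexp d else 0))"
      proof (cases "d \<in> act \<or> \<not> blk (enat k) a d")
        case True then show ?thesis using d by (auto simp: zb_def)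
      next
        case False
        then have "2 ^ expo d = d" by (simp add: blk_def)
        then show ?thesis using False d by (auto simp: zb_def act_def act2_def not_less)
      qed
    qed
    also have "\<dots> = card act * (6 * m + 16 * \<rho> + 2) + 32 * (\<Sum>d\<in>?S. 2 ^ expo d) + 6 * (\<Sum>d\<in>?T. 2 ^ bexp d)"
    proof -
      have "{1..2 * \<rho>} \<inter> act = act" by (auto simp: act_def act2_def)
      moreover have "{1..2 * \<rho>} \<inter> ?S = ?S" "{1..2 * \<rho>} \<inter> ?T = ?T" by auto
      ultimately show ?thesis
        unfolding sum.distrib sum_distrib_left by (simp only: sum.inter_restrict[symmetric] finite_atLeastAtMost sum_constant of_nat_id add.assoc)
    qed
    also have "\<dots> \<le> (k + f) * (6 * m + 16 * \<rho> + 2) + 32 * (2 * (2 * \<rho>)) + 6 * (2 * m)"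
    proof (intro add_mono mult_le_mono order_refl card)
      show "(\<Sum>d\<in>?S. 2 ^ expo d) \<le> 2 * (2 * \<rho>)"
      proof (rule sum_powers_le)
        show "inj_on expo ?S" by (rule inj_onI) (metis (mono_tags, lifting) blk_def mem_Collect_eq)
        show "2 ^ expo d \<le> 2 * \<rho>" if "d \<in> ?S" for d using that by (auto simp: blk_def)
      qed simp
      show "(\<Sum>d\<in>?T. 2 ^ bexp d) \<le> 2 * m"
      proof (rule sum_powers_le)
        show "inj_on bexp ?T" by (rule inj_on_subset[OF bexp_inj]) auto
        fix d assume "d \<in> ?T"
        then have "(2 ^ bexp d)\<^sup>2 \<le> m\<^sup>2" using Pm by (simp add: power_mult[symmetric] mult.commute)
        then show "2 ^ bexp d \<le> m" by (rule power2_le_imp_le) simp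
      qed simp
    qed
    finally have "3 * \<rho> + (\<Sum>d = 1..2 * \<rho>. if d \<in> act then 6 * m + 8 * d + 2 else zb d)
      \<le> 3 * \<rho> + (k + f) * (6 * m + 16 * \<rho> + 2) + 32 * (2 * (2 * \<rho>)) + 6 * (2 * m)" by simp
    also have "\<dots> \<le> c * (\<rho> + 1)"
    proof -
      have m: "m \<le> 2 * (2 * K + 1) * (\<rho> + 1)" by (simp add: m_def algebra_simps)
      have "(k + f) * (6 * m + 16 * \<rho> + 2) \<le> (k + f) * ((12 * (2 * K + 1) + 18) * (\<rho> + 1))"
        using m by (intro mult_le_mono2) (simp add: algebra_simps)
      moreover have "6 * (2 * m) \<le> 24 * (2 * K + 1) * (\<rho> + 1)"
        using mult_le_mono2[OF m, of 12] by (simp add: algebra_simps)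
      moreover have "c * (\<rho> + 1) = 3 * (\<rho> + 1) + (k + f) * ((12 * (2 * K + 1) + 18) * (\<rho> + 1)) + 128 * (\<rho> + 1) + 24 * (2 * K + 1) * (\<rho> + 1)"
        by (simp only: c_def distrib_right mult.assoc)
      moreover have "3 * \<rho> + x + 32 * (2 * (2 * \<rho>)) + y \<le> z"
        if "x \<le> x'" "y \<le> y'" "z = 3 * (\<rho> + 1) + x' + 128 * (\<rho> + 1) + y'" for x x' y y' z :: nat
        using that by simp
      ultimately show ?thesis by blast
    qed
    finally show ?thesis using fb by (meson fam_mono order_refl)
  qed
  obtain C where C: "\<And>r. twice (\<lambda>\<rho>. c * (\<rho> + 1)) K r \<le> C * (r + 1)" using twice_linear[of c K] by blast
  have "fam (wd ?N ?q s) K (words_over s) (k + f + 2) r (twice (\<lambda>\<rho>. c * (\<rho> + 1)) K r)" for r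
    by (rule fam_words) (use s34 K base in \<open>auto simp: Nz_nonneg Nz_nonpos\<close>)
  then show ?thesis using C fam_mono by (meson order_refl)
qed

subsection \<open>Recursively enumerable sets of relators\<close>

lemma rec_eval_deterministic: "rec_eval f xs y \<Longrightarrow> rec_eval f xs y' \<Longrightarrow> y = y'"
proof (induction arbitrary: y' rule: rec_eval.induct)
  case (comp ys hs xs g y)
  from comp.prems obtain ys' where ys': "length ys' = length hs"
    "\<forall>i<length hs. rec_eval (hs ! i) xs (ys' ! i)" "rec_eval g ys' y'"
    by (auto elim: rec_eval.cases)
  have "ys = ys'" using comp.IH(1) comp.hyps(1) ys' by (intro nth_equalityI) auto
  then show ?case using comp.IH(2) ys'(3) by blast
next
  case (precS f g n xs y z)
  from precS.prems obtain w where "rec_eval (Prec f g) (n # xs) w" "rec_eval g (n # w # xs) y'"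
    by (auto elim: rec_eval.cases)
  then show ?case using precS.IH by blast
next
  case (mn f n xs)
  from mn.prems have m: "rec_eval f (y' # xs) 0" "\<forall>j<y'. \<exists>y. rec_eval f (j # xs) (Suc y)"
    by (auto elim: rec_eval.cases)
  have "\<not> n < y'"
    using m(2) mn.IH by (metis nat.distinct(1))
  moreover have "\<not> y' < n"
    using m(1) mn.IH(2) by (metis nat.distinct(1))
  ultimately show ?case by simp
next
  case (prec0 f xs y g)
  from prec0.prems have "rec_eval f xs y'" by cases auto
  then show ?case by (rule prec0.IH)
qed (erule rec_eval.cases; simp)+

section \<open>Total computable functions and decidable predicates\<close>

definition cf :: "nat \<Rightarrow> (nat list \<Rightarrow> nat) \<Rightarrow> bool" where
  "cf n f \<longleftrightarrow> (\<exists>h. \<forall>xs. length xs = n \<longrightarrow> rec_eval h xs (f xs))"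

lemma cf_cong: "cf n f \<Longrightarrow> (\<And>xs. length xs = n \<Longrightarrow> f xs = g xs) \<Longrightarrow> cf n g"
  by (auto simp: cf_def)

lemma cf_zero: "cf n (\<lambda>_. 0)"
  unfolding cf_def by (blast intro: rec_eval.zero)

lemma cf_proj: "i < n \<Longrightarrow> cf n (\<lambda>xs. xs ! i)"
  unfolding cf_def by (intro exI[of _ "Proj i"]) (auto intro: rec_eval.proj)

lemma cf_comp:
  assumes g: "cf (length fs) g" and fs: "\<And>f. f \<in> set fs \<Longrightarrow> cf n f"
  shows "cf n (\<lambda>xs. g (map (\<lambda>f. f xs) fs))"
proof -
  obtain h where h: "\<And>xs. length xs = length fs \<Longrightarrow> rec_eval h xs (g xs)" using g by (auto simp: cf_def)
  define H where "H f = (SOME h. \<forall>xs. length xs = n \<longrightarrow> rec_eval h xs (f xs))" for f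
  have H: "rec_eval (H f) xs (f xs)" if "f \<in> set fs" "length xs = n" for f xs
  proof -
    have "\<forall>xs. length xs = n \<longrightarrow> rec_eval (H f) xs (f xs)"
      using fs[OF that(1)] unfolding cf_def H_def by (rule someI_ex)
    then show ?thesis using that(2) by blast
  qed
  have "rec_eval (Comp h (map H fs)) xs (g (map (\<lambda>f. f xs) fs))" if "length xs = n" for xs
    by (rule rec_eval.comp[of "map (\<lambda>f. f xs) fs"]) (use H h that in auto)
  then show ?thesis unfolding cf_def by blast
qed

lemma cf_suc: assumes "cf n f" shows "cf n (\<lambda>xs. Suc (f xs))"
proof -
  have "cf 1 (\<lambda>xs. Suc (xs ! 0))" unfolding cf_def
  proof (intro exI allI impI)
    fix xs :: "nat list" assume "length xs = 1"
    then obtain x where "xs = [x]" by (cases xs) auto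
    then show "rec_eval Sucf xs (Suc (xs ! 0))" by (auto intro: rec_eval.succ)
  qed
  then show ?thesis using cf_comp[of "[f]" "\<lambda>xs. Suc (xs ! 0)" n] assms by simp
qed

lemma cf_const: "cf n (\<lambda>_. c)"
  by (induction c) (auto intro: cf_zero cf_suc)

lemma cf_rec:
  assumes a: "cf n a" and b: "cf n b" and g: "cf (Suc (Suc n)) g"
  shows "cf n (\<lambda>xs. rec_nat (b xs) (\<lambda>k y. g (k # y # xs)) (a xs))"
proof -
  obtain hb where hb: "\<And>xs. length xs = n \<Longrightarrow> rec_eval hb xs (b xs)" using b by (auto simp: cf_def)
  obtain hg where hg: "\<And>xs. length xs = Suc (Suc n) \<Longrightarrow> rec_eval hg xs (g xs)" using g by (auto simp: cf_def)
  have rec: "rec_eval (Prec hb hg) (m # xs) (rec_nat (b xs) (\<lambda>k y. g (k # y # xs)) m)" if "length xs = n" for m xs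
  proof (induction m)
    case 0 then show ?case using hb[OF that] by (auto intro: rec_eval.prec0)
  next
    case (Suc m) then show ?case using hg[of "m # _ # xs"] that by (auto intro: rec_eval.precS)
  qed
  let ?G = "\<lambda>zs. rec_nat (b (tl zs)) (\<lambda>k y. g (k # y # tl zs)) (hd zs)"
  have "cf (Suc n) ?G" unfolding cf_def
  proof (intro exI allI impI)
    fix zs :: "nat list" assume "length zs = Suc n"
    then show "rec_eval (Prec hb hg) zs (?G zs)" using rec[of "tl zs" "hd zs"] by (cases zs) auto
  qed
  then have "cf n (\<lambda>xs. ?G (map (\<lambda>f. f xs) (a # map (\<lambda>i xs. xs ! i) [0..<n])))"
    by (intro cf_comp) (use a in \<open>auto intro: cf_proj\<close>)
  then show ?thesis
  proof (rule cf_cong)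
    fix xs :: "nat list" assume "length xs = n"
    then have e: "map ((!) xs) [0..<n] = xs" using map_nth[of xs] by simp
    show "?G (map (\<lambda>f. f xs) (a # map (\<lambda>i xs. xs ! i) [0..<n])) = rec_nat (b xs) (\<lambda>k y. g (k # y # xs)) (a xs)"
      by (simp add: o_def e)
  qed
qed

lemma cf_drop: assumes "cf n f" shows "cf (k + n) (\<lambda>zs. f (drop k zs))"
proof -
  have "cf (k + n) (\<lambda>zs. f (map (\<lambda>h. h zs) (map (\<lambda>i zs. zs ! i) [k..<k + n])))"
    by (rule cf_comp) (use assms in \<open>auto intro: cf_proj\<close>)
  then show ?thesis
  proof (rule cf_cong)
    fix zs :: "nat list" assume "length zs = k + n"
    then have "map (\<lambda>h. h zs) (map (\<lambda>i zs. zs ! i) [k..<k + n]) = drop k zs"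
      by (intro nth_equalityI) auto
    then show "f (map (\<lambda>h. h zs) (map (\<lambda>i zs. zs ! i) [k..<k + n])) = f (drop k zs)" by simp
  qed
qed

lemma cf_drop2: "cf n f \<Longrightarrow> cf (Suc (Suc n)) (\<lambda>zs. f (drop 2 zs))"
  using cf_drop[of n f 2] by simp

lemma cf_add: assumes "cf n a" "cf n b" shows "cf n (\<lambda>xs. a xs + b xs)"
proof -
  have "cf n (\<lambda>xs. rec_nat (b xs) (\<lambda>k y. Suc ((k # y # xs) ! 1)) (a xs))"
    by (intro cf_rec assms cf_suc cf_proj) simp
  moreover have "rec_nat v (\<lambda>k y. Suc y) u = u + v" for u v :: nat by (induction u) auto
  ultimately show ?thesis by simp
qed

lemma cf_mult: assumes "cf n a" "cf n b" shows "cf n (\<lambda>xs. a xs * b xs)"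
proof -
  have "cf n (\<lambda>xs. rec_nat 0 (\<lambda>k y. (k # y # xs) ! 1 + b (drop 2 (k # y # xs))) (a xs))"
    by (intro cf_rec[where g = "\<lambda>zs. zs ! 1 + b (drop 2 zs)"] assms cf_add cf_drop2 cf_proj cf_zero) simp
  moreover have "rec_nat 0 (\<lambda>k y. y + v) u = u * v" for u v :: nat by (induction u) auto
  ultimately show ?thesis by simp
qed

lemma cf_sub: assumes "cf n a" "cf n b" shows "cf n (\<lambda>xs. a xs - b xs)"
proof -
  have pred: "cf m (\<lambda>xs. f xs - 1)" if "cf m f" for f m
  proof -
    have "cf m (\<lambda>xs. rec_nat 0 (\<lambda>k y. (k # y # xs) ! 0) (f xs))"
      by (intro cf_rec that cf_proj cf_zero) simp
    moreover have "rec_nat 0 (\<lambda>k y. k) u = u - 1" for u :: nat by (cases u) auto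
    ultimately show ?thesis by simp
  qed
  have "cf n (\<lambda>xs. rec_nat (a xs) (\<lambda>k y. (k # y # xs) ! 1 - 1) (b xs))"
    by (intro cf_rec[where g = "\<lambda>zs. zs ! 1 - 1"] assms pred cf_proj) simp
  moreover have "rec_nat v (\<lambda>k y. y - 1) u = v - u" for u v :: nat by (induction u) auto
  ultimately show ?thesis by simp
qed

lemma cf_power2: assumes "cf n a" shows "cf n (\<lambda>xs. 2 ^ a xs)"
proof -
  have "cf n (\<lambda>xs. rec_nat 1 (\<lambda>k y. (k # y # xs) ! 1 + (k # y # xs) ! 1) (a xs))"
    by (intro cf_rec[where g = "\<lambda>zs. zs ! 1 + zs ! 1"] assms cf_add cf_proj cf_const) simp_all
  moreover have "rec_nat 1 (\<lambda>k y. y + y) u = (2::nat) ^ u" for u :: nat by (induction u) auto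
  ultimately show ?thesis by simp
qed

definition cpr :: "nat \<Rightarrow> (nat list \<Rightarrow> bool) \<Rightarrow> bool" where
  "cpr n P \<longleftrightarrow> cf n (\<lambda>xs. if P xs then 1 else 0)"

lemma cf_if: assumes "cpr n P" "cf n a" "cf n b" shows "cf n (\<lambda>xs. if P xs then a xs else b xs)"
proof -
  have "cf n (\<lambda>xs. (if P xs then 1 else 0) * a xs + (1 - (if P xs then 1 else 0)) * b xs)"
    using assms by (intro cf_add cf_mult cf_sub cf_const) (simp_all add: cpr_def)
  then show ?thesis by (rule cf_cong) simp
qed

lemma cpr_le: assumes "cf n a" "cf n b" shows "cpr n (\<lambda>xs. a xs \<le> b xs)"
proof -
  have "cf n (\<lambda>xs. 1 - (a xs - b xs))" using assms by (intro cf_sub cf_const)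
  then show ?thesis unfolding cpr_def by (rule cf_cong) auto
qed

lemma cpr_not: assumes "cpr n P" shows "cpr n (\<lambda>xs. \<not> P xs)"
  unfolding cpr_def using cf_if[OF assms cf_const[of n 0] cf_const[of n 1]] by (rule cf_cong) simp

lemma cpr_and: assumes "cpr n P" "cpr n Q" shows "cpr n (\<lambda>xs. P xs \<and> Q xs)"
  unfolding cpr_def using cf_if[OF assms(1) assms(2)[unfolded cpr_def] cf_const[of n 0]] by (rule cf_cong) simp

lemma cpr_less: assumes "cf n a" "cf n b" shows "cpr n (\<lambda>xs. a xs < b xs)"
  using cpr_not[OF cpr_le[OF assms(2,1)]] by (simp add: not_le)

lemma cpr_eq: assumes "cf n a" "cf n b" shows "cpr n (\<lambda>xs. a xs = b xs)"
  using cpr_and[OF cpr_le[OF assms] cpr_le[OF assms(2,1)]] by (simp add: eq_iff)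

lemma cpr_const: "cpr n (\<lambda>_. b)" unfolding cpr_def by (rule cf_const)

text \<open>The parameter \<open>k\<close> is fixed, so an infinite value merely makes the predicate
  constant. This keeps the orders computable for all extended parameters.\<close>

lemma cpr_le_enat: assumes "cf n a" shows "cpr n (\<lambda>xs. enat (a xs) \<le> k)"
proof (cases k)
  case (enat m) then show ?thesis using cpr_le[OF assms cf_const[of n m]] by simp
qed (simp add: cpr_const)

lemma cf_Least:
  assumes P: "cpr (Suc n) P" and ex: "\<And>xs. length xs = n \<Longrightarrow> \<exists>t. P (t # xs)"
  shows "cf n (\<lambda>xs. LEAST t. P (t # xs))"
proof -
  obtain h where h: "\<And>zs. length zs = Suc n \<Longrightarrow> rec_eval h zs (if \<not> P zs then 1 else 0)"
    using cpr_not[OF P] unfolding cpr_def cf_def by blast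
  have "rec_eval (Mn h) xs (LEAST t. P (t # xs))" if l: "length xs = n" for xs
  proof (rule rec_eval.mn)
    let ?t = "LEAST t. P (t # xs)"
    have "P (?t # xs)" using ex[OF l] by (rule LeastI_ex)
    then show "rec_eval h (?t # xs) 0" using h[of "?t # xs"] l by simp
    show "\<forall>j<?t. \<exists>y. rec_eval h (j # xs) (Suc y)"
    proof (intro allI impI)
      fix j assume "j < ?t"
      then have "\<not> P (j # xs)" by (rule not_less_Least)
      then show "\<exists>y. rec_eval h (j # xs) (Suc y)" using h[of "j # xs"] l by auto
    qed
  qed
  then show ?thesis unfolding cf_def by blast
qed

lemma cf_expo: assumes "cf n a" shows "cf n (\<lambda>xs. expo (a xs))"
proof -
  have "cf n (\<lambda>xs. LEAST e. a (drop 1 (e # xs)) \<le> 2 ^ ((e # xs) ! 0))"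
  proof (rule cf_Least[where P = "\<lambda>zs. a (drop 1 zs) \<le> 2 ^ (zs ! 0)"])
    show "cpr (Suc n) (\<lambda>zs. a (drop 1 zs) \<le> 2 ^ (zs ! 0))"
      using cf_drop[OF assms, of 1] by (intro cpr_le cf_power2 cf_proj) auto
    show "\<exists>t. a (drop 1 (t # xs)) \<le> 2 ^ ((t # xs) ! 0)" for xs
      by (intro exI[of _ "a xs"]) (simp add: less_imp_le)
  qed
  then show ?thesis by (simp add: expo_def)
qed

lemma cf_lg: assumes "cf n a" shows "cf n (\<lambda>xs. lg (a xs))"
proof -
  have "cf n (\<lambda>xs. LEAST e. a (drop 1 (e # xs)) < 2 ^ Suc ((e # xs) ! 0))"
  proof (rule cf_Least[where P = "\<lambda>zs. a (drop 1 zs) < 2 ^ Suc (zs ! 0)"])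
    show "cpr (Suc n) (\<lambda>zs. a (drop 1 zs) < 2 ^ Suc (zs ! 0))"
      using cf_drop[OF assms, of 1] by (intro cpr_less cf_power2 cf_suc cf_proj) auto
    show "\<exists>t. a (drop 1 (t # xs)) < 2 ^ Suc ((t # xs) ! 0)" for xs
      using lg_bounds(2)[of "a xs"] by (intro exI[of _ "lg (a xs)"]) simp
  qed
  then show ?thesis by (simp add: lg_def)
qed

lemma cf_bpos: "cf n a \<Longrightarrow> cf n (\<lambda>xs. bpos (a xs))"
  unfolding bpos_def by (intro cf_sub cf_power2 cf_lg cf_expo)

lemma cf_bexp: "cf n a \<Longrightarrow> cf n (\<lambda>xs. bexp (a xs))"
  unfolding bexp_def by (intro cf_sub cf_add cf_power2 cf_lg cf_expo)

lemma cpr_less_enat: assumes "cf n a" shows "cpr n (\<lambda>xs. enat (a xs) < k)"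
proof (cases k)
  case (enat m) then show ?thesis using cpr_less[OF assms cf_const[of n m]] by simp
qed (simp add: cpr_const)

lemma cpr_blk: assumes "cf n a" shows "cpr n (\<lambda>xs. blk k l (a xs))"
proof -
  have "cpr n (\<lambda>xs. k < enat (a xs))" unfolding not_le[symmetric] by (rule cpr_not[OF cpr_le_enat[OF assms]])
  moreover have "cpr n (\<lambda>xs. a xs = 2 ^ expo (a xs))" by (rule cpr_eq[OF assms cf_power2[OF cf_expo[OF assms]]])
  moreover have "cpr n (\<lambda>xs. bpos (a xs) < lg (expo (a xs)))"
    by (rule cpr_less[OF cf_bpos[OF assms] cf_lg[OF cf_expo[OF assms]]])
  moreover have "cpr n (\<lambda>xs. enat (bpos (a xs)) < l)" by (rule cpr_less_enat[OF cf_bpos[OF assms]])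
  ultimately show ?thesis unfolding blk_def by (intro cpr_and)
qed

lemma cf_Nn: assumes "cf n a" shows "cf n (\<lambda>xs. Nn k l (a xs))"
proof -
  have "cf n (\<lambda>xs. 2 ^ (2 * bexp (a xs)))" by (rule cf_power2[OF cf_mult[OF cf_const cf_bexp[OF assms]]])
  then show ?thesis unfolding Nn_def
    by (intro cf_if[OF cpr_eq[OF assms cf_const]] cf_if[OF cpr_le_enat[OF assms]] cf_if[OF cpr_blk[OF assms]] cf_const)
qed

lemma cf_qn: assumes "cf n a" shows "cf n (\<lambda>xs. qn k l b (a xs))"
proof -
  have b: "cpr n (\<lambda>xs. b \<le> enat (bpos (a xs)))"
  proof (cases b)
    case (enat m) then show ?thesis using cpr_le[OF cf_const[of n m] cf_bpos[OF assms]] by simp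
  next
    case infinity then show ?thesis using cpr_const[of n False] by simp
  qed
  show ?thesis unfolding qn_def
    by (rule cf_if[OF cpr_and[OF cpr_blk[OF assms] b] cf_power2[OF cf_bexp[OF assms]] cf_const])
qed

section \<open>Computable codes of pairs and words\<close>

lemma cf_prod_encode: assumes "cf n a" "cf n b" shows "cf n (\<lambda>xs. prod_encode (a xs, b xs))"
proof -
  have tri: "cf n (\<lambda>xs. triangle (f xs))" if "cf n f" for f
  proof -
    have "cf n (\<lambda>xs. rec_nat 0 (\<lambda>k y. (k # y # xs) ! 1 + Suc ((k # y # xs) ! 0)) (f xs))"
      by (intro cf_rec[where g = "\<lambda>zs. zs ! 1 + Suc (zs ! 0)"] that cf_add cf_suc cf_proj cf_zero) simp_all
    moreover have "rec_nat 0 (\<lambda>k y. y + Suc k) u = triangle u" for u by (induction u) auto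
    ultimately show ?thesis by simp
  qed
  show ?thesis unfolding prod_encode_def by (simp, intro cf_add tri assms)
qed

text \<open>Codes of lists are built from the right end, so putting a word in front of a computable
  rest is easy while concatenating two codes is not. Quantifying over the rest \<open>W\<close>
  makes the notion closed under \<open>wpre_append\<close>.\<close>

definition wpre :: "(nat \<Rightarrow> word) \<Rightarrow> bool" where
  "wpre u \<longleftrightarrow> (\<forall>W. cf 1 (\<lambda>xs. word_code (W (xs ! 0))) \<longrightarrow> cf 1 (\<lambda>xs. word_code (u (xs ! 0) @ W (xs ! 0))))"

lemma wpreD: "wpre u \<Longrightarrow> cf 1 (\<lambda>xs. word_code (W (xs ! 0))) \<Longrightarrow> cf 1 (\<lambda>xs. word_code (u (xs ! 0) @ W (xs ! 0)))"
  by (simp add: wpre_def)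

lemma wpre_append: assumes "wpre u" "wpre v" shows "wpre (\<lambda>t. u t @ v t)"
  unfolding wpre_def
proof (intro allI impI)
  fix W assume "cf 1 (\<lambda>xs. word_code (W (xs ! 0)))"
  from wpreD[OF assms(1), where W = "\<lambda>t. v t @ W t", OF wpreD[OF assms(2) this]]
  show "cf 1 (\<lambda>xs. word_code ((u (xs ! 0) @ v (xs ! 0)) @ W (xs ! 0)))" by simp
qed

definition letter_code :: "nat \<times> bool \<Rightarrow> nat" where
  "letter_code l = prod_encode (fst l, if snd l then 1 else 0)"

lemma word_code_Cons: "word_code (l # w) = Suc (prod_encode (letter_code l, word_code w))"
  by (cases l) (simp add: word_code_def letter_code_def)

lemma wpre_replicate:
  assumes "cf 1 (\<lambda>xs. a (xs ! 0))" shows "wpre (\<lambda>t. replicate (a t) l)"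
  unfolding wpre_def
proof (intro allI impI)
  fix W assume W: "cf 1 (\<lambda>xs. word_code (W (xs ! 0)))"
  have "cf 1 (\<lambda>xs. rec_nat (word_code (W (xs ! 0)))
      (\<lambda>k y. Suc (prod_encode (letter_code l, (k # y # xs) ! 1))) (a (xs ! 0)))"
    by (intro cf_rec[where g = "\<lambda>zs. Suc (prod_encode (letter_code l, zs ! 1))"] assms W cf_suc cf_prod_encode cf_const cf_proj) simp
  moreover have "rec_nat (word_code w) (\<lambda>k y. Suc (prod_encode (letter_code l, y))) m = word_code (replicate m l @ w)" for w m
    by (induction m) (auto simp: word_code_Cons)
  ultimately show "cf 1 (\<lambda>xs. word_code (replicate (a (xs ! 0)) l @ W (xs ! 0)))" by simp
qed

lemma wpre_const: "wpre (\<lambda>_. u)"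
proof (induction u)
  case Nil then show ?case by (simp add: wpre_def)
next
  case (Cons l u)
  have "wpre (\<lambda>_. replicate 1 l)" by (rule wpre_replicate) (rule cf_const)
  from wpre_append[OF this Cons] show ?case by simp
qed

lemma wpre_ipow:
  assumes "cf 1 (\<lambda>xs. a (xs ! 0))"
  shows "wpre (\<lambda>t. ipow i (int (a t)))" "wpre (\<lambda>t. ipow i (- int (a t)))"
proof -
  have 1: "ipow i (int m) = replicate m (i, False)" for m by (simp add: ipow_def)
  have 2: "ipow i (- int m) = replicate m (i, True)" for m by (simp add: ipow_def)
  show "wpre (\<lambda>t. ipow i (int (a t)))" unfolding 1 by (rule wpre_replicate[OF assms])
  show "wpre (\<lambda>t. ipow i (- int (a t)))" unfolding 2 by (rule wpre_replicate[OF assms])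
qed

text \<open>\<open>F\<close> multiplies the distances of \<open>x\<close> from the codes of all
  families at time \<open>t\<close>. It vanishes exactly when some family hits \<open>x\<close>, so
  searching for a zero in \<open>t\<close> halts precisely on the union.\<close>

lemma re_set_ranges:
  assumes "\<And>W. W \<in> set Ws \<Longrightarrow> wpre W"
  shows "re_set (word_code ` (\<Union>W\<in>set Ws. range W))"
proof -
  define F where "F Ws t x = prod_list (map (\<lambda>W. (word_code (W t) - x) + (x - word_code (W t))) Ws)" for Ws :: "(nat \<Rightarrow> word) list" and t x
  have "cf 2 (\<lambda>xs. F Ws (xs ! 0) (xs ! 1))" using assms
  proof (induction Ws)
    case Nil then show ?case by (simp add: F_def cf_const)
  next
    case (Cons W Ws)
    have "cf 1 (\<lambda>xs. word_code (W (xs ! 0) @ []))"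
      by (rule wpreD[where W = "\<lambda>_. []"]) (use Cons.prems[of W] cf_const in auto)
    then have "cf 2 (\<lambda>xs. word_code (W (map (\<lambda>f. f xs) [\<lambda>xs. xs ! 0] ! 0)))"
      by (intro cf_comp[where g = "\<lambda>xs. word_code (W (xs ! 0))"]) (auto intro: cf_proj)
    then have "cf 2 (\<lambda>xs. ((word_code (W (xs ! 0)) - xs ! 1) + (xs ! 1 - word_code (W (xs ! 0)))) * F Ws (xs ! 0) (xs ! 1))"
      using Cons by (intro cf_mult cf_add cf_sub cf_proj) auto
    then show ?case by (simp add: F_def)
  qed
  then obtain h where h: "\<And>xs. length xs = 2 \<Longrightarrow> rec_eval h xs (F Ws (xs ! 0) (xs ! 1))" by (auto simp: cf_def)
  have h': "rec_eval h [t, x] y \<longleftrightarrow> y = F Ws t x" for t x y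
    using h[of "[t, x]"] rec_eval_deterministic[of h "[t, x]"] by auto
  have F0: "F Ws t x = 0 \<longleftrightarrow> (\<exists>W\<in>set Ws. word_code (W t) = x)" for t x
    by (induction Ws) (auto simp: F_def intro: le_antisym)
  have "(\<exists>y. rec_eval (Mn h) [x] y) \<longleftrightarrow> x \<in> word_code ` (\<Union>W\<in>set Ws. range W)" for x
  proof
    assume "\<exists>y. rec_eval (Mn h) [x] y"
    then obtain t where "rec_eval h [t, x] 0" by (auto elim: rec_eval.cases)
    then show "x \<in> word_code ` (\<Union>W\<in>set Ws. range W)" using h'[of t x 0] F0[of t x] by force
  next
    assume "x \<in> word_code ` (\<Union>W\<in>set Ws. range W)"
    then have ex: "\<exists>t. F Ws t x = 0" using F0 by auto
    let ?t = "LEAST t. F Ws t x = 0"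
    have "rec_eval (Mn h) [x] ?t"
    proof (rule rec_eval.mn)
      show "rec_eval h [?t, x] 0" using h' LeastI_ex[OF ex] by simp
      show "\<forall>j<?t. \<exists>y. rec_eval h [j, x] (Suc y)"
      proof (intro allI impI)
        fix j assume "j < ?t"
        then have "F Ws j x \<noteq> 0" by (rule not_less_Least)
        then show "\<exists>y. rec_eval h [j, x] (Suc y)" using h' not0_implies_Suc by metis
      qed
    qed
    then show "\<exists>y. rec_eval (Mn h) [x] y" by (rule exI)
  qed
  then show ?thesis unfolding re_set_def by (intro exI[of _ "Mn h"]) auto
qed

text \<open>The relators form finitely many families indexed by an integer;
  \<open>\<epsilon>\<close> splits each one by sign into two families indexed by naturals.\<close>

lemma rels_re:
  "re_set (word_code ` rels s (Nz k a) (qz k a b))"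
proof -
  define \<epsilon> where "\<epsilon> \<sigma> t = (if \<sigma> then int t else - int t)" for \<sigma> and t :: nat
  define Ws where "Ws = [\<lambda>t. rel_central g (\<epsilon> \<sigma> t). g \<leftarrow> [0..<s], \<sigma> \<leftarrow> [True, False]]
    @ [\<lambda>t. Zw (\<epsilon> \<sigma> t) (Nz k a (\<epsilon> \<sigma> t)) 1. \<sigma> \<leftarrow> [True, False]]
    @ (if s = 4 then [\<lambda>t. rel_w (qz k a b) (\<epsilon> \<sigma> t). \<sigma> \<leftarrow> [True, False]] else [])"
  have id: "cf 1 (\<lambda>xs. xs ! 0)" by (rule cf_proj) simp
  have \<epsilon>: "wpre (\<lambda>t. ipow i (\<epsilon> \<sigma> t))" "wpre (\<lambda>t. ipow i (- \<epsilon> \<sigma> t))" for i \<sigma>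
    using wpre_ipow[where a = "\<lambda>t. t" and i = i, OF id] by (cases \<sigma>; simp add: \<epsilon>_def)+
  have Y: "wpre (\<lambda>t. Yp (\<epsilon> \<sigma> t) c)" for \<sigma> c
    unfolding Yp_def by (intro wpre_append \<epsilon> wpre_const)
  have N: "wpre (\<lambda>t. ipow i (Nz k a (\<epsilon> \<sigma> t)))" "wpre (\<lambda>t. ipow i (- Nz k a (\<epsilon> \<sigma> t)))"
    and q: "wpre (\<lambda>t. ipow i (qz k a b (\<epsilon> \<sigma> t)))" "wpre (\<lambda>t. ipow i (- qz k a b (\<epsilon> \<sigma> t)))" for i \<sigma>
  proof -
    have "cf 1 (\<lambda>xs. nat (\<epsilon> \<sigma> (xs ! 0)))" using id cf_const[of 1 0] by (cases \<sigma>) (simp_all add: \<epsilon>_def)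
    note 1 = cf_Nn[OF this, of k a] cf_qn[OF this, of k a b]
    show "wpre (\<lambda>t. ipow i (Nz k a (\<epsilon> \<sigma> t)))" "wpre (\<lambda>t. ipow i (- Nz k a (\<epsilon> \<sigma> t)))"
      "wpre (\<lambda>t. ipow i (qz k a b (\<epsilon> \<sigma> t)))" "wpre (\<lambda>t. ipow i (- qz k a b (\<epsilon> \<sigma> t)))"
      unfolding Nz_def qz_def using wpre_ipow[where a = "\<lambda>t. Nn k a (nat (\<epsilon> \<sigma> t))", OF 1(1)]
        wpre_ipow[where a = "\<lambda>t. qn k a b (nat (\<epsilon> \<sigma> t))", OF 1(2)] by simp_all
  qed
  have "wpre (\<lambda>t. rel_central g (\<epsilon> \<sigma> t))" for g \<sigma>
    unfolding rel_central_def Zw_def winv_simps winv_ipow winv_Yp by (intro wpre_append Y wpre_const)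
  moreover have "wpre (\<lambda>t. Zw (\<epsilon> \<sigma> t) (Nz k a (\<epsilon> \<sigma> t)) 1)" for \<sigma>
    unfolding Zw_def by (intro wpre_append Y N)
  moreover have "wpre (\<lambda>t. rel_w (qz k a b) (\<epsilon> \<sigma> t))" for \<sigma>
    unfolding rel_w_def by (intro wpre_append Y q wpre_const)
  ultimately have "re_set (word_code ` (\<Union>W\<in>set Ws. range W))"
    by (intro re_set_ranges) (auto simp: Ws_def split: if_splits)
  moreover have "(\<Union>W\<in>set Ws. range W) = rels s (Nz k a) (qz k a b)"
  proof -
    have \<epsilon>_all: "range (\<lambda>t. f (\<epsilon> True t)) \<union> range (\<lambda>t. f (\<epsilon> False t)) = range f" for f :: "int \<Rightarrow> word"
    proof -
      have "d = \<epsilon> True (nat d) \<or> d = \<epsilon> False (nat (- d))" for d by (auto simp: \<epsilon>_def)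
      then show ?thesis by (auto simp: image_iff) metis
    qed
    have "(\<Union>W\<in>set Ws. range W) = (\<Union>g\<in>{0..<s}. range (\<lambda>t. rel_central g (\<epsilon> True t)) \<union> range (\<lambda>t. rel_central g (\<epsilon> False t)))
      \<union> (range (\<lambda>t. Zw (\<epsilon> True t) (Nz k a (\<epsilon> True t)) 1) \<union> range (\<lambda>t. Zw (\<epsilon> False t) (Nz k a (\<epsilon> False t)) 1))
      \<union> (if s = 4 then range (\<lambda>t. rel_w (qz k a b) (\<epsilon> True t)) \<union> range (\<lambda>t. rel_w (qz k a b) (\<epsilon> False t)) else {})"
      by (auto simp: Ws_def)
    also have "\<dots> = (\<Union>g\<in>{0..<s}. range (rel_central g)) \<union> range (\<lambda>d. Zw d (Nz k a d) 1) \<union> (if s = 4 then range (rel_w (qz k a b)) else {})"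
      using \<epsilon>_all[of "rel_central _"] \<epsilon>_all[of "\<lambda>d. Zw d (Nz k a d) 1"] \<epsilon>_all[of "rel_w (qz k a b)"] by simp
    also have "\<dots> = rels s (Nz k a) (qz k a b)" by (auto simp: rels_def)
    finally show ?thesis .
  qed
  ultimately show ?thesis by simp
qed

lemma rels_words_over: "s = 3 \<or> s = 4 \<Longrightarrow> rels s N q \<subseteq> words_over s"
  by (auto simp: rels_def rel_central_def rel_w_def)

subsection \<open>Lower bounds\<close>

text \<open>Label a grid point by the first coordinate whose zero face is avoided by a chosen member of the
  cover containing the image of the point; a completely labelled simplex then meets \<open>n + 1\<close> members.\<close>
lemma grid_lower_bound:
  fixes dd :: "'a \<Rightarrow> 'a \<Rightarrow> real" and g :: "(nat \<Rightarrow> nat) \<Rightarrow> 'a"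
  assumes p: "0 < p"
    and gM: "\<And>u. g u \<in> M"
    and near: "\<And>u v. (\<And>j. j < n \<Longrightarrow> u j \<le> v j \<and> v j \<le> Suc (u j)) \<Longrightarrow> dd (g u) (g v) \<le> r"
    and far: "\<And>u v j. j < n \<Longrightarrow> u j = 0 \<Longrightarrow> v j = p \<Longrightarrow> D < dd (g u) (g v)"
    and cov: "\<Union>\<U> = M" "\<And>U x y. U \<in> \<U> \<Longrightarrow> x \<in> U \<Longrightarrow> y \<in> U \<Longrightarrow> dd x y \<le> D"
    and mult: "meets_at_most M dd \<U> r m"
  shows "n \<le> m"
proof -
  define T where "T x = (SOME U. U \<in> \<U> \<and> g x \<in> U)" for x
  have T: "T x \<in> \<U>" "g x \<in> T x" for x
  proof -
    have "\<exists>U. U \<in> \<U> \<and> g x \<in> U" using gM[of x] cov(1) by blast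
    then have "T x \<in> \<U> \<and> g x \<in> T x" unfolding T_def by (rule someI_ex)
    then show "T x \<in> \<U>" "g x \<in> T x" by auto
  qed
  \<comment> \<open>The label depends on the cover member only, so different reduced labels force
    different members. By \<open>far\<close> no member touches two opposite faces, which gives the
    boundary condition at \<open>p\<close>.\<close>
  define L where "L U j = (if \<exists>z. z j = 0 \<and> g z \<in> U then 0 else 1::nat)" for U j
  have "odd (card {S. ksimplex p n S \<and> (Brouwer_Fixpoint.reduced n \<circ> (\<lambda>x. L (T x))) ` S = {..n}})"
  proof (rule kuhn_combinatorial[OF p])
    show "\<forall>x j. (\<forall>j. x j \<le> p) \<and> j < n \<and> x j = 0 \<longrightarrow> L (T x) j = 0"
    proof (intro allI impI, elim conjE)
      fix x :: "nat \<Rightarrow> nat" and j assume "x j = 0"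
      then show "L (T x) j = 0" using T(2)[of x] by (auto simp: L_def)
    qed
    show "\<forall>x j. (\<forall>j. x j \<le> p) \<and> j < n \<and> x j = p \<longrightarrow> L (T x) j = 1"
    proof (intro allI impI, elim conjE)
      fix x :: "nat \<Rightarrow> nat" and j assume j: "j < n" "x j = p"
      have "\<not> (z j = 0 \<and> g z \<in> T x)" for z
        using far[OF j(1), of z x] j(2) cov(2)[OF T(1)[of x], of "g z" "g x"] T(2)[of x] by fastforce
      then show "L (T x) j = 1" by (simp add: L_def)
    qed
  qed
  then have "{S. ksimplex p n S \<and> (Brouwer_Fixpoint.reduced n \<circ> (\<lambda>x. L (T x))) ` S = {..n}} \<noteq> {}"
    by (metis card.empty even_zero)
  then obtain S where S: "ksimplex p n S" "(Brouwer_Fixpoint.reduced n \<circ> (\<lambda>x. L (T x))) ` S = {..n}" by blast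
  from S(1) obtain b upd where k: "kuhn_simplex p n b upd S" by (auto elim: ksimplex.cases)
  \<comment> \<open>A simplex lies in a unit cube with lowest corner \<open>b\<close>; therefore one
    ball around \<open>g b\<close> meets all members chosen at its vertices.\<close>
  have box: "b j \<le> v j \<and> v j \<le> Suc (b j)" if "v \<in> S" for v j
    using that kuhn_simplex.s_pre[OF k] by auto
  let ?B = "cball_in M dd (g b) r"
  have "{..n} \<subseteq> (\<lambda>U. Brouwer_Fixpoint.reduced n (L U)) ` {U \<in> \<U>. U \<inter> ?B \<noteq> {}}"
  proof -
    have "T v \<in> {U \<in> \<U>. U \<inter> ?B \<noteq> {}}" if "v \<in> S" for v
    proof -
      have "g v \<in> ?B" using near[of b v] box[OF that] gM by (simp add: cball_in_def)
      then show ?thesis using T[of v] by blast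
    qed
    then show ?thesis unfolding S(2)[symmetric] by auto
  qed
  moreover have fin: "finite {U \<in> \<U>. U \<inter> ?B \<noteq> {}}" "card {U \<in> \<U>. U \<inter> ?B \<noteq> {}} \<le> m + 1"
    using mult gM by (auto simp: meets_at_most_def)
  ultimately have "card {..n} \<le> card {U \<in> \<U>. U \<inter> ?B \<noteq> {}}" by (intro surj_card_le)
  then show ?thesis using fin(2) by simp
qed

section \<open>Grids along \<open>y\<close>, \<open>y'\<close> and the central directions\<close>

definition ecount :: "nat \<Rightarrow> word \<Rightarrow> int" where
  "ecount i w = (\<Sum>l\<leftarrow>w. if fst l = i then sg (snd l) else 0)"

lemma ecount_append [simp]: "ecount i (u @ v) = ecount i u + ecount i v"
  by (simp add: ecount_def)

lemma ecount_free: "pres_eq {} u v \<Longrightarrow> ecount i u = ecount i v"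
proof (induction rule: pres_eq.induct)
  case (cancel u x v) then show ?case by (cases x) (simp add: ecount_def)
qed auto

lemma ecount_p2: "ecount 2 (p2 w) = ecount 2 w"
  by (induction w) (auto simp: ecount_def)

lemma abs_ecount_le: "\<bar>ecount i w\<bar> \<le> int (length w)"
  by (induction w) (auto simp: ecount_def sg_def)

lemma ecount_ipow [simp]: "ecount i (ipow j n) = (if i = j then n else 0)"
  by (auto simp: ecount_def ipow_def sg_def sum_list_replicate)

context
  fixes s :: nat and N q :: "int \<Rightarrow> int" and n \<rho> :: nat and d :: "nat \<Rightarrow> nat"
  assumes s: "s = 3 \<or> s = 4" and N0: "N 0 = 1" and inj: "inj_on d {2..<n}" and d1: "\<And>j. j \<in> {2..<n} \<Longrightarrow> 1 \<le> d j"
begin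

definition zgrid :: "nat list \<Rightarrow> (nat \<Rightarrow> int) \<Rightarrow> word" where
  "zgrid js u = concat (map (\<lambda>j. Zw (int (d j)) (int \<rho>) (int \<rho> * u j)) js)"

text \<open>The generators \<open>y\<close> and \<open>y'\<close> commute because
  \<open>N 0 = 1\<close> makes \<open>z 0\<close> trivial, so the grid is the image of a lattice. A
  unit step moves a central direction by the square of \<open>\<rho>\<close>, yet costs only a
  multiple of \<open>\<rho> + d j\<close>.\<close>

definition grid :: "(nat \<Rightarrow> int) \<Rightarrow> word" where
  "grid u = zgrid [2..<n] u @ ipow 1 (int \<rho> * u 0) @ ipow 2 (int \<rho> * u 1)"

lemma zgrid_words: "zgrid js u \<in> words_over s"
proof (induction js)
  case Nil then show ?case by (simp add: zgrid_def)
next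
  case (Cons j js)
  have "2 < s" using s by auto
  then show ?case using Cons by (simp add: zgrid_def)
qed

lemma grid_words: "grid u \<in> words_over s"
proof -
  have "2 < s" using s by auto
  then show ?thesis using zgrid_words by (simp add: grid_def)
qed

lemma zgrid_act:
  "red (p1 (zgrid js u @ v)) = red (p1 v)" "red (p2 (zgrid js u @ v)) = red (p2 v)"
  "cnt (zgrid js u @ v) = cnt v" "ecount 2 (zgrid js u) = 0" "ht (zgrid js u) = 0"
  "cent q (zgrid js u @ v) e = cent q v e + (\<Sum>j\<leftarrow>js. if e = int (d j) then (int \<rho>)\<^sup>2 * u j else 0)"
proof (induction js)
  case (Cons j js)
  have z: "zgrid (j # js) u = Zw (int (d j)) (int \<rho>) (int \<rho> * u j) @ zgrid js u" by (simp add: zgrid_def)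
  have "ecount 2 (Zw a b c) = 0" for a b c by (simp add: Zw_def Yp_def)
  moreover have "red (p1 (Zw a b c @ w)) = red (p1 w)" "red (p2 (Zw a b c @ w)) = red (p2 w)" for a b c w by simp_all
  ultimately show "red (p1 (zgrid (j # js) u @ v)) = red (p1 v)" "red (p2 (zgrid (j # js) u @ v)) = red (p2 v)"
     "cnt (zgrid (j # js) u @ v) = cnt v" "ecount 2 (zgrid (j # js) u) = 0" "ht (zgrid (j # js) u) = 0"
     "cent q (zgrid (j # js) u @ v) e = cent q v e + (\<Sum>j\<leftarrow>j # js. if e = int (d j) then (int \<rho>)\<^sup>2 * u j else 0)"
    using Cons unfolding z append_assoc by (simp_all del: p1_simps p2_simps add: power2_eq_square)
qed (simp_all add: zgrid_def ecount_def)

lemma cnt_grid: "cnt (grid u @ v) e = cnt v e + (if e = 0 then int \<rho> * u 0 else 0)"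
proof -
  show ?thesis unfolding grid_def append_assoc zgrid_act(3) by simp
qed

lemma cent_grid:
  assumes "e \<noteq> 0"
  shows "cent q (grid u @ v) e = cent q v e + int \<rho> * u 1 * cnt v e + (\<Sum>j\<leftarrow>[2..<n]. if e = int (d j) then (int \<rho>)\<^sup>2 * u j else 0)"
proof -
  show ?thesis using assms unfolding grid_def append_assoc zgrid_act(6) by simp
qed

lemma grid_translate:
  "st N q (grid u @ grid t) = st N q (grid (\<lambda>j. u j + t j))"
proof -
  have c: "cnt (grid u @ grid t) = cnt (grid (\<lambda>j. u j + t j))"
  proof
    fix e show "cnt (grid u @ grid t) e = cnt (grid (\<lambda>j. u j + t j)) e"
      using cnt_grid[of u "grid t" e] cnt_grid[of t "[]" e] cnt_grid[of "\<lambda>j. u j + t j" "[]" e]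
      by (simp add: algebra_simps)
  qed
  \<comment> \<open>The cross terms between \<open>y'\<close> and \<open>y\<close> all sit in
    coordinate 0, which is trivial.\<close>
  have "cent q (grid u @ grid t) e mod N e = cent q (grid (\<lambda>j. u j + t j)) e mod N e" for e
  proof (cases "e = 0")
    case False
    have "cent q (grid u @ grid t) e = cent q (grid (\<lambda>j. u j + t j)) e"
      using cent_grid[OF False, of u "grid t"] cent_grid[OF False, of t "[]"] cent_grid[OF False, of "\<lambda>j. u j + t j" "[]"]
        cnt_grid[of t "[]" e] False sum_list_addf[of "\<lambda>j. if e = int (d j) then (int \<rho>)\<^sup>2 * u j else 0" "\<lambda>j. if e = int (d j) then (int \<rho>)\<^sup>2 * t j else 0" "[2..<n]", symmetric]
      by (auto simp: algebra_simps intro!: arg_cong[of _ _ sum_list])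
    then show ?thesis by simp
  qed (simp add: N0)
  moreover have "red (p1 (grid u @ grid t)) = red (p1 (grid (\<lambda>j. u j + t j)))"
  proof -
    let ?a = "ipow 1 (int \<rho> * u 0)" and ?b = "ipow 1 (int \<rho> * t 0)"
    have "red (p1 (grid u @ grid t)) = red (?a @ p1 (grid t))"
      unfolding grid_def[of u] append_assoc zgrid_act(1) by simp
    also have "\<dots> = red (?a @ ?b)"
      unfolding red_append grid_def[of t] zgrid_act(1) by simp
    also have "\<dots> = red (ipow 1 (int \<rho> * (u 0 + t 0)))"
      using ipow_add[of "{}" 1 "int \<rho> * u 0" "int \<rho> * t 0"] by (simp add: red_eq_iff algebra_simps)
    also have "\<dots> = red (p1 (grid (\<lambda>j. u j + t j)))"
      unfolding grid_def[of "\<lambda>j. u j + t j"] zgrid_act(1) by simp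
    finally show ?thesis .
  qed
  moreover have "red (p2 (grid u @ grid t)) = red (p2 (grid (\<lambda>j. u j + t j)))"
  proof -
    let ?a = "ipow 2 (int \<rho> * u 1)" and ?b = "ipow 2 (int \<rho> * t 1)"
    have "red (p2 (grid u @ grid t)) = red (?a @ p2 (grid t))"
      unfolding grid_def[of u] append_assoc zgrid_act(2) by simp
    also have "\<dots> = red (?a @ ?b)"
      unfolding red_append grid_def[of t] zgrid_act(2) by simp
    also have "\<dots> = red (ipow 2 (int \<rho> * (u 1 + t 1)))"
      using ipow_add[of "{}" 2 "int \<rho> * u 1" "int \<rho> * t 1"] by (simp add: red_eq_iff algebra_simps)
    also have "\<dots> = red (p2 (grid (\<lambda>j. u j + t j)))"
      unfolding grid_def[of "\<lambda>j. u j + t j"] zgrid_act(2) by simp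
    finally show ?thesis .
  qed
  ultimately show ?thesis using c by (simp add: st_def del: p1_simps p2_simps)
qed

lemma length_zgrid:
  assumes "\<And>j. j \<in> set js \<Longrightarrow> u j \<in> {0, 1}" "\<And>j. j \<in> set js \<Longrightarrow> d j \<le> dm"
  shows "length (zgrid js u) \<le> length js * (4 * \<rho> + 4 * dm)"
  using assms
proof (induction js)
  case (Cons j js)
  have "length (Zw (int (d j)) (int \<rho>) (int \<rho> * u j)) \<le> 4 * \<rho> + 4 * dm"
    using Cons.prems(1)[of j] Cons.prems(2)[of j] by (auto simp: Zw_def Yp_def)
  moreover have "length (zgrid js u) \<le> length js * (4 * \<rho> + 4 * dm)" using Cons by simp
  ultimately show ?case by (simp add: zgrid_def)
qed (simp add: zgrid_def)

lemma grid_near: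
  assumes "\<And>j. j < n \<Longrightarrow> u j \<le> v j \<and> v j \<le> u j + 1" and n2: "2 \<le> n" and dm: "\<And>j. j \<in> {2..<n} \<Longrightarrow> d j \<le> dm"
  shows "nrm N q s (winv (grid u) @ grid v) \<le> n * (4 * \<rho> + 4 * dm) + 2 * \<rho>"
proof -
  let ?t = "\<lambda>j. v j - u j"
  have t01: "?t j \<in> {0, 1}" if "j < n" for j using assms(1)[OF that] by auto
  have "st N q (grid u @ grid ?t) = st N q (grid v)" using grid_translate[of u ?t] by simp
  then have "st N q (winv (grid u) @ grid u @ grid ?t) = st N q (winv (grid u) @ grid v)" by (rule st_append_cong)
  moreover have "st N q (winv (grid u) @ grid u @ grid ?t) = st N q (grid ?t)"
    using st_free[OF pres_eq_right[OF pres_eq_cancel_left[of _ "grid u"], where b = "grid ?t"]] by simp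
  ultimately have "nrm N q s (winv (grid u) @ grid v) \<le> length (grid ?t)"
    by (intro nrm_le grid_words) simp
  also have "\<dots> = length (zgrid [2..<n] ?t) + nat \<bar>int \<rho> * ?t 0\<bar> + nat \<bar>int \<rho> * ?t 1\<bar>"
    by (simp add: grid_def)
  also have "\<dots> \<le> (n - 2) * (4 * \<rho> + 4 * dm) + \<rho> + \<rho>"
  proof (intro add_mono)
    show "length (zgrid [2..<n] ?t) \<le> (n - 2) * (4 * \<rho> + 4 * dm)"
      using length_zgrid[of "[2..<n]" ?t dm] t01 dm by force
    show "nat \<bar>int \<rho> * ?t 0\<bar> \<le> \<rho>" "nat \<bar>int \<rho> * ?t 1\<bar> \<le> \<rho>" using t01[of 0] t01[of 1] n2 by auto
  qed
  also have "\<dots> \<le> n * (4 * \<rho> + 4 * dm) + 2 * \<rho>" by simp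
  finally show ?thesis .
qed

text \<open>In the directions \<open>y\<close> and \<open>y'\<close> the shift shows in counts that
  are linear in the length, in a central direction in \<open>cent\<close>, which is quadratic. An
  order of at least twice the shift prevents any representative of the class from being smaller than
  the shift.\<close>

lemma grid_far:
  assumes j: "j < n" "v j = u j + int p" and p: "1 \<le> p"
    and qd: "\<And>j. j \<in> {2..<n} \<Longrightarrow> q (int (d j)) = 0"
    and Nd: "\<And>j. j \<in> {2..<n} \<Longrightarrow> N (int (d j)) = 0 \<or> 2 * (int \<rho>)\<^sup>2 * int p \<le> N (int (d j))"
  shows "\<rho>\<^sup>2 * p \<le> (nrm N q s (winv (grid u) @ grid v))\<^sup>2"
proof -
  obtain t where t: "t \<in> words_over s" "length t = nrm N q s (winv (grid u) @ grid v)" "st N q t = st N q (winv (grid u) @ grid v)"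
    using nrm_attained[of "winv (grid u) @ grid v" s N q] grid_words by auto
  have "st N q (grid u @ t) = st N q (grid u @ winv (grid u) @ grid v)" by (rule st_append_cong[OF t(3)])
  also have "\<dots> = st N q (grid v)"
    using st_free[OF pres_eq_right[OF pres_eq_cancel_right[of _ "grid u"], where b = "grid v"]] by simp
  finally have st: "st N q (grid u @ t) = st N q (grid v)" .
  have lin: "\<rho>\<^sup>2 * p \<le> (length t)\<^sup>2" if "int \<rho> * int p \<le> int (length t)"
  proof -
    have "\<rho> * p \<le> length t" using that by (simp only: of_nat_mult[symmetric] of_nat_le_iff)
    then have "(\<rho> * p)\<^sup>2 \<le> (length t)\<^sup>2" by (rule power_mono) simp
    moreover have "\<rho>\<^sup>2 * p \<le> (\<rho> * p)\<^sup>2" using p by (simp add: power2_eq_square)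
    ultimately show ?thesis by linarith
  qed
  have cnt: "cnt t e = (if e = 0 then int \<rho> * (v 0 - u 0) else 0)" for e
  proof -
    have "cnt (grid u @ t) e = cnt (grid v) e" using st by (simp add: st_def)
    then show ?thesis using cnt_grid[of u t e] cnt_grid[of v "[]" e] by (simp add: algebra_simps split: if_splits)
  qed
  consider "j = 0" | "j = 1" | "2 \<le> j" by linarith
  then have "\<rho>\<^sup>2 * p \<le> (length t)\<^sup>2"
  proof cases
    case 1
    then have "cnt t 0 = int \<rho> * int p" using cnt[of 0] j by simp
    then show ?thesis using abs_cnt_le[of t 0] by (intro lin) simp
  next
    case 2
    have "pres_eq {} (p2 (grid u @ t)) (p2 (grid v))" using st by (simp add: st_def red_eq_iff)
    then have "ecount 2 (p2 (grid u @ t)) = ecount 2 (p2 (grid v))" by (rule ecount_free)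
    then have "ecount 2 t = int \<rho> * int p" using 2 j unfolding ecount_p2 by (simp add: grid_def zgrid_act algebra_simps)
    then show ?thesis using abs_ecount_le[of 2 t] by (intro lin) simp
  next
    case 3
    define e where "e = int (d j)"
    have jn: "j \<in> {2..<n}" using 3 j by simp
    have e0: "e \<noteq> 0" using d1[OF jn] by (simp add: e_def)
    have pick: "(\<Sum>i\<leftarrow>[2..<n]. if e = int (d i) then (int \<rho>)\<^sup>2 * u i else 0) = (int \<rho>)\<^sup>2 * u j" for u
    proof -
      have "(\<Sum>i\<leftarrow>[2..<n]. if e = int (d i) then (int \<rho>)\<^sup>2 * u i else 0) = (\<Sum>i\<in>{2..<n}. if e = int (d i) then (int \<rho>)\<^sup>2 * u i else 0)"
        by (simp add: sum_list_distinct_conv_sum_set)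
      also have "\<dots> = (\<Sum>i\<in>{2..<n}. if i = j then (int \<rho>)\<^sup>2 * u i else 0)"
        using inj jn by (intro sum.cong) (auto simp: e_def dest: inj_onD)
      also have "\<dots> = (int \<rho>)\<^sup>2 * u j" using jn by simp
      finally show ?thesis .
    qed
    have "cent q (grid u @ t) e mod N e = cent q (grid v) e mod N e"
      using st by (auto simp: st_def dest: fun_cong[where x = e])
    then have "(cent q t e + (int \<rho>)\<^sup>2 * u j) mod N e = ((int \<rho>)\<^sup>2 * v j) mod N e"
      using cent_grid[OF e0, of u t] cent_grid[OF e0, of v "[]"] cnt[of e] e0 by (simp add: pick)
    then have "N e dvd (cent q t e + (int \<rho>)\<^sup>2 * u j) - (int \<rho>)\<^sup>2 * v j" by (simp add: mod_eq_dvd_iff)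
    then have "N e dvd cent q t e - (int \<rho>)\<^sup>2 * int p" using j by (simp add: algebra_simps)
    then obtain k where k: "cent q t e = (int \<rho>)\<^sup>2 * int p + N e * k" by (auto simp: dvd_def algebra_simps)
    have Ne: "N e = 0 \<or> 2 * ((int \<rho>)\<^sup>2 * int p) \<le> N e" using Nd[OF jn] by (simp add: e_def mult.assoc)
    have nn: "0 \<le> (int \<rho>)\<^sup>2 * int p" by simp
    define B where "B = (int \<rho>)\<^sup>2 * int p"
    have B: "0 \<le> B" "N e = 0 \<or> 2 * B \<le> N e" "cent q t e = B + N e * k" using nn Ne k by (simp_all add: B_def)
    then have N_ge: "0 \<le> N e" by linarith
    have "B \<le> \<bar>cent q t e\<bar>"
    proof (cases "N e = 0 \<or> 0 \<le> k")
      case True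
      then have "0 \<le> N e * k" using N_ge by (elim disjE) simp_all
      then show ?thesis using B by linarith
    next
      case False
      then have "N e * k \<le> N e * (-1)" using N_ge by (intro mult_left_mono) linarith+
      then show ?thesis using B False by linarith
    qed
    also have "\<dots> \<le> (int (length t))\<^sup>2" using abs_cent_le[of q e t] qd[OF jn] by (simp add: e_def)
    finally have "int (\<rho>\<^sup>2 * p) \<le> int ((length t)\<^sup>2)" by (simp add: B_def)
    then show ?thesis by (simp only: of_nat_le_iff)
  qed
  then show ?thesis using t(2) by simp
qed

end

subsection \<open>Groups with the given word invariants\<close>

lemma Inf_enat_eqI:
  assumes "\<And>k'. k = enat k' \<Longrightarrow> P k'" "\<And>m. P m \<Longrightarrow> k \<le> enat m"
  shows "(INF n \<in> {n. P n}. enat n) = k"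
proof (rule antisym)
  show "(INF n \<in> {n. P n}. enat n) \<le> k"
  proof (cases k)
    case (enat k') then show ?thesis using assms(1) by (intro INF_lower2[of k']) auto
  qed simp
  show "k \<le> (INF n \<in> {n. P n}. enat n)" using assms(2) by (intro INF_greatest) simp
qed

text \<open>Dimensions are computed from the invariant alone, so that one argument serves the
  presented group and its subgroup with the restricted carrier.\<close>

locale word_group =
  fixes \<Gamma> :: "('g, 'z) monoid_scheme" and \<phi> :: "word \<Rightarrow> 'g" and s :: nat and N q :: "int \<Rightarrow> int"
  assumes group: "group \<Gamma>" and carrier: "carrier \<Gamma> = \<phi> ` words_over s"
    and mult: "\<And>u v. u \<in> words_over s \<Longrightarrow> v \<in> words_over s \<Longrightarrow> \<phi> (u @ v) = \<phi> u \<otimes>\<^bsub>\<Gamma>\<^esub> \<phi> v"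
    and eq: "\<And>u v. u \<in> words_over s \<Longrightarrow> v \<in> words_over s \<Longrightarrow> \<phi> u = \<phi> v \<longleftrightarrow> st N q u = st N q v"
    and s: "s = 3 \<or> s = 4" and N_nonneg: "\<And>d. 0 \<le> N d"
begin

interpretation group \<Gamma> by (rule group)

lemma \<phi>_in [simp]: "u \<in> words_over s \<Longrightarrow> \<phi> u \<in> carrier \<Gamma>"
  by (simp add: carrier)

lemma \<phi>_Nil: "\<phi> [] = \<one>\<^bsub>\<Gamma>\<^esub>"
  using mult[of "[]" "[]"] l_cancel_one[of "\<phi> []" "\<phi> []"] by simp

lemma \<phi>_winv: assumes "u \<in> words_over s" shows "\<phi> (winv u) = inv\<^bsub>\<Gamma>\<^esub> (\<phi> u)"
proof -
  have "\<phi> (winv u @ u) = \<phi> []" using eq[of "winv u @ u" "[]"] st_free[OF pres_eq_cancel_left] assms by simp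
  then have "\<phi> (winv u) \<otimes>\<^bsub>\<Gamma>\<^esub> \<phi> u = \<one>\<^bsub>\<Gamma>\<^esub>" using mult[of "winv u" u] assms \<phi>_Nil by simp
  then show ?thesis using assms by (intro inv_equality[symmetric]) auto
qed

lemma fin_generated: "fin_generated \<Gamma>"
  unfolding fin_generated_def
proof (intro exI conjI)
  let ?S = "(\<lambda>i. \<phi> [(i, False)]) ` {..<s}"
  show S: "finite ?S" "?S \<subseteq> carrier \<Gamma>" by auto
  show "generate \<Gamma> ?S = carrier \<Gamma>"
  proof
    show "generate \<Gamma> ?S \<subseteq> carrier \<Gamma>" by (rule generate_incl[OF S(2)])
    have "\<phi> w \<in> generate \<Gamma> ?S" if "w \<in> words_over s" for w using that
    proof (induction w)
      case Nil then show ?case by (simp add: \<phi>_Nil generate.one)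
    next
      case (Cons l w)
      obtain i b where l: "l = (i, b)" by (cases l)
      have i: "i < s" using Cons.prems l by simp
      have "\<phi> [(i, b)] \<in> generate \<Gamma> ?S"
      proof (cases b)
        case True
        have "\<phi> [(i, True)] = inv\<^bsub>\<Gamma>\<^esub> \<phi> [(i, False)]" using \<phi>_winv[of "[(i, False)]"] i by simp
        then show ?thesis using True i by (auto intro: generate.inv)
      next
        case False then show ?thesis using i by (auto intro: generate.incl)
      qed
      then show ?case using Cons mult[of "[l]" w] l by (auto intro: generate.eng)
    qed
    then show "carrier \<Gamma> \<subseteq> generate \<Gamma> ?S" by (auto simp: carrier)
  qed
qed

context
  fixes S assumes S: "finite S" "S \<subseteq> carrier \<Gamma>" "generate \<Gamma> S = carrier \<Gamma>"
begin

private definition gens where "gens = S \<union> m_inv \<Gamma> ` S"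
private abbreviation "pr ws \<equiv> foldr (\<otimes>\<^bsub>\<Gamma>\<^esub>) ws \<one>\<^bsub>\<Gamma>\<^esub>"

private lemma gens: "finite gens" "gens \<subseteq> carrier \<Gamma>"
  using S by (auto simp: gens_def)

private lemma pr_in: "set ws \<subseteq> gens \<Longrightarrow> pr ws \<in> carrier \<Gamma>"
  using gens(2) by (induction ws) auto

private lemma pr_append: "set ws \<subseteq> gens \<Longrightarrow> set vs \<subseteq> gens \<Longrightarrow> pr (ws @ vs) = pr ws \<otimes>\<^bsub>\<Gamma>\<^esub> pr vs"
proof (induction ws)
  case Nil then show ?case using pr_in by simp
next
  case (Cons g ws)
  then have "g \<in> carrier \<Gamma>" "pr ws \<in> carrier \<Gamma>" "pr vs \<in> carrier \<Gamma>" using gens(2) pr_in by auto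
  then show ?case using Cons by (simp add: m_assoc)
qed

private lemma pr_exists: assumes "g \<in> carrier \<Gamma>" shows "\<exists>ws. set ws \<subseteq> gens \<and> pr ws = g"
proof -
  have "g \<in> generate \<Gamma> S" using assms S by simp
  then show ?thesis
  proof (induction rule: generate.induct)
    case one then show ?case by (intro exI[of _ "[]"]) simp
  next
    case (incl h) then show ?case using S by (intro exI[of _ "[h]"]) (auto simp: gens_def)
  next
    case (inv h) then show ?case using S by (intro exI[of _ "[inv\<^bsub>\<Gamma>\<^esub> h]"]) (auto simp: gens_def)
  next
    case (eng h1 h2)
    then obtain ws vs where "set ws \<subseteq> gens" "pr ws = h1" "set vs \<subseteq> gens" "pr vs = h2" by blast
    then show ?case using pr_append[of ws vs] by (intro exI[of _ "ws @ vs"]) simp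
  qed
qed

private lemma word_length_le: "set ws \<subseteq> gens \<Longrightarrow> word_length \<Gamma> S (pr ws) \<le> length ws"
  unfolding word_length_def gens_def[symmetric] by (rule Least_le) blast

private lemma word_length_attained:
  assumes "g \<in> carrier \<Gamma>" obtains ws where "set ws \<subseteq> gens" "pr ws = g" "length ws = word_length \<Gamma> S g"
proof -
  obtain ws where "set ws \<subseteq> gens" "pr ws = g" using pr_exists[OF assms] by blast
  then have "\<exists>n ws. length ws = n \<and> set ws \<subseteq> gens \<and> pr ws = g" by blast
  from LeastI_ex[OF this] show ?thesis using that unfolding word_length_def gens_def[symmetric] by blast
qed

private lemma word_length_mult:
  assumes "g \<in> carrier \<Gamma>" "h \<in> carrier \<Gamma>"
  shows "word_length \<Gamma> S (g \<otimes>\<^bsub>\<Gamma>\<^esub> h) \<le> word_length \<Gamma> S g + word_length \<Gamma> S h"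
proof -
  obtain ws where ws: "set ws \<subseteq> gens" "pr ws = g" "length ws = word_length \<Gamma> S g" using word_length_attained[OF assms(1)] by blast
  obtain vs where vs: "set vs \<subseteq> gens" "pr vs = h" "length vs = word_length \<Gamma> S h" using word_length_attained[OF assms(2)] by blast
  show ?thesis using word_length_le[of "ws @ vs"] pr_append[of ws vs] ws vs by simp
qed

text \<open>Letters have bounded length in the given generators and generators have representing
  words of bounded norm. The constant is the sum of both bounds, plus 1 for positivity.\<close>

lemma metric_comparison:
  "\<exists>c::nat>0. \<forall>u\<in>words_over s. \<forall>v\<in>words_over s.
     word_dist \<Gamma> S (\<phi> u) (\<phi> v) \<le> real c * real (nrm N q s (winv u @ v))
     \<and> real (nrm N q s (winv u @ v)) \<le> real c * word_dist \<Gamma> S (\<phi> u) (\<phi> v)"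
proof -
  define c1 where "c1 = (\<Sum>l\<in>{..<s} \<times> UNIV. word_length \<Gamma> S (\<phi> [l]))"
  have len: "word_length \<Gamma> S (\<phi> w) \<le> c1 * length w" if "w \<in> words_over s" for w using that
  proof (induction w)
    case Nil then show ?case using word_length_le[of "[]"] by (simp add: \<phi>_Nil)
  next
    case (Cons l w)
    have "word_length \<Gamma> S (\<phi> [l]) \<le> c1" unfolding c1_def
      using Cons.prems by (intro member_le_sum) (auto simp: mem_Times_iff)
    moreover have "word_length \<Gamma> S (\<phi> ([l] @ w)) \<le> word_length \<Gamma> S (\<phi> [l]) + word_length \<Gamma> S (\<phi> w)"
      using Cons.prems mult[of "[l]" w] word_length_mult[of "\<phi> [l]" "\<phi> w"] by simp
    ultimately show ?case using Cons by simp
  qed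
  define rp where "rp g = (SOME w. w \<in> words_over s \<and> \<phi> w = g)" for g
  have rp: "rp g \<in> words_over s \<and> \<phi> (rp g) = g" if "g \<in> carrier \<Gamma>" for g
  proof -
    have "\<exists>w. w \<in> words_over s \<and> \<phi> w = g" using that carrier by auto
    then show ?thesis unfolding rp_def by (rule someI_ex)
  qed
  define c2 where "c2 = (\<Sum>g\<in>gens. nrm N q s (rp g))"
  have nlen: "nrm N q s w \<le> c2 * length ws" if "set ws \<subseteq> gens" "w \<in> words_over s" "\<phi> w = pr ws" for ws w
    using that
  proof (induction ws arbitrary: w)
    case Nil
    then have "st N q [] = st N q w" using eq[of "[]" w] \<phi>_Nil by simp
    then show ?case using nrm_le[of "[]" s N q w] by simp
  next
    case (Cons g ws)
    have g: "g \<in> gens" "g \<in> carrier \<Gamma>" "pr ws \<in> carrier \<Gamma>" using Cons.prems gens(2) pr_in by auto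
    note r = rp[OF g(2)] rp[OF g(3)]
    have "\<phi> w = \<phi> (rp g @ rp (pr ws))" using Cons.prems r mult[of "rp g" "rp (pr ws)"] by simp
    then have "st N q w = st N q (rp g @ rp (pr ws))" using eq[of w "rp g @ rp (pr ws)"] Cons.prems r by simp
    then have "nrm N q s w = nrm N q s (rp g @ rp (pr ws))" by (rule nrm_cong)
    also have "\<dots> \<le> nrm N q s (rp g) + nrm N q s (rp (pr ws))"
      using r nrm_append[where s = s and N = N and q = q, OF s N_nonneg] by blast
    also have "\<dots> \<le> c2 + c2 * length ws"
      using Cons.IH[of "rp (pr ws)"] Cons.prems r member_le_sum[of g gens "\<lambda>g. nrm N q s (rp g)"] g gens(1)
      by (intro add_mono) (auto simp: c2_def)
    finally show ?case by simp
  qed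
  define c where "c = c1 + c2 + 1"
  have "word_dist \<Gamma> S (\<phi> u) (\<phi> v) \<le> real c * real (nrm N q s (winv u @ v))
     \<and> real (nrm N q s (winv u @ v)) \<le> real c * word_dist \<Gamma> S (\<phi> u) (\<phi> v)"
    if uv: "u \<in> words_over s" "v \<in> words_over s" for u v
  proof -
    let ?w = "winv u @ v"
    have w: "?w \<in> words_over s" using uv by simp
    have wd: "word_dist \<Gamma> S (\<phi> u) (\<phi> v) = real (word_length \<Gamma> S (\<phi> ?w))"
      using uv mult[of "winv u" v] \<phi>_winv[of u] by (simp add: word_dist_def)
    obtain t where t: "t \<in> words_over s" "length t = nrm N q s ?w" "st N q t = st N q ?w"
      using nrm_attained[OF w] by blast
    then have "\<phi> ?w = \<phi> t" using eq[OF w t(1)] by simp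
    then have 1: "word_length \<Gamma> S (\<phi> ?w) \<le> (c1 + c2 + 1) * nrm N q s ?w" using len[OF t(1)] t(2) by (simp add: algebra_simps)
    obtain ws where ws: "set ws \<subseteq> gens" "pr ws = \<phi> ?w" "length ws = word_length \<Gamma> S (\<phi> ?w)"
      using word_length_attained[of "\<phi> ?w"] w by auto
    have 2: "nrm N q s ?w \<le> (c1 + c2 + 1) * word_length \<Gamma> S (\<phi> ?w)"
      using nlen[OF ws(1) w ws(2)[symmetric]] ws(3) by (simp add: algebra_simps)
    show ?thesis unfolding wd c_def using 1 2 by (simp only: of_nat_mult[symmetric] of_nat_le_iff)
  qed
  moreover have "0 < c" by (simp add: c_def)
  ultimately show ?thesis by blast
qed

text \<open>A section \<open>rp\<close> of \<open>\<phi>\<close> pulls the pseudometric and the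
  families back to group elements and maps chains to chains.\<close>

lemma fam_to_cover:
  fixes c :: nat
  assumes "0 < c" and c: "\<forall>u\<in>words_over s. \<forall>v\<in>words_over s.
     word_dist \<Gamma> S (\<phi> u) (\<phi> v) \<le> real c * real (nrm N q s (winv u @ v))
     \<and> real (nrm N q s (winv u @ v)) \<le> real c * word_dist \<Gamma> S (\<phi> u) (\<phi> v)"
    and fam: "fam (wd N q s) (Suc p) (words_over s) p r R" and t: "2 * real c * t \<le> real r"
  obtains \<U> where "\<Union>\<U> = carrier \<Gamma>" "\<forall>U\<in>\<U>. \<forall>x\<in>U. \<forall>y\<in>U. word_dist \<Gamma> S x y \<le> real c * real R"
    "meets_at_most (carrier \<Gamma>) (word_dist \<Gamma> S) \<U> t p"
proof -
  interpret pm: pseudometric "wd N q s"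
    by (rule pseudometric_wd[where N = N and q = q and s = s, OF s N_nonneg])
  define rp where "rp g = (SOME w. w \<in> words_over s \<and> \<phi> w = g)" for g
  have rp: "rp g \<in> words_over s \<and> \<phi> (rp g) = g" if "g \<in> carrier \<Gamma>" for g
  proof -
    have "\<exists>w. w \<in> words_over s \<and> \<phi> w = g" using that carrier by auto
    then show ?thesis unfolding rp_def by (rule someI_ex)
  qed
  define \<delta> where "\<delta> g h = wd N q s (rp g) (rp h)" for g h
  interpret pd: pseudometric \<delta>
  proof
    fix x y z
    show "\<delta> x x = 0" by (simp add: \<delta>_def)
    show "\<delta> x y = \<delta> y x" unfolding \<delta>_def by (rule pm.dist_sym)
    show "\<delta> x z \<le> \<delta> x y + \<delta> y z" unfolding \<delta>_def by (rule pm.dist_tri)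
  qed
  obtain A where A1: "\<And>x. x \<in> words_over s \<Longrightarrow> card {i. i < Suc p \<and> x \<notin> A i} \<le> p"
    and A2: "\<And>i x y. i < Suc p \<Longrightarrow> chain (wd N q s) r (A i \<inter> words_over s) x y \<Longrightarrow> wd N q s x y \<le> R"
    using fam unfolding fam_def by blast
  have f: "fam \<delta> (Suc p) (carrier \<Gamma>) p r R" unfolding fam_def
  proof (intro exI conjI ballI allI impI)
    let ?A = "\<lambda>i. {g. rp g \<in> A i}"
    show "card {i. i < Suc p \<and> g \<notin> ?A i} \<le> p" if "g \<in> carrier \<Gamma>" for g
      using A1[of "rp g"] rp[OF that] by simp
    fix i x y assume i: "i < Suc p" and ch: "chain \<delta> r (?A i \<inter> carrier \<Gamma>) x y"
    have "chain (wd N q s) r (A i \<inter> words_over s) (rp x) (rp y)" using ch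
    proof (induction rule: chain.induct)
      case (start x) then show ?case using rp[of x] by (intro chain.start) simp
    next
      case (step x y z) then show ?case using rp[of z] by (intro chain.step[OF step.IH]) (auto simp: \<delta>_def)
    qed
    then show "\<delta> x y \<le> R" using A2[OF i] by (simp add: \<delta>_def)
  qed
  have cmp: "word_dist \<Gamma> S x y \<le> real c * real (\<delta> x y) \<and> real (\<delta> x y) \<le> real c * word_dist \<Gamma> S x y"
    if "x \<in> carrier \<Gamma>" "y \<in> carrier \<Gamma>" for x y
    using c[rule_format, of "rp x" "rp y"] rp that by (simp add: \<delta>_def wd_words_over)
  have "\<exists>\<U>. \<Union>\<U> = carrier \<Gamma> \<and> (\<forall>U\<in>\<U>. \<forall>x\<in>U. \<forall>y\<in>U. word_dist \<Gamma> S x y \<le> real c * real R)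
    \<and> meets_at_most (carrier \<Gamma>) (word_dist \<Gamma> S) \<U> t p"
    by (rule pd.fam_cover[OF f]) (use cmp assms(1) t in simp_all)
  then show ?thesis using that by (elim exE conjE)
qed

lemma asdim_leI:
  assumes "\<forall>r. fam (wd N q s) (Suc p) (words_over s) p r (R r)"
  shows "asdim_le (carrier \<Gamma>) (word_dist \<Gamma> S) p"
proof -
  obtain c :: nat where c: "0 < c" "\<forall>u\<in>words_over s. \<forall>v\<in>words_over s.
     word_dist \<Gamma> S (\<phi> u) (\<phi> v) \<le> real c * real (nrm N q s (winv u @ v))
     \<and> real (nrm N q s (winv u @ v)) \<le> real c * word_dist \<Gamma> S (\<phi> u) (\<phi> v)" using metric_comparison by blast
  show ?thesis unfolding asdim_le_def
  proof (intro allI impI)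
    fix t :: real assume "0 < t"
    have "2 * real c * t \<le> real (nat \<lceil>2 * real c * t\<rceil>)" by linarith
    obtain \<U> where \<U>: "\<Union>\<U> = carrier \<Gamma>"
      "\<forall>U\<in>\<U>. \<forall>x\<in>U. \<forall>y\<in>U. word_dist \<Gamma> S x y \<le> real c * real (R (nat \<lceil>2 * real c * t\<rceil>))"
      "meets_at_most (carrier \<Gamma>) (word_dist \<Gamma> S) \<U> t p"
      by (rule fam_to_cover[OF c assms[rule_format] \<open>2 * real c * t \<le> _\<close>])
    show "\<exists>\<U>. \<Union>\<U> = carrier \<Gamma> \<and> (\<exists>D. \<forall>U\<in>\<U>. \<forall>x\<in>U. \<forall>y\<in>U. word_dist \<Gamma> S x y \<le> D)
       \<and> meets_at_most (carrier \<Gamma>) (word_dist \<Gamma> S) \<U> t p"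
      by (intro exI conjI) (rule \<U>)+
  qed
qed

lemma asdim_AN_leI:
  assumes "\<forall>r. fam (wd N q s) (Suc p) (words_over s) p r (C * (r + 1))"
  shows "asdim_AN_le (carrier \<Gamma>) (word_dist \<Gamma> S) p"
proof -
  obtain c :: nat where c: "0 < c" "\<forall>u\<in>words_over s. \<forall>v\<in>words_over s.
     word_dist \<Gamma> S (\<phi> u) (\<phi> v) \<le> real c * real (nrm N q s (winv u @ v))
     \<and> real (nrm N q s (winv u @ v)) \<le> real c * word_dist \<Gamma> S (\<phi> u) (\<phi> v)" using metric_comparison by blast
  define C' where "C' = real c * real C * (2 * real c + 2) + 1"
  have C'0: "0 < C'" using c(1) by (simp add: C'_def add_nonneg_pos)
  show ?thesis unfolding asdim_AN_le_def
  proof (rule exI[of _ C'], intro conjI C'0 exI[of _ "1::real"] allI impI)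
    fix t :: real assume t: "1 \<le> t"
    let ?r = "nat \<lceil>2 * real c * t\<rceil>"
    have "2 * real c * t \<le> real ?r" by linarith
    obtain \<U> where \<U>: "\<Union>\<U> = carrier \<Gamma>"
      "\<forall>U\<in>\<U>. \<forall>x\<in>U. \<forall>y\<in>U. word_dist \<Gamma> S x y \<le> real c * real (C * (?r + 1))"
      "meets_at_most (carrier \<Gamma>) (word_dist \<Gamma> S) \<U> t p"
      by (rule fam_to_cover[OF c assms[rule_format] \<open>2 * real c * t \<le> _\<close>])
    have "0 \<le> 2 * real c * t" using c(1) t by simp
    then have "real (?r + 1) \<le> 2 * real c * t + 2" by linarith
    also have "\<dots> \<le> (2 * real c + 2) * t" using t by (simp add: algebra_simps)
    finally have "real c * real C * real (?r + 1) \<le> real c * real C * ((2 * real c + 2) * t)"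
      using c(1) by (intro mult_left_mono) auto
    also have "\<dots> \<le> C' * t" using t by (simp add: C'_def algebra_simps)
    finally have "real c * real (C * (?r + 1)) \<le> C' * t" by (simp only: of_nat_mult mult.assoc)
    then have "\<forall>U\<in>\<U>. \<forall>x\<in>U. \<forall>y\<in>U. word_dist \<Gamma> S x y \<le> C' * t"
      using order_trans[OF \<U>(2)[rule_format]] by simp
    then show "\<exists>\<U>. \<Union>\<U> = carrier \<Gamma> \<and> (\<forall>U\<in>\<U>. \<forall>x\<in>U. \<forall>y\<in>U. word_dist \<Gamma> S x y \<le> C' * t)
       \<and> meets_at_most (carrier \<Gamma>) (word_dist \<Gamma> S) \<U> t p"
      by (intro exI[of _ \<U>] conjI \<U>)
  qed simp
qed

text \<open>Neighbours in the grid are within \<open>r\<close>, whereas opposite faces are at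
  distance at least about \<open>\<rho> * sqrt p\<close>. As \<open>p\<close> does not enter
  \<open>r\<close>, a large \<open>p\<close> beats any prescribed ratio between mesh and
  radius.\<close>

lemma grid_obstruction:
  fixes d :: "nat \<Rightarrow> nat" and n \<rho> dm p m c :: nat
  assumes c: "0 < c" "\<forall>u\<in>words_over s. \<forall>v\<in>words_over s.
     word_dist \<Gamma> S (\<phi> u) (\<phi> v) \<le> real c * real (nrm N q s (winv u @ v))
     \<and> real (nrm N q s (winv u @ v)) \<le> real c * word_dist \<Gamma> S (\<phi> u) (\<phi> v)"
    and N0: "N 0 = 1" and inj: "inj_on d {2..<n}" and d1: "\<And>j. j \<in> {2..<n} \<Longrightarrow> 1 \<le> d j \<and> d j \<le> dm"
    and qd: "\<And>j. j \<in> {2..<n} \<Longrightarrow> q (int (d j)) = 0"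
    and Nd: "\<And>j. j \<in> {2..<n} \<Longrightarrow> N (int (d j)) = 0 \<or> 2 * (int \<rho>)\<^sup>2 * int p \<le> N (int (d j))"
    and n2: "2 \<le> n" and p: "0 < p"
    and D: "0 \<le> D" "(real c * D)\<^sup>2 < real (\<rho>\<^sup>2 * p)" and r: "real c * real (n * (4 * \<rho> + 4 * dm) + 2 * \<rho>) \<le> r"
    and cov: "\<Union>\<U> = carrier \<Gamma>" "\<forall>U\<in>\<U>. \<forall>x\<in>U. \<forall>y\<in>U. word_dist \<Gamma> S x y \<le> D"
    and mult: "meets_at_most (carrier \<Gamma>) (word_dist \<Gamma> S) \<U> r m"
  shows "n \<le> m"
proof -
  have d1': "\<And>j. j \<in> {2..<n} \<Longrightarrow> 1 \<le> d j" using d1 by blast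
  define g where "g u = grid n \<rho> d (\<lambda>j. int (u j))" for u
  have gw: "g u \<in> words_over s" for u unfolding g_def by (rule grid_words[where s = s and N = N and n = n and d = d, OF s N0 inj]) (rule d1')
  show ?thesis
  proof (rule grid_lower_bound[where g = "\<lambda>u. \<phi> (g u)", OF p _ _ _ cov(1) _ mult])
    show "\<phi> (g u) \<in> carrier \<Gamma>" for u using gw by simp
    show "word_dist \<Gamma> S (\<phi> (g u)) (\<phi> (g v)) \<le> r" if "\<And>j. j < n \<Longrightarrow> u j \<le> v j \<and> v j \<le> Suc (u j)" for u v
    proof -
      have "nrm N q s (winv (g u) @ g v) \<le> n * (4 * \<rho> + 4 * dm) + 2 * \<rho>" unfolding g_def
        by (rule grid_near[where s = s and N = N and n = n and d = d, OF s N0 inj _ _ n2]) (use that d1 in force)+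
      then have "real c * real (nrm N q s (winv (g u) @ g v)) \<le> real c * real (n * (4 * \<rho> + 4 * dm) + 2 * \<rho>)"
        using c(1) by (intro mult_left_mono) (simp_all only: of_nat_le_iff less_imp_le)
      then show ?thesis using c(2)[rule_format, OF gw gw, of u v] r by linarith
    qed
    show "D < word_dist \<Gamma> S (\<phi> (g u)) (\<phi> (g v))" if "j < n" "u j = 0" "v j = p" for u v j
    proof (rule ccontr)
      assume "\<not> ?thesis"
      then have "real c * word_dist \<Gamma> S (\<phi> (g u)) (\<phi> (g v)) \<le> real c * D" using c(1) by simp
      then have "real (nrm N q s (winv (g u) @ g v)) \<le> real c * D"
        using c(2)[rule_format, OF gw gw, of u v] by linarith
      then have "(real (nrm N q s (winv (g u) @ g v)))\<^sup>2 \<le> (real c * D)\<^sup>2" by (rule power_mono) simp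
      moreover have "\<rho>\<^sup>2 * p \<le> (nrm N q s (winv (g u) @ g v))\<^sup>2" unfolding g_def
        by (rule grid_far[where s = s and N = N and n = n and d = d, OF s N0 inj, of j]) (use that p qd Nd d1' in auto)
      then have "real (\<rho>\<^sup>2 * p) \<le> real ((nrm N q s (winv (g u) @ g v))\<^sup>2)" by (simp only: of_nat_le_iff)
      ultimately show False using D(2) by simp
    qed
    show "word_dist \<Gamma> S x y \<le> D" if "U \<in> \<U>" "x \<in> U" "y \<in> U" for U x y using cov(2) that by blast
  qed
qed

end

end

lemma two_mult_le_power: "2 * i \<le> 2 ^ i" for i :: nat
proof (induction i)
  case (Suc i)
  then show ?case by (cases i) auto
qed simp

lemma less_nat_ceiling: "x < real (nat \<lceil>x\<rceil> + 1)"
  by linarith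

section \<open>Both dimensions of a word group\<close>

context word_group
begin

context
  fixes k a b S
  assumes params: "N = Nz k a" "q = qz k a b" and S: "finite S" "S \<subseteq> carrier \<Gamma>" "generate \<Gamma> S = carrier \<Gamma>"
begin

text \<open>With \<open>\<rho> = 1\<close> the radius depends on \<open>c\<close> and
  \<open>k'\<close> only, and \<open>p\<close> is chosen after the mesh \<open>D\<close> is known.
  The indices \<open>j - 1\<close> run through the infinite orders 1 to \<open>k'\<close>.\<close>

lemma asdim_lower:
  assumes m: "asdim_le (carrier \<Gamma>) (word_dist \<Gamma> S) m" and k: "enat k' \<le> k"
  shows "k' + 2 \<le> m"
proof -
  obtain c :: nat where c: "0 < c" "\<forall>u\<in>words_over s. \<forall>v\<in>words_over s.
     word_dist \<Gamma> S (\<phi> u) (\<phi> v) \<le> real c * real (nrm N q s (winv u @ v))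
     \<and> real (nrm N q s (winv u @ v)) \<le> real c * word_dist \<Gamma> S (\<phi> u) (\<phi> v)" using metric_comparison[OF S] by blast
  let ?n = "k' + 2"
  let ?r = "real c * real (?n * (4 * 1 + 4 * ?n) + 2 * 1)"
  have "0 < ?r" using c(1) by (intro mult_pos_pos) (simp_all only: of_nat_0_less_iff add_gr_0, simp_all)
  from m[unfolded asdim_le_def, rule_format, OF this] obtain \<U> where
    ex: "\<Union>\<U> = carrier \<Gamma> \<and> (\<exists>D. \<forall>U\<in>\<U>. \<forall>x\<in>U. \<forall>y\<in>U. word_dist \<Gamma> S x y \<le> D)
      \<and> meets_at_most (carrier \<Gamma>) (word_dist \<Gamma> S) \<U> ?r m" by (rule exE)
  then have U: "\<Union>\<U> = carrier \<Gamma>" "meets_at_most (carrier \<Gamma>) (word_dist \<Gamma> S) \<U> ?r m" by simp_all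
  from ex have "\<exists>D. \<forall>U\<in>\<U>. \<forall>x\<in>U. \<forall>y\<in>U. word_dist \<Gamma> S x y \<le> D" by (elim conjE)
  then obtain D0 where D0: "\<forall>U\<in>\<U>. \<forall>x\<in>U. \<forall>y\<in>U. word_dist \<Gamma> S x y \<le> D0" by (rule exE)
  define D where "D = max 0 D0"
  define p where "p = nat \<lceil>(real c * D)\<^sup>2\<rceil> + 1"
  show ?thesis
  proof (rule grid_obstruction[OF S c, where d = "\<lambda>j. j - 1" and n = ?n and \<rho> = 1 and dm = ?n and p = p and D = D and \<U> = \<U> and r = ?r])
    show "N 0 = 1" by (simp add: params Nz_nonpos)
    show "inj_on (\<lambda>j. j - 1) {2..<?n}" by (auto simp: inj_on_def)
    fix j assume j: "j \<in> {2..<?n}"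
    then have "enat (j - 1) \<le> enat k'" by auto
    then have "enat (j - 1) \<le> k" using k by (rule order_trans)
    moreover have "q (int e) = 0 \<and> (1 \<le> e \<longrightarrow> N (int e) = 0)" if "enat e \<le> k" for e
      using that by (simp add: params Nz_def Nn_def qz_def qn_def blk_def not_less)
    ultimately show "q (int (j - 1)) = 0" "N (int (j - 1)) = 0 \<or> 2 * (int 1)\<^sup>2 * int p \<le> N (int (j - 1))"
      using j by fastforce+
  next
    show "(real c * D)\<^sup>2 < real (1\<^sup>2 * p)" using less_nat_ceiling[of "(real c * D)\<^sup>2"] by (simp add: p_def)
    show "\<forall>U\<in>\<U>. \<forall>x\<in>U. \<forall>y\<in>U. word_dist \<Gamma> S x y \<le> D"
    proof (intro ballI)
      fix U x y assume "U \<in> \<U>" "x \<in> U" "y \<in> U"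
      then have "word_dist \<Gamma> S x y \<le> D0" using D0 by simp
      then show "word_dist \<Gamma> S x y \<le> D" by (simp add: D_def)
    qed
  qed (use U in \<open>auto simp: D_def p_def\<close>)
qed

text \<open>Here the mesh is \<open>C\<close> times the radius, and the radius is
  \<open>\<kappa> * \<rho>\<close> with \<open>\<kappa>\<close> independent of
  \<open>\<rho>\<close>. Hence \<open>p\<close> can be fixed before the scale, and a late block
  \<open>i\<close> then provides orders of at least \<open>2 * p\<close> times the square of
  \<open>\<rho>\<close>.\<close>

lemma asdim_AN_lower:
  assumes m: "asdim_AN_le (carrier \<Gamma>) (word_dist \<Gamma> S) m" and k: "enat k' \<le> k"
    and f: "enat f \<le> min a b" "f = 0 \<or> k = enat k'"
  shows "k' + f + 2 \<le> m"
proof -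
  obtain c :: nat where c: "0 < c" "\<forall>u\<in>words_over s. \<forall>v\<in>words_over s.
     word_dist \<Gamma> S (\<phi> u) (\<phi> v) \<le> real c * real (nrm N q s (winv u @ v))
     \<and> real (nrm N q s (winv u @ v)) \<le> real c * word_dist \<Gamma> S (\<phi> u) (\<phi> v)" using metric_comparison[OF S] by blast
  let ?cov = "\<lambda>C r. \<exists>\<U>. \<Union>\<U> = carrier \<Gamma> \<and>
      (\<forall>U\<in>\<U>. \<forall>x\<in>U. \<forall>y\<in>U. word_dist \<Gamma> S x y \<le> C * r) \<and> meets_at_most (carrier \<Gamma>) (word_dist \<Gamma> S) \<U> r m"
  from m[unfolded asdim_AN_le_def] obtain C where "0 < C \<and> (\<exists>r0>0. \<forall>r\<ge>r0. ?cov C r)" by (rule exE)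
  then obtain r0 where C: "0 < C" "\<forall>r\<ge>r0. ?cov C r" by (elim conjE exE)
  define n where "n = k' + f + 2"
  define \<kappa> where "\<kappa> = c * (n * (4 + 4 * (2 ^ f + k')) + 2)"
  define p where "p = nat \<lceil>(real c * (C * real \<kappa>))\<^sup>2\<rceil> + 1"
  \<comment> \<open>The summand \<open>f\<close> makes \<open>f\<close> positions available in the
    block, \<open>k'\<close> puts the block beyond the infinite orders, \<open>2 * p\<close> yields
    \<open>2 * p \<le> 2 ^ i\<close> for the orders, and the last one makes the scale at least
    \<open>r0\<close>.\<close>
  define i where "i = f + k' + 1 + 2 * p + nat \<lceil>r0\<rceil>"
  define \<rho> where "\<rho> = (2::nat) ^ 2 ^ i"
  \<comment> \<open>Directions 0 and 1 are \<open>y\<close> and \<open>y'\<close>; the next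
    \<open>k'\<close> have infinite order, and the last \<open>f\<close> are the first positions of
    block \<open>i\<close>, whose indices are within the factor \<open>2 ^ f\<close> of
    \<open>\<rho>\<close>.\<close>
  define d where "d j = (if j < k' + 2 then j - 1 else 2 ^ (2 ^ i + (j - (k' + 2))))" for j
  define dm where "dm = \<rho> * (2 ^ f + k')"
  define r where "r = real c * real (n * (4 * \<rho> + 4 * dm) + 2 * \<rho>)"
  have i\<rho>: "i < 2 ^ i" "2 ^ i < \<rho>" by (simp_all add: \<rho>_def)
  have r\<kappa>: "r = real \<kappa> * real \<rho>"
  proof -
    have "c * (n * (4 * \<rho> + 4 * dm) + 2 * \<rho>) = \<kappa> * \<rho>" by (simp add: \<kappa>_def dm_def algebra_simps)
    then show ?thesis unfolding r_def by (simp only: of_nat_mult[symmetric])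
  qed
  have "1 * \<rho> \<le> \<kappa> * \<rho>" using c(1) by (intro mult_le_mono1) (simp add: \<kappa>_def)
  then have "real \<rho> \<le> r" unfolding r\<kappa> by (simp only: of_nat_mult[symmetric] of_nat_le_iff mult_1)
  moreover have "r0 \<le> real \<rho>"
  proof -
    have "nat \<lceil>r0\<rceil> \<le> i" unfolding i_def by (rule le_add2)
    then have "real (nat \<lceil>r0\<rceil>) \<le> real \<rho>" using i\<rho> by (simp only: of_nat_le_iff)
    moreover have "r0 \<le> real (nat \<lceil>r0\<rceil>)" by linarith
    ultimately show ?thesis by (rule order_trans[rotated])
  qed
  ultimately have "r0 \<le> r" by linarith
  from C(2)[rule_format, OF this] obtain \<U> where "\<Union>\<U> = carrier \<Gamma> \<and>
      (\<forall>U\<in>\<U>. \<forall>x\<in>U. \<forall>y\<in>U. word_dist \<Gamma> S x y \<le> C * r) \<and> meets_at_most (carrier \<Gamma>) (word_dist \<Gamma> S) \<U> r m" by (rule exE)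
  then have U: "\<Union>\<U> = carrier \<Gamma>" "\<forall>U\<in>\<U>. \<forall>x\<in>U. \<forall>y\<in>U. word_dist \<Gamma> S x y \<le> C * r"
    "meets_at_most (carrier \<Gamma>) (word_dist \<Gamma> S) \<U> r m" by simp_all
  have r0': "0 \<le> r" by (simp add: r_def)
  have block: "blk k a (d j) \<and> bpos (d j) = j - (k' + 2) \<and> bexp (d j) = 2 * 2 ^ i + (j - (k' + 2)) - i \<and> k' < d j"
    if j: "k' + 2 \<le> j" "j < n" for j
  proof -
    let ?c = "j - (k' + 2)"
    have cf: "?c < f" using j by (simp add: n_def)
    then have kk: "k = enat k'" using f(2) by auto
    have "k' < 2 ^ (2 ^ i + ?c)"
    proof -
      have "k' < i" by (simp add: i_def)
      then have "k' < 2 ^ 2 ^ i" using i\<rho> unfolding \<rho>_def by linarith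
      also have "(2::nat) ^ 2 ^ i \<le> 2 ^ (2 ^ i + ?c)" by (intro power_increasing) auto
      finally show ?thesis .
    qed
    moreover have "enat ?c < a" using f(1) cf by (meson enat_ord_simps(2) less_le_trans min.bounded_iff)
    moreover have "?c < i" using cf by (simp add: i_def)
    ultimately show ?thesis using blk_power[of ?c i a k] kk j by (simp add: d_def)
  qed
  have "n \<le> m"
  proof (rule grid_obstruction[OF S c, where d = d and n = n and \<rho> = \<rho> and dm = dm and p = p and D = "C * r" and \<U> = \<U> and r = r])
    show "N 0 = 1" by (simp add: params Nz_nonpos)
    show "inj_on d {2..<n}"
    proof (rule inj_onI)
      fix j j' assume j: "j \<in> {2..<n}" "j' \<in> {2..<n}" "d j = d j'"
      show "j = j'" using block[of j] block[of j'] j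
        by (cases "j < k' + 2"; cases "j' < k' + 2") (auto simp: d_def)
    qed
    fix j assume j: "j \<in> {2..<n}"
    show "1 \<le> d j \<and> d j \<le> dm"
    proof (cases "j < k' + 2")
      case True
      have "1 * k' \<le> \<rho> * (2 ^ f + k')" by (intro mult_le_mono) (simp_all add: \<rho>_def)
      then have "k' \<le> dm" by (simp add: dm_def)
      then show ?thesis using True j by (auto simp: d_def)
    next
      case False
      have "(2::nat) ^ (j - (k' + 2)) \<le> 2 ^ f" using j False by (intro power_increasing) (auto simp: n_def)
      then have "\<rho> * 2 ^ (j - (k' + 2)) \<le> \<rho> * (2 ^ f + k')" by (intro mult_le_mono2 trans_le_add1)
      moreover have "d j = \<rho> * 2 ^ (j - (k' + 2))" using False by (simp only: d_def if_False \<rho>_def power_add)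
      moreover have "1 \<le> \<rho> * 2 ^ (j - (k' + 2))" by (simp add: \<rho>_def)
      ultimately show ?thesis by (simp only: dm_def simp_thms)
    qed
    show "q (int (d j)) = 0"
    proof (cases "j < k' + 2")
      case True
      then have "enat (d j) \<le> enat k'" by (simp add: d_def)
      then have "enat (d j) \<le> k" using k by (rule order_trans)
      then show ?thesis by (simp add: params qz_def qn_def blk_def not_less)
    next
      case False
      then have "enat (bpos (d j)) < enat f" using block[of j] j by (auto simp: n_def)
      then have "\<not> b \<le> enat (bpos (d j))" using f(1) by (meson leD less_le_trans min.bounded_iff)
      then show ?thesis by (simp add: params qz_def qn_def)
    qed
    show "N (int (d j)) = 0 \<or> 2 * (int \<rho>)\<^sup>2 * int p \<le> N (int (d j))"
    proof (cases "j < k' + 2")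
      case True
      then have "enat (d j) \<le> enat k'" by (simp add: d_def)
      then have "enat (d j) \<le> k" using k by (rule order_trans)
      moreover have "d j \<noteq> 0" using True j by (auto simp: d_def)
      ultimately show ?thesis by (simp add: params Nz_def Nn_def)
    next
      case False
      then have bl: "blk k a (d j)" "bexp (d j) = 2 * 2 ^ i + (j - (k' + 2)) - i" "k' < d j" using block[of j] j by auto
      have Nd: "Nn k a (d j) = 2 ^ (2 * bexp (d j))" using bl by (auto simp: Nn_def blk_def not_le)
      have "2 * 2 ^ i + i \<le> 2 * bexp (d j)" using bl(2) two_mult_le_power[of i] i\<rho>(1) by linarith
      then have "(2::nat) ^ (2 * 2 ^ i + i) \<le> Nn k a (d j)" unfolding Nd by (intro power_increasing) auto
      moreover have "2 * p * \<rho>\<^sup>2 \<le> 2 ^ i * \<rho>\<^sup>2" using i\<rho>(1) by (intro mult_le_mono1) (simp add: i_def)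
      moreover have "2 ^ i * \<rho>\<^sup>2 = 2 ^ (2 * 2 ^ i + i)" by (simp add: \<rho>_def power_add power_mult[symmetric] mult.commute)
      ultimately have "2 * p * \<rho>\<^sup>2 \<le> Nn k a (d j)" by linarith
      then have "int (2 * p * \<rho>\<^sup>2) \<le> int (Nn k a (d j))" by (simp only: of_nat_le_iff)
      then show ?thesis by (simp add: params Nz_def mult_ac)
    qed
  next
    show "2 \<le> n" "0 < p" by (simp_all add: n_def p_def)
    show "0 \<le> C * r" using C(1) r0' by simp
    have "(real c * (C * real \<kappa>))\<^sup>2 < real p"
      using less_nat_ceiling[of "(real c * (C * real \<kappa>))\<^sup>2"] by (simp add: p_def)
    then have "(real c * (C * real \<kappa>))\<^sup>2 * (real \<rho>)\<^sup>2 < real p * (real \<rho>)\<^sup>2" by (intro mult_strict_right_mono) (simp_all add: \<rho>_def)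
    then show "(real c * (C * r))\<^sup>2 < real (\<rho>\<^sup>2 * p)" unfolding r\<kappa> by (simp add: power_mult_distrib mult_ac)
  qed (use U in \<open>auto simp: r_def\<close>)
  then show ?thesis by (simp add: n_def)
qed

end

lemma group_asdim_eq:
  assumes params: "N = Nz k a" "q = qz k a b"
  shows "group_asdim_eq \<Gamma> (k + 2)"
  unfolding group_asdim_eq_def asdim_def
proof (intro allI impI, elim conjE, rule Inf_enat_eqI)
  fix S assume S: "finite S" "S \<subseteq> carrier \<Gamma>" "generate \<Gamma> S = carrier \<Gamma>"
  show "asdim_le (carrier \<Gamma>) (word_dist \<Gamma> S) n" if kn: "k + 2 = enat n" for n
  proof -
    obtain k' where k': "k = enat k'" using kn by (cases k) auto
    then have n: "n = k' + 2" using kn by (simp add: numeral_eq_enat)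
    obtain R where "\<forall>r. fam (wd N q s) (Suc n) (words_over s) n r (R r)"
      using asdim_upper[OF s, of "Suc n" k' a b] n unfolding params k' by auto
    then show ?thesis by (rule asdim_leI[OF S])
  qed
  fix m assume "asdim_le (carrier \<Gamma>) (word_dist \<Gamma> S) m"
  note lower = asdim_lower[OF params S this]
  show "k + 2 \<le> enat m"
  proof (cases k)
    case (enat k') then show ?thesis using lower[of k'] by (simp add: numeral_eq_enat)
  next
    case infinity then show ?thesis using lower[of m] by simp
  qed
qed

lemma group_asdim_AN_eq:
  assumes params: "N = Nz k a" "q = qz k a b" and sb: "s = 4 \<or> s = 3 \<and> b = \<infinity>"
  shows "group_asdim_AN_eq \<Gamma> (k + min a b + 2)"
  unfolding group_asdim_AN_eq_def asdim_AN_def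
proof (intro allI impI, elim conjE, rule Inf_enat_eqI)
  fix S assume S: "finite S" "S \<subseteq> carrier \<Gamma>" "generate \<Gamma> S = carrier \<Gamma>"
  show "asdim_AN_le (carrier \<Gamma>) (word_dist \<Gamma> S) n" if kn: "k + min a b + 2 = enat n" for n
  proof -
    obtain k' where k': "k = enat k'" using kn by (cases k) auto
    obtain f where f: "min a b = enat f" using kn by (cases "min a b") auto
    have n: "n = k' + f + 2" using kn by (simp add: numeral_eq_enat k' f)
    obtain C where "\<forall>r. fam (wd N q s) (Suc n) (words_over s) n r (C * (r + 1))"
      using asdim_AN_upper[OF sb _ f, of "Suc n" k'] n unfolding params k' by auto
    then show ?thesis by (rule asdim_AN_leI[OF S])
  qed
  fix m assume "asdim_AN_le (carrier \<Gamma>) (word_dist \<Gamma> S) m"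
  note lower = asdim_AN_lower[OF params S this]
  show "k + min a b + 2 \<le> enat m"
  proof (cases k)
    case k': (enat k')
    show ?thesis
    proof (cases "min a b")
      case (enat f) then show ?thesis using lower[of k' f] k' by (simp add: numeral_eq_enat)
    next
      case infinity then show ?thesis using lower[of k' m] k' by simp
    qed
  next
    case infinity then show ?thesis using lower[of m 0] by (simp add: zero_enat_def[symmetric])
  qed
qed

end

subsection \<open>The groups\<close>

lemma pres_class_eq: "pres_class R u = pres_class R v \<longleftrightarrow> pres_eq R u v"
  unfolding pres_class_def by (auto intro: pres_eq.intros pres_eq.trans pres_eq.sym)

lemma pres_mult:
  "pres_class R u \<otimes>\<^bsub>pres_group s R\<^esub> pres_class R v = pres_class R (u @ v)"
proof -
  have "(\<exists>a\<in>pres_class R u. \<exists>b\<in>pres_class R v. pres_eq R (a @ b) w) \<longleftrightarrow> pres_eq R (u @ v) w" for w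
  proof
    assume "\<exists>a\<in>pres_class R u. \<exists>b\<in>pres_class R v. pres_eq R (a @ b) w"
    then obtain a b where "pres_eq R u a" "pres_eq R v b" "pres_eq R (a @ b) w" by (auto simp: pres_class_def)
    then show "pres_eq R (u @ v) w" using pres_eq_append pres_eq.trans by blast
  next
    assume "pres_eq R (u @ v) w"
    then show "\<exists>a\<in>pres_class R u. \<exists>b\<in>pres_class R v. pres_eq R (a @ b) w"
      using pres_eq.refl[of R u] pres_eq.refl[of R v] by (auto simp: pres_class_def)
  qed
  then show ?thesis by (simp add: pres_group_def) (simp add: pres_class_def)
qed

lemma group_pres_group: "group (pres_group s R)"
proof -
  let ?G = "pres_group s R"
  have carr: "carrier ?G = pres_class R ` words_over s" and one: "\<one>\<^bsub>?G\<^esub> = pres_class R []"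
    by (simp_all add: pres_group_def)
  show ?thesis
  proof (rule groupI)
    fix x y assume "x \<in> carrier ?G" "y \<in> carrier ?G"
    then show "x \<otimes>\<^bsub>?G\<^esub> y \<in> carrier ?G" unfolding carr by (auto simp: pres_mult)
  next
    show "\<one>\<^bsub>?G\<^esub> \<in> carrier ?G" by (simp add: carr one)
  next
    fix x y z assume "x \<in> carrier ?G" "y \<in> carrier ?G" "z \<in> carrier ?G"
    then show "x \<otimes>\<^bsub>?G\<^esub> y \<otimes>\<^bsub>?G\<^esub> z = x \<otimes>\<^bsub>?G\<^esub> (y \<otimes>\<^bsub>?G\<^esub> z)" unfolding carr by (auto simp: pres_mult)
  next
    fix x assume "x \<in> carrier ?G"
    then obtain u where u: "u \<in> words_over s" "x = pres_class R u" by (auto simp: carr)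
    show "\<one>\<^bsub>?G\<^esub> \<otimes>\<^bsub>?G\<^esub> x = x" by (simp add: u one pres_mult)
    have "pres_class R (winv u) \<in> carrier ?G" using u by (simp add: carr)
    moreover have "pres_class R (winv u) \<otimes>\<^bsub>?G\<^esub> x = \<one>\<^bsub>?G\<^esub>"
      by (simp add: u one pres_mult pres_class_eq pres_eq_cancel_left)
    ultimately show "\<exists>y\<in>carrier ?G. y \<otimes>\<^bsub>?G\<^esub> x = \<one>\<^bsub>?G\<^esub>" by blast
  qed
qed

lemma word_group_pres_group:
  assumes "s = 3 \<or> s = 4" "\<And>d. 0 \<le> N d"
  shows "word_group (pres_group s (rels s N q)) (pres_class (rels s N q)) s N q"
proof (rule word_group.intro)
  show "group (pres_group s (rels s N q))" by (rule group_pres_group)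
  show "carrier (pres_group s (rels s N q)) = pres_class (rels s N q) ` words_over s" by (simp add: pres_group_def)
  show "pres_class (rels s N q) (u @ v) = pres_class (rels s N q) u \<otimes>\<^bsub>pres_group s (rels s N q)\<^esub> pres_class (rels s N q) v" for u v
    by (simp add: pres_mult)
  show "pres_class (rels s N q) u = pres_class (rels s N q) v \<longleftrightarrow> st N q u = st N q v"
    if "u \<in> words_over s" "v \<in> words_over s" for u v
    unfolding pres_class_eq by (rule rels_complete[where N = N and q = q and s = s, OF HOL.refl assms that])
qed (use assms in auto)

text \<open>Both groups are the words modulo the same invariant, so sending \<open>\<phi> u\<close>
  to \<open>\<psi> u\<close> is well defined and injective.\<close>

lemma word_group_iso:
  assumes "word_group \<Gamma> \<phi> s N q" "word_group \<Delta> \<psi> s N q"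
  shows "is_iso \<Gamma> \<Delta>"
proof -
  interpret G: word_group \<Gamma> \<phi> s N q by fact
  interpret D: word_group \<Delta> \<psi> s N q by fact
  define h where "h g = \<psi> (SOME w. w \<in> words_over s \<and> \<phi> w = g)" for g
  have h: "h (\<phi> u) = \<psi> u" if u: "u \<in> words_over s" for u
  proof -
    have "\<exists>w. w \<in> words_over s \<and> \<phi> w = \<phi> u" using u by blast
    then have w: "(SOME w. w \<in> words_over s \<and> \<phi> w = \<phi> u) \<in> words_over s \<and> \<phi> (SOME w. w \<in> words_over s \<and> \<phi> w = \<phi> u) = \<phi> u"
      by (rule someI_ex)
    then show ?thesis unfolding h_def using G.eq[of _ u] D.eq[of _ u] u by blast
  qed
  have "h \<in> iso \<Gamma> \<Delta>"
  proof (rule isoI)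
    show "h \<in> hom \<Gamma> \<Delta>"
    proof (rule homI)
      fix x assume "x \<in> carrier \<Gamma>" then show "h x \<in> carrier \<Delta>" using h by (auto simp: G.carrier D.carrier)
    next
      fix x y assume "x \<in> carrier \<Gamma>" "y \<in> carrier \<Gamma>"
      then obtain u v where "u \<in> words_over s" "v \<in> words_over s" "x = \<phi> u" "y = \<phi> v" by (auto simp: G.carrier)
      then show "h (x \<otimes>\<^bsub>\<Gamma>\<^esub> y) = h x \<otimes>\<^bsub>\<Delta>\<^esub> h y" by (simp add: G.mult[symmetric] D.mult[symmetric] h)
    qed
    show "bij_betw h (carrier \<Gamma>) (carrier \<Delta>)"
      unfolding bij_betw_def
    proof
      show "inj_on h (carrier \<Gamma>)" by (rule inj_onI) (auto simp: G.carrier h G.eq D.eq)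
      show "h ` carrier \<Gamma> = carrier \<Delta>" using h by (force simp: G.carrier D.carrier image_iff)
    qed
  qed
  then show ?thesis by (auto simp: is_iso_def)
qed

lemma fg_rec_presented_word_group:
  assumes "word_group \<Gamma> \<phi> s (Nz k a) (qz k a b)"
  shows "fg_rec_presented \<Gamma>"
  unfolding fg_rec_presented_def
proof (intro conjI exI)
  interpret G: word_group \<Gamma> \<phi> s "Nz k a" "qz k a b" by fact
  let ?R = "rels s (Nz k a) (qz k a b)"
  show "group \<Gamma>" "fin_generated \<Gamma>" by (rule G.group, rule G.fin_generated)
  show "rec_presentation s ?R" unfolding rec_presentation_def using rels_re rels_words_over[OF G.s] by blast
  show "is_iso \<Gamma> (pres_group s ?R)"
    by (rule word_group_iso[OF assms word_group_pres_group[OF G.s Nz_nonneg]])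
qed

lemma st_eq_words_over_3:
  assumes "u \<in> words_over 3" "v \<in> words_over 3"
  shows "st N q u = st N q v \<longleftrightarrow> st N q' u = st N q' v"
proof -
  have "cent q w = cent q' w" if "w \<in> words_over 3" for w
  proof
    show "cent q w d = cent q' w d" for d using that
      by (induction q w d rule: cent.induct) auto
  qed
  then show ?thesis using assms by (simp add: st_def)
qed

text \<open>The weight \<open>q\<close> enters only through letters \<open>w'\<close>, so on words
  without them any \<open>q'\<close> gives the same equality. Choosing a \<open>q'\<close> that
  collapses nothing identifies the subgroup with the group on three generators and the same
  orders.\<close>

lemma subgroup_words_over_3:
  assumes "word_group \<Gamma> \<phi> 4 N q"
  shows "subgroup (\<phi> ` words_over 3) \<Gamma>" "word_group (\<Gamma>\<lparr>carrier := \<phi> ` words_over 3\<rparr>) \<phi> 3 N q'"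
proof -
  interpret G: word_group \<Gamma> \<phi> 4 N q by fact
  interpret group \<Gamma> by (rule G.group)
  have sub: "u \<in> words_over 4" if "u \<in> words_over 3" for u using that by (auto simp: words_over_def)
  show sg: "subgroup (\<phi> ` words_over 3) \<Gamma>"
  proof (rule subgroupI)
    show "\<phi> ` words_over 3 \<subseteq> carrier \<Gamma>" using sub by auto
    show "\<phi> ` words_over 3 \<noteq> {}" by (metis empty_iff imageI words_over_simps(1))
    fix x assume "x \<in> \<phi> ` words_over 3"
    then obtain u where "u \<in> words_over 3" "x = \<phi> u" by auto
    then show "inv\<^bsub>\<Gamma>\<^esub> x \<in> \<phi> ` words_over 3" using G.\<phi>_winv[of u] sub[of u] by (auto intro!: image_eqI[of _ \<phi> "winv u"])
  next
    fix x y assume "x \<in> \<phi> ` words_over 3" "y \<in> \<phi> ` words_over 3"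
    then obtain u v where uv: "u \<in> words_over 3" "x = \<phi> u" "v \<in> words_over 3" "y = \<phi> v" by auto
    then show "x \<otimes>\<^bsub>\<Gamma>\<^esub> y \<in> \<phi> ` words_over 3" using G.mult[of u v] sub[of u] sub[of v] by (auto intro!: image_eqI[of _ \<phi> "u @ v"])
  qed
  show "word_group (\<Gamma>\<lparr>carrier := \<phi> ` words_over 3\<rparr>) \<phi> 3 N q'"
  proof (rule word_group.intro)
    show "group (\<Gamma>\<lparr>carrier := \<phi> ` words_over 3\<rparr>)" by (rule subgroup_imp_group[OF sg])
    show "\<phi> u = \<phi> v \<longleftrightarrow> st N q' u = st N q' v" if "u \<in> words_over 3" "v \<in> words_over 3" for u v
      using G.eq[OF sub sub, OF that] st_eq_words_over_3[OF that, of N q q'] by simp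
  qed (use G.mult sub G.N_nonneg in auto)
qed

theorem mainTheorem1:
  fixes k m n :: enat
  assumes "4 \<le> k" and "k \<le> m" and "m \<le> n"
  shows "\<exists>(G :: word set monoid) H.
           fg_rec_presented G \<and> subgroup H G \<and> fg_rec_presented (G\<lparr>carrier := H\<rparr>) \<and>
           group_asdim_eq G k \<and> group_asdim_AN_eq G m \<and>
           group_asdim_AN_eq (G\<lparr>carrier := H\<rparr>) n"
proof -
  \<comment> \<open>If \<open>k\<close> is infinite then so are \<open>m\<close> and \<open>n\<close>, and \<open>a\<close>, \<open>b\<close> are irrelevant.\<close>
  define k0 a b where "k0 = k - 2" and "a = n - k" and "b = m - k"
  \<comment> \<open>The two trees account for the summand 2. Each block offers \<open>n - k\<close>
    positions, up to its length, all of which count in the subgroup; the first \<open>m - k\<close>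
    of them are left uncollapsed in the larger group.\<close>
  have dims: "k0 + 2 = k" "k0 + min a b + 2 = m" "k0 + min a \<infinity> + 2 = n"
    using assms unfolding k0_def a_def b_def
    by (cases k; cases m; cases n; auto simp: numeral_eq_enat min_def)+
  let ?R = "rels 4 (Nz k0 a) (qz k0 a b)"
  let ?G = "pres_group 4 ?R" and ?H = "pres_class ?R ` words_over 3"
  have G: "word_group ?G (pres_class ?R) 4 (Nz k0 a) (qz k0 a b)"
    by (rule word_group_pres_group) (simp_all add: Nz_nonneg)
  note H = subgroup_words_over_3(1)[OF G] subgroup_words_over_3(2)[OF G, where q' = "qz k0 a \<infinity>"]
  have "group_asdim_eq ?G k"
    using word_group.group_asdim_eq[OF G HOL.refl HOL.refl] unfolding dims .
  moreover have "group_asdim_AN_eq ?G m"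
    using word_group.group_asdim_AN_eq[OF G HOL.refl HOL.refl] unfolding dims by simp
  moreover have "group_asdim_AN_eq (?G\<lparr>carrier := ?H\<rparr>) n"
    using word_group.group_asdim_AN_eq[OF H(2) HOL.refl HOL.refl] unfolding dims by simp
  ultimately show ?thesis
    using fg_rec_presented_word_group[OF G] fg_rec_presented_word_group[OF H(2)] H(1) by blast
qed

end
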